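(* Let $0<\alpha<2$ and $\lambda>0$, let $\tilde\sigma$ be a finite symmetric measure on $S^{2d-1}\subset\mathbb{R}^{2d}$ that is not concentrated on any $(2d-1)$-dimensional subspace of $\mathbb{R}^{2d}$, and let $\mathbb{M}_\lambda^{\mathbb{C}}$ be the associated $\mathbb{C}^d$-valued exponentially tempered stable independently scattered random measure on $\mathbb{R}^n$ (with Lebesgue measure). Let $E\in Q(\mathbb{R}^n)$, denote its trace by $q$ and the smallest real part of its eigenvalues by $a$. Let $\varphi:\mathbb{R}^n\to[0,\infty)$ be a continuous and $E^*$-homogeneous function fulfilling $\varphi(x)>0$ for all $x\in\mathbb{R}^n\setminus\{0\}$. Let $D\in L(\mathbb{R}^d)$, and let $h$ and $H$ denote the minimum and the maximum of the real parts of the eigenvalues of $D$, respectively. Assume $$q\left(\frac12-\frac1\alpha\right)<h\le H<a.$$ Then the random field $\mathbb{Y}=\{Y(t):t\in\mathbb{R}^n\}$ defined by $$Y(t)=\operatorname{Re}\int_{\mathbb{R}^n}\left(e^{\mathrm{i}\langle t,s\rangle}-1\right)\varphi(s)^{-D-\frac q\alpha I}\,\mathbb{M}_\lambda^{\mathbb{C}}(ds)$$ exists. Furthermore: (a) $\mathbb{Y}$ is tempered stable, i.e. all its finite-dimensional distributions are tempered $\alpha$-stable. (b) $\mathbb{Y}$ is stochastically continuous. (c) $Y(t)$ is full for every $t\neq0$.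
   Context: Notation: $L(\mathbb{R}^m)$ is the space of real $m\times m$ matrices, $I=I_d$ the identity on $\mathbb{R}^d$, $E^*$ the adjoint (transpose) of $E$, $\|\cdot\|$ the Euclidean norm. $Q(\mathbb{R}^m)$ is the set of $E\in L(\mathbb{R}^m)$ all of whose eigenvalues have strictly positive real part. For $c>0$ and a matrix $B$, $c^B:=\exp((\log c)B)$ (matrix exponential). A function $\varphi$ on $\mathbb{R}^n$ is $E^*$-homogeneous if $\varphi(c^{E^*}x)=c\,\varphi(x)$ for all $c>0$, $x\neq0$. A random vector is full if its law is not concentrated on any hyperplane. A tempered $\alpha$-stable ($T\alpha S$) distribution on $\mathbb{R}^m$ is an infinitely divisible law without Gaussian part whose Lévy measure in polar coordinates is $\phi(dr,d\theta)=r^{-\alpha-1}q_0(r,\theta)\,dr\,\sigma_0(d\theta)$, with $\sigma_0$ a finite measure on $S^{m-1}$ and $q_0:(0,\infty)\times S^{m-1}\to(0,\infty)$ Borel such that for every $\theta$: $(-1)^k\frac{\partial^k}{\partial r^k}q_0(r,\theta)>0$ for all $r>0$, $k\in\mathbb{N}$, and $\lim_{r\to\infty}q_0(r,\theta)=0$. Random measure: let $\tilde\phi_\lambda(A)=\int_{S^{2d-1}}\int_0^\infty\mathbf{1}_A(r\theta)r^{-\alpha-1}e^{-\lambda r}\,dr\,\tilde\sigma(d\theta)$ for Borel $A\subset\mathbb{R}^{2d}$ and $\tilde\psi_\lambda(w)=\int_{\mathbb{R}^{2d}}(\cos\langle w,x\rangle-1)\tilde\phi_\lambda(dx)$. $\widetilde{\mathbb{M}}_\lambda$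 is a family of $\mathbb{R}^{2d}$-valued random vectors $\widetilde{\mathbb{M}}_\lambda(A)$, indexed by Borel sets $A\subset\mathbb{R}^n$ of finite Lebesgue measure $|A|$, independent over disjoint sets, a.s. $\sigma$-additive over disjoint sequences whose union has finite measure, and such that $\widetilde{\mathbb{M}}_\lambda(A)$ has log-characteristic function $|A|\tilde\psi_\lambda$. $\mathbb{M}_\lambda^{\mathbb{C}}$ is the $\mathbb{C}^d$-valued random measure obtained from $\widetilde{\mathbb{M}}_\lambda$ by identifying $\mathbb{R}^{2d}$ with $\mathbb{C}^d$ (first $d$ coordinates real part, last $d$ imaginary part). Stochastic integral: for simple $f=\sum_jD_j\mathbf{1}_{A_j}$ with $D_j\in L(\mathbb{R}^{2d})$ put $I(f)=\sum_jD_j\widetilde{\mathbb{M}}_\lambda(A_j)$. A measurable $f:\mathbb{R}^n\to L(\mathbb{R}^{2d})$ belongs to $\mathcal{I}(\widetilde{\mathbb{M}}_\lambda)$ if there are simple $f_k\to f$ a.e. such that $I(f_k\mathbf{1}_A)$ converges in probability for every Borel $A$; then $I(f)=\int f\,d\widetilde{\mathbb{M}}_\lambda=\lim I(f_k)$. Known facts: $f\in\mathcal{I}(\widetilde{\mathbb{M}}_\lambda)$ iff $\int_{\mathbb{R}^n}\int_{\mathbb{R}^{2d}}(1\wedge\|f(s)x\|^2)\tilde\phi_\lambda(dx)ds<\infty$ (this may be taken as the definition); $I$ is linear; $(I(f_1),\dots,I(f_k))^t$ has log-characteristic function $(w_1,\dots,w_k)^t\mapsto\int_{\mathbb{R}^n}\tilde\psi_\lambda(\sum_jf_j(s)^*w_j)ds$.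 For measurable $g:\mathbb{R}^n\to L(\mathbb{C}^d)$ (complex $d\times d$ matrices), $\operatorname{Re}\int g\,d\mathbb{M}_\lambda^{\mathbb{C}}$ exists iff $\tilde g:=\begin{pmatrix}\operatorname{Re}g&-\operatorname{Im}g\\0&0\end{pmatrix}\in\mathcal{I}(\widetilde{\mathbb{M}}_\lambda)$, and then it is the $\mathbb{R}^d$-valued vector of the first $d$ coordinates of $\int\tilde g\,d\widetilde{\mathbb{M}}_\lambda$. Integrands need only be defined for Lebesgue-almost every $s$. *)

theory Defs
  imports "HOL-Probability.Probability"
begin

section \<open>Eigenvalues and matrix powers\<close>

definition eigenvalues :: "real^'n^'n \<Rightarrow> complex set" where
  "eigenvalues A = {z. \<exists>v::complex^'n. v \<noteq> 0 \<and> map_matrix complex_of_real A *v v = z *s v}"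

definition Q_matrix :: "real^'n^'n \<Rightarrow> bool" where
  "Q_matrix A \<longleftrightarrow> (\<forall>z\<in>eigenvalues A. Re z > 0)"

primrec mat_pow :: "real^'n^'n \<Rightarrow> nat \<Rightarrow> real^'n^'n" where
  "mat_pow A 0 = mat 1"
| "mat_pow A (Suc k) = A ** mat_pow A k"

definition mat_exp :: "real^'n^'n \<Rightarrow> real^'n^'n" where
  "mat_exp A = (\<Sum>k. (1 / fact k) *\<^sub>R mat_pow A k)"

text \<open>Meant for positive \<open>c\<close>; since \<open>ln 0 = 0\<close> in the library, the value at \<open>c = 0\<close> is the identity.\<close>

definition mat_powr :: "real \<Rightarrow> real^'n^'n \<Rightarrow> real^'n^'n" where
  "mat_powr c B = mat_exp (ln c *\<^sub>R B)"

definition adjoint_homogeneous :: "real^'n^'n \<Rightarrow> (real^'n \<Rightarrow> real) \<Rightarrow> bool" where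
  "adjoint_homogeneous E \<phi> \<longleftrightarrow>
     (\<forall>c>0. \<forall>x. x \<noteq> 0 \<longrightarrow> \<phi> (mat_powr c (transpose E) *v x) = c * \<phi> x)"


section \<open>Infinitely divisible and tempered stable laws\<close>

definition char_fun :: "'a::euclidean_space measure \<Rightarrow> 'a \<Rightarrow> complex" where
  "char_fun \<mu> w = (CLINT x|\<mu>. iexp (w \<bullet> x))"

definition borel_prob :: "'a::euclidean_space measure \<Rightarrow> bool" where
  "borel_prob \<mu> \<longleftrightarrow> prob_space \<mu> \<and> sets \<mu> = sets borel"

definition infinitely_divisible :: "'a::euclidean_space measure \<Rightarrow> bool" where
  "infinitely_divisible \<mu> \<longleftrightarrow> borel_prob \<mu> \<and>
     (\<forall>n>0. \<exists>\<nu>. borel_prob \<nu> \<and> (\<forall>w. char_fun \<mu> w = char_fun \<nu> w ^ n))"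

definition levy_measure :: "'a::euclidean_space measure \<Rightarrow> bool" where
  "levy_measure \<nu> \<longleftrightarrow> sets \<nu> = sets borel \<and> emeasure \<nu> {0} = 0 \<and>
     (\<integral>\<^sup>+x. ennreal (min 1 ((norm x)\<^sup>2)) \<partial>\<nu>) < \<infinity>"

text \<open>The Levy-Khintchine representation with drift \<open>\<gamma>\<close>, Gaussian covariance operator \<open>C\<close> and
  Levy measure \<open>\<nu>\<close>.\<close>

definition has_levy_triplet ::
  "'a::euclidean_space measure \<Rightarrow> 'a \<Rightarrow> ('a \<Rightarrow> 'a) \<Rightarrow> 'a measure \<Rightarrow> bool" where
  "has_levy_triplet \<mu> \<gamma> C \<nu> \<longleftrightarrow>
     linear C \<and> (\<forall>x y. C x \<bullet> y = x \<bullet> C y) \<and> (\<forall>x. 0 \<le> x \<bullet> C x) \<and>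
     levy_measure \<nu> \<and>
     (\<forall>w. char_fun \<mu> w = exp (\<i> * of_real (w \<bullet> \<gamma>) - of_real (w \<bullet> C w) / 2 +
        (CLINT x|\<nu>. iexp (w \<bullet> x) - 1 - \<i> * of_real ((w \<bullet> x) * indicator (cball 0 1) x))))"

definition sphere_measure :: "'a::euclidean_space measure \<Rightarrow> bool" where
  "sphere_measure \<sigma> \<longleftrightarrow> finite_measure \<sigma> \<and> sets \<sigma> = sets (restrict_space borel (sphere 0 1))"

text \<open>The Borel measure given in polar coordinates by
  \<open>r powr (-\<alpha>-1) * p r \<theta> dr \<sigma>(d\<theta>)\<close>, where \<open>r > 0\<close> and \<open>\<theta>\<close> is in the unit sphere.\<close>

definition polar_measure ::
  "real \<Rightarrow> (real \<Rightarrow> 'a \<Rightarrow> real) \<Rightarrow> 'a::euclidean_space measure \<Rightarrow> 'a measure" where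
  "polar_measure \<alpha> p \<sigma> =
     distr (density (\<sigma> \<Otimes>\<^sub>M lborel)
              (\<lambda>(\<theta>, r). indicator {0<..} r * ennreal (r powr (- \<alpha> - 1) * p r \<theta>)))
           borel (\<lambda>(\<theta>, r). r *\<^sub>R \<theta>)"

definition tempering_function :: "(real \<Rightarrow> 'a::euclidean_space \<Rightarrow> real) \<Rightarrow> bool" where
  "tempering_function p \<longleftrightarrow>
     (\<lambda>(r, \<theta>). p r \<theta>) \<in> borel_measurable (restrict_space borel ({0<..} \<times> sphere 0 1)) \<and>
     (\<forall>\<theta>\<in>sphere 0 1.
        (\<forall>k. \<forall>r>0. (deriv ^^ k) (\<lambda>r. p r \<theta>) differentiable (at r) \<and>
                   (-1) ^ k * (deriv ^^ k) (\<lambda>r. p r \<theta>) r > 0) \<and>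
        ((\<lambda>r. p r \<theta>) \<longlongrightarrow> 0) at_top)"

definition tempered_stable :: "real \<Rightarrow> 'a::euclidean_space measure \<Rightarrow> bool" where
  "tempered_stable \<alpha> \<mu> \<longleftrightarrow> infinitely_divisible \<mu> \<and>
     (\<exists>\<gamma> \<sigma> p. sphere_measure \<sigma> \<and> tempering_function p \<and>
        has_levy_triplet \<mu> \<gamma> (\<lambda>_. 0) (polar_measure \<alpha> p \<sigma>))"

definition full :: "'a::euclidean_space measure \<Rightarrow> bool" where
  "full \<mu> \<longleftrightarrow> (\<forall>v c. v \<noteq> 0 \<longrightarrow> \<not> (AE x in \<mu>. v \<bullet> x = c))"


section \<open>The random measure\<close>

text \<open>\<open>real^('d + 'd)\<close> plays the role of the real space of dimension \<open>2d\<close>: the indices \<open>Inl i\<close>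
  are the first \<open>d\<close> coordinates, the indices \<open>Inr i\<close> the last \<open>d\<close> ones.\<close>

definition realify :: "complex^'d \<Rightarrow> real^('d + 'd)" where
  "realify z = (\<chi> k. case k of Inl i \<Rightarrow> Re (z $ i) | Inr i \<Rightarrow> Im (z $ i))"

definition not_in_hyperspace :: "(real^'m) measure \<Rightarrow> bool" where
  "not_in_hyperspace \<sigma> \<longleftrightarrow>
     (\<forall>V. subspace V \<and> dim V = CARD('m) - 1 \<longrightarrow> \<not> (AE \<theta> in \<sigma>. \<theta> \<in> V))"

definition symmetric_measure :: "'a::euclidean_space measure \<Rightarrow> bool" where
  "symmetric_measure \<sigma> \<longleftrightarrow> (\<forall>A\<in>sets \<sigma>. emeasure \<sigma> (uminus ` A) = emeasure \<sigma> A)"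

definition exp_tempered_levy ::
  "real \<Rightarrow> real \<Rightarrow> 'a::euclidean_space measure \<Rightarrow> 'a measure" where
  "exp_tempered_levy \<alpha> l \<sigma> = polar_measure \<alpha> (\<lambda>r \<theta>. exp (- l * r)) \<sigma>"

definition exp_tempered_psi ::
  "real \<Rightarrow> real \<Rightarrow> 'a::euclidean_space measure \<Rightarrow> 'a \<Rightarrow> real" where
  "exp_tempered_psi \<alpha> l \<sigma> w = (LINT x|exp_tempered_levy \<alpha> l \<sigma>. cos (w \<bullet> x) - 1)"

definition finite_borel :: "(real^'n) set set" where
  "finite_borel = {A \<in> sets borel. emeasure lborel A < \<infinity>}"

text \<open>Independence is required for disjoint sequences; as the sets may be empty, this covers
  finite disjoint families.\<close>

definition indep_scattered ::
  "'w measure \<Rightarrow> ((real^'n) set \<Rightarrow> 'w \<Rightarrow> 'a::euclidean_space) \<Rightarrow> ('a \<Rightarrow> real) \<Rightarrow> bool" where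
  "indep_scattered P M \<psi> \<longleftrightarrow> prob_space P \<and>
     (\<forall>A\<in>finite_borel. M A \<in> borel_measurable P) \<and>
     (\<forall>A::nat \<Rightarrow> (real^'n) set. disjoint_family A \<and> range A \<subseteq> finite_borel \<longrightarrow>
        prob_space.indep_vars P (\<lambda>_. borel) (\<lambda>i. M (A i)) UNIV) \<and>
     (\<forall>A::nat \<Rightarrow> (real^'n) set. disjoint_family A \<and> range A \<subseteq> finite_borel \<and>
          (\<Union>i. A i) \<in> finite_borel \<longrightarrow>
        (AE \<omega> in P. (\<lambda>i. M (A i) \<omega>) sums M (\<Union>i. A i) \<omega>)) \<and>
     (\<forall>A\<in>finite_borel. \<forall>w.
        char_fun (distr P borel (M A)) w = exp (of_real (measure lborel A * \<psi> w)))"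

definition complex_exp_tempered_stable_measure ::
  "'w measure \<Rightarrow> real \<Rightarrow> real \<Rightarrow> (real^('d + 'd)) measure \<Rightarrow>
   ((real^'n) set \<Rightarrow> 'w \<Rightarrow> complex^'d) \<Rightarrow> bool" where
  "complex_exp_tempered_stable_measure P \<alpha> l \<sigma> M \<longleftrightarrow>
     indep_scattered P (\<lambda>A \<omega>. realify (M A \<omega>)) (exp_tempered_psi \<alpha> l \<sigma>)"


section \<open>The stochastic integral\<close>

definition tendsto_in_prob ::
  "'w measure \<Rightarrow> ('i \<Rightarrow> 'w \<Rightarrow> 'a::euclidean_space) \<Rightarrow> ('w \<Rightarrow> 'a) \<Rightarrow> 'i filter \<Rightarrow> bool" where
  "tendsto_in_prob P X Z F \<longleftrightarrow>
     (\<forall>\<epsilon>>0. ((\<lambda>k. measure P {\<omega>\<in>space P. norm (X k \<omega> - Z \<omega>) > \<epsilon>}) \<longlongrightarrow> 0) F)"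

definition simple_integrand :: "(real^'n \<Rightarrow> real^'m^'m) \<Rightarrow> bool" where
  "simple_integrand f \<longleftrightarrow> simple_function lborel f \<and> emeasure lborel {s. f s \<noteq> 0} < \<infinity>"

text \<open>The integral of a simple function, written canonically through its level sets.\<close>

definition simple_stoch_integral ::
  "((real^'n) set \<Rightarrow> 'w \<Rightarrow> real^'m) \<Rightarrow> (real^'n \<Rightarrow> real^'m^'m) \<Rightarrow> 'w \<Rightarrow> real^'m" where
  "simple_stoch_integral M f \<omega> = (\<Sum>D\<in>range f - {0}. D *v M {s. f s = D} \<omega>)"

text \<open>\<open>X\<close> is a version of the integral of \<open>f\<close> with respect to \<open>M\<close>; integrability of \<open>f\<close> is the
  existence of some such \<open>X\<close>.\<close>

definition has_stoch_integral ::
  "'w measure \<Rightarrow> ((real^'n) set \<Rightarrow> 'w \<Rightarrow> real^'m) \<Rightarrow> (real^'n \<Rightarrow> real^'m^'m) \<Rightarrow>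
   ('w \<Rightarrow> real^'m) \<Rightarrow> bool" where
  "has_stoch_integral P M f X \<longleftrightarrow>
     f \<in> borel_measurable borel \<and> X \<in> borel_measurable P \<and>
     (\<exists>F::nat \<Rightarrow> real^'n \<Rightarrow> real^'m^'m.
        (\<forall>k. simple_integrand (F k)) \<and>
        (AE s in lborel. (\<lambda>k. F k s) \<longlonglongrightarrow> f s) \<and>
        (\<forall>A\<in>sets borel. \<exists>Z\<in>borel_measurable P.
           tendsto_in_prob P (\<lambda>k. simple_stoch_integral M (\<lambda>s. indicator A s *\<^sub>R F k s)) Z sequentially) \<and>
        tendsto_in_prob P (\<lambda>k. simple_stoch_integral M (F k)) X sequentially)"

definition tilde_matrix :: "complex^'d^'d \<Rightarrow> real^('d + 'd)^('d + 'd)" where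
  "tilde_matrix G = (\<chi> k l. case k of
       Inl i \<Rightarrow> (case l of Inl j \<Rightarrow> Re (G $ i $ j) | Inr j \<Rightarrow> - Im (G $ i $ j))
     | Inr i \<Rightarrow> 0)"

definition has_Re_integral ::
  "'w measure \<Rightarrow> ((real^'n) set \<Rightarrow> 'w \<Rightarrow> complex^'d) \<Rightarrow> (real^'n \<Rightarrow> complex^'d^'d) \<Rightarrow>
   ('w \<Rightarrow> real^'d) \<Rightarrow> bool" where
  "has_Re_integral P M g Y \<longleftrightarrow>
     (\<exists>X. has_stoch_integral P (\<lambda>A \<omega>. realify (M A \<omega>)) (\<lambda>s. tilde_matrix (g s)) X \<and>
          Y = (\<lambda>\<omega>. \<chi> i. X \<omega> $ Inl i))"

definition harmonizable_kernel ::
  "(real^'n \<Rightarrow> real) \<Rightarrow> real^'d^'d \<Rightarrow> real^'n \<Rightarrow> real^'n \<Rightarrow> complex^'d^'d" where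
  "harmonizable_kernel \<phi> B t s =
     (\<chi> i j. (iexp (t \<bullet> s) - 1) * complex_of_real (mat_powr (\<phi> s) B $ i $ j))"

definition stochastically_continuous ::
  "'w measure \<Rightarrow> (real^'n \<Rightarrow> 'w \<Rightarrow> 'a::euclidean_space) \<Rightarrow> bool" where
  "stochastically_continuous P Y \<longleftrightarrow> (\<forall>t. tendsto_in_prob P Y (Y t) (at t))"

end

theory Submission
  imports Defs "HOL-Computational_Algebra.Fundamental_Theorem_Algebra"
begin

text \<open>Let \<open>\<eta>\<close> be minus the log-characteristic function of the random measure per unit volume. Its square
  root is subadditive and \<open>\<eta> w \<le> C * min (norm w powr \<alpha>) ((norm w)\<^sup>2)\<close>, so the integrability of
  \<open>min (norm f powr \<alpha>) ((norm f)\<^sup>2)\<close> suffices for the integral of \<open>f\<close> to exist: along simple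
  functions approaching \<open>f\<close> fast enough the integrals converge almost surely by Borel--Cantelli.
  Conversely, every version of the integral has log-characteristic function
  \<open>w \<mapsto> - \<integral> \<eta> (transpose (f s) *v w) ds\<close>, since convergence in probability is a Cauchy condition on
  these exponents.

  The integral is therefore infinitely divisible with Levy measure the image of \<open>ds \<otimes> \<phi>(dx)\<close> under
  \<open>(s, x) \<mapsto> f s *v x\<close>. In polar coordinates this image has the density \<open>r powr (- \<alpha> - 1)\<close> times a
  mixture of exponentials \<open>exp (- l * r)\<close>; disintegrating the mixing measure with respect to the
  direction makes the tempering function a Laplace transform, hence completely monotone.

  For the kernel, \<open>\<real>\<^sup>n\<close> splits into the shells \<open>2 powr k \<le> \<phi> s < 2 powr (k + 1)\<close>, which have volume
  proportional to \<open>2 powr (k * q)\<close> and on which the real parts of the eigenvalues of \<open>D\<close> and \<open>E\<close>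
  control the kernel; the hypotheses on \<open>h\<close> and \<open>H\<close> make the resulting geometric series converge.
  Stochastic continuity follows from dominated convergence, as the kernels at \<open>t\<close> and \<open>t'\<close> differ by the
  kernel at \<open>t - t'\<close> up to a factor of modulus one. If \<open>Y(t)\<close> were not full, \<open>\<eta>\<close> would vanish along
  the kernel, which contradicts the support condition on \<open>\<sigma>\<close>.\<close>

section \<open>Matrix exponentials\<close>

text \<open>The gauge \<open>min (y powr \<alpha>) (y\<^sup>2)\<close> is what both hypotheses on
  the spectra come from. Near the origin the kernel may be large and \<alpha>-th powers are
  integrated; up to small losses \<open>norm s\<close> is at most of order
  \<open>\<phi> s powr a\<close> while volume scales like \<open>\<phi> s powr q\<close>, so
  \<open>H < a\<close> decides. At infinity squares are integrated, of order at most
  \<open>\<phi> s powr (- 2 * h - 2 * q / \<alpha>)\<close>, and comparison with the volume gives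
  \<open>q * (1/2 - 1/\<alpha>) < h\<close>. The delicate conclusion is the tempered stable form of
  the law. Polar coordinates give a mixture of exponentials with weights
  \<open>m powr \<alpha>\<close>, whose total mass can be infinite because only the gauge is
  integrable. The mixing measure therefore carries the gauge as weight, and the remaining factor is
  moved into the tempering function, where for each \<open>r > 0\<close> exponential decay outweighs
  its growth. Moreover complete monotonicity is demanded in every direction and not merely in almost
  every one, so conditional laws have to be chosen for all directions.\<close>

lemma mat_pow_commute: "A ** mat_pow A k = mat_pow A k ** A"
  by (induction k) (simp_all add: matrix_mul_assoc)

lemma scaleR_matrix_mult:
  fixes A :: "real^'n^'m" and B :: "real^'p^'n"
  shows "(c *\<^sub>R A) ** B = c *\<^sub>R (A ** B)" "A ** (c *\<^sub>R B) = c *\<^sub>R (A ** B)"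
  by (simp_all add: matrix_matrix_mult_def vec_eq_iff sum_distrib_left mult_ac)

lemma mat_pow_scaleR: "mat_pow (t *\<^sub>R A) k = t ^ k *\<^sub>R mat_pow A k"
  by (induction k) (simp_all add: scaleR_matrix_mult)

lemma mat_pow_transpose: "mat_pow (transpose A) k = transpose (mat_pow A k)"
proof (induction k)
  case (Suc k)
  then show ?case
    by (simp add: mat_pow_commute[of A] matrix_transpose_mul)
qed (simp add: transpose_mat)

text \<open>The sum of all absolute entries of \<open>A\<close> is a crude submultiplicative size.
  The series of each entry of the exponential is thereby dominated by a real exponential
  series.\<close>

lemma mat_pow_entry_bound:
  fixes A :: "real^'n^'n"
  defines "K \<equiv> \<Sum>i\<in>UNIV. \<Sum>j\<in>UNIV. \<bar>A $ i $ j\<bar>"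
  shows "\<bar>mat_pow A k $ i $ j\<bar> \<le> K ^ k"
proof (induction k arbitrary: i j)
  case 0
  show ?case by (simp add: mat_def)
next
  case (Suc k)
  have K0: "K \<ge> 0" unfolding K_def by (intro sum_nonneg) auto
  have "\<bar>mat_pow A (Suc k) $ i $ j\<bar> \<le> (\<Sum>m\<in>UNIV. \<bar>A $ i $ m\<bar> * \<bar>mat_pow A k $ m $ j\<bar>)"
    by (simp add: matrix_matrix_mult_def) (rule order_trans[OF sum_abs], simp add: abs_mult)
  also have "\<dots> \<le> (\<Sum>m\<in>UNIV. \<bar>A $ i $ m\<bar>) * K ^ k"
    unfolding sum_distrib_right by (intro sum_mono mult_left_mono Suc.IH) auto
  also have "\<dots> \<le> K * K ^ k"
    using member_le_sum[of i UNIV "\<lambda>i. \<Sum>j\<in>UNIV. \<bar>A $ i $ j\<bar>"] K0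
    by (intro mult_right_mono) (auto simp: K_def sum_nonneg)
  finally show ?case by simp
qed

lemma summable_mat_pow_entry:
  fixes A :: "real^'n^'n"
  shows "summable (\<lambda>k. mat_pow A k $ i $ j / fact k * t ^ k)"
proof -
  define K where "K = (\<Sum>i\<in>UNIV. \<Sum>j\<in>UNIV. \<bar>A $ i $ j\<bar>)"
  have "summable (\<lambda>k. inverse (fact k) * (K * \<bar>t\<bar>) ^ k)"
    by (rule summable_exp)
  then show ?thesis
  proof (rule summable_comparison_test'[where N=0])
    fix k
    have "\<bar>mat_pow A k $ i $ j\<bar> * \<bar>t\<bar> ^ k \<le> K ^ k * \<bar>t\<bar> ^ k"
      using mat_pow_entry_bound[of A k i j] by (intro mult_right_mono) (auto simp: K_def)
    then show "norm (mat_pow A k $ i $ j / fact k * t ^ k) \<le> inverse (fact k) * (K * \<bar>t\<bar>) ^ k"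
      by (simp add: abs_mult power_abs power_mult_distrib field_simps)
  qed
qed

lemma mat_sums_iff:
  fixes f :: "nat \<Rightarrow> real^'n^'m"
  shows "f sums s \<longleftrightarrow> (\<forall>i j. (\<lambda>k. f k $ i $ j) sums (s $ i $ j))"
proof
  assume "f sums s"
  then show "\<forall>i j. (\<lambda>k. f k $ i $ j) sums (s $ i $ j)"
    by (auto simp: sums_def simp flip: sum_component intro!: tendsto_vec_nth)
next
  assume *: "\<forall>i j. (\<lambda>k. f k $ i $ j) sums (s $ i $ j)"
  show "f sums s" unfolding sums_def
  proof (intro vec_tendstoI)
    fix i j
    show "(\<lambda>n. (\<Sum>k<n. f k) $ i $ j) \<longlonglongrightarrow> s $ i $ j"
      using *[rule_format, of i j] by (simp add: sums_def)
  qed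
qed

text \<open>Working entry by entry turns the exponential into real power series in \<open>t\<close>,
  so that termwise differentiation of scalar series carries the whole theory.\<close>

lemma mat_exp_entry_sums:
  "(\<lambda>k. mat_pow A k $ i $ j / fact k * t ^ k) sums (mat_exp (t *\<^sub>R A) $ i $ j)"
proof -
  define S where "S = (\<chi> i j. \<Sum>k. mat_pow A k $ i $ j / fact k * t ^ k)"
  have "(\<lambda>k. (1 / fact k) *\<^sub>R mat_pow (t *\<^sub>R A) k) sums S"
    unfolding mat_sums_iff
    using summable_sums[OF summable_mat_pow_entry[of A _ _ t]]
    by (simp add: S_def mat_pow_scaleR mult.commute)
  then have "mat_exp (t *\<^sub>R A) = S"
    unfolding mat_exp_def by (simp add: sums_iff)
  then show ?thesis
    using summable_sums[OF summable_mat_pow_entry[of A i j t]] by (simp add: S_def)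
qed

lemma mat_exp_0 [simp]: "mat_exp (0 :: real^'n^'n) = mat 1"
proof -
  have "mat_exp (0 *\<^sub>R (0::real^'n^'n)) $ i $ j = mat 1 $ i $ j" for i j
    using mat_exp_entry_sums[of "0::real^'n^'n" i j 0]
    by (subst (asm) powser_sums_zero_iff) simp
  then show ?thesis by (simp add: vec_eq_iff)
qed

lemma mat_exp_commute: "A ** mat_exp (t *\<^sub>R A) = mat_exp (t *\<^sub>R A) ** A"
proof -
  have "(\<Sum>m\<in>UNIV. A $ i $ m * mat_exp (t *\<^sub>R A) $ m $ j) =
        (\<Sum>m\<in>UNIV. mat_exp (t *\<^sub>R A) $ i $ m * A $ m $ j)" for i j
  proof -
    have "(\<lambda>k. \<Sum>m\<in>UNIV. A $ i $ m * (mat_pow A k $ m $ j / fact k * t ^ k)) sums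
        (\<Sum>m\<in>UNIV. A $ i $ m * mat_exp (t *\<^sub>R A) $ m $ j)"
      by (intro sums_sum sums_mult mat_exp_entry_sums)
    moreover have "(\<lambda>k. \<Sum>m\<in>UNIV. (mat_pow A k $ i $ m / fact k * t ^ k) * A $ m $ j) sums
        (\<Sum>m\<in>UNIV. mat_exp (t *\<^sub>R A) $ i $ m * A $ m $ j)"
      by (intro sums_sum sums_mult2 mat_exp_entry_sums)
    moreover have "(\<Sum>m\<in>UNIV. A $ i $ m * (mat_pow A k $ m $ j / fact k * t ^ k)) =
        (\<Sum>m\<in>UNIV. (mat_pow A k $ i $ m / fact k * t ^ k) * A $ m $ j)" for k
    proof -
      have "(A ** mat_pow A k) $ i $ j = (mat_pow A k ** A) $ i $ j"
        by (simp only: mat_pow_commute)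
      then have "(t ^ k / fact k) * (\<Sum>m\<in>UNIV. A $ i $ m * mat_pow A k $ m $ j) =
          (t ^ k / fact k) * (\<Sum>m\<in>UNIV. mat_pow A k $ i $ m * A $ m $ j)"
        by (simp add: matrix_matrix_mult_def)
      then show ?thesis by (simp add: sum_distrib_left mult_ac)
    qed
    ultimately show ?thesis using sums_unique2 by fastforce
  qed
  then show ?thesis by (simp add: matrix_matrix_mult_def vec_eq_iff)
qed

lemma mat_exp_entry_deriv:
  "((\<lambda>t. mat_exp (t *\<^sub>R A) $ i $ j) has_real_derivative (A ** mat_exp (t *\<^sub>R A)) $ i $ j) (at t)"
proof -
  let ?c = "\<lambda>k. mat_pow A k $ i $ j / fact k"
  have "((\<lambda>t. \<Sum>k. ?c k * t ^ k) has_real_derivative (\<Sum>k. diffs ?c k * t ^ k)) (at t)"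
    by (rule termdiffs_strong_converges_everywhere) (rule summable_mat_pow_entry)
  moreover have "(\<Sum>k. ?c k * t ^ k) = mat_exp (t *\<^sub>R A) $ i $ j" for t
    using mat_exp_entry_sums by (rule sums_unique[symmetric])
  moreover have "(\<Sum>k. diffs ?c k * t ^ k) = (A ** mat_exp (t *\<^sub>R A)) $ i $ j"
  proof (rule sums_unique[symmetric])
    have *: "diffs ?c k * t ^ k = (\<Sum>m\<in>UNIV. A $ i $ m * (mat_pow A k $ m $ j / fact k * t ^ k))" for k
    proof -
      have "diffs ?c k = (A ** mat_pow A k) $ i $ j / fact k"
        unfolding diffs_def by (simp add: field_simps del: of_nat_Suc)
      then show ?thesis
        by (simp add: matrix_matrix_mult_def sum_distrib_left sum_divide_distrib mult_ac)
    qed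
    have "(\<lambda>k. diffs ?c k * t ^ k) sums (\<Sum>m\<in>UNIV. A $ i $ m * mat_exp (t *\<^sub>R A) $ m $ j)"
      unfolding * by (intro sums_sum sums_mult mat_exp_entry_sums)
    then show "(\<lambda>k. diffs ?c k * t ^ k) sums (A ** mat_exp (t *\<^sub>R A)) $ i $ j"
      by (simp add: matrix_matrix_mult_def)
  qed
  ultimately show ?thesis by simp
qed

text \<open>The left side has derivative 0 in \<open>t\<close>, since \<open>A\<close> commutes with
  its exponentials, and it equals the right side at \<open>t = 0\<close>. This takes the place of a
  Cauchy product of matrix series.\<close>

lemma mat_exp_add_minus: "mat_exp ((s + t) *\<^sub>R A) ** mat_exp (- t *\<^sub>R A) = mat_exp (s *\<^sub>R A)"
proof -
  let ?W = "\<lambda>t. mat_exp ((s + t) *\<^sub>R A) ** mat_exp (- t *\<^sub>R A)"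
  have "?W t $ i $ j = ?W 0 $ i $ j" for i j
  proof -
    have "((\<lambda>t. ?W t $ i $ j) has_real_derivative 0) (at t)" for t
    proof -
      have 1: "((\<lambda>t. mat_exp ((s + t) *\<^sub>R A) $ i $ m) has_real_derivative
          (mat_exp ((s + t) *\<^sub>R A) ** A) $ i $ m) (at t)" for m
      proof -
        have "((\<lambda>t. s + t) has_real_derivative 1) (at t)" by (auto intro!: derivative_eq_intros)
        from DERIV_chain2[where f="\<lambda>t. mat_exp (t *\<^sub>R A) $ i $ m", OF mat_exp_entry_deriv this]
        show ?thesis by (simp add: mat_exp_commute)
      qed
      have 2: "((\<lambda>t. mat_exp (- t *\<^sub>R A) $ m $ j) has_real_derivative
          - (A ** mat_exp (- t *\<^sub>R A)) $ m $ j) (at t)" for m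
      proof -
        have "((\<lambda>t. - t) has_real_derivative -1) (at t)" by (auto intro!: derivative_eq_intros)
        from DERIV_chain2[where f="\<lambda>t. mat_exp (t *\<^sub>R A) $ m $ j", OF mat_exp_entry_deriv this]
        show ?thesis by simp
      qed
      have "((\<lambda>t. \<Sum>m\<in>UNIV. mat_exp ((s + t) *\<^sub>R A) $ i $ m * mat_exp (- t *\<^sub>R A) $ m $ j)
        has_real_derivative
          (\<Sum>m\<in>UNIV. (mat_exp ((s + t) *\<^sub>R A) ** A) $ i $ m * mat_exp (- t *\<^sub>R A) $ m $ j +
             - (A ** mat_exp (- t *\<^sub>R A)) $ m $ j * mat_exp ((s + t) *\<^sub>R A) $ i $ m)) (at t)"
        by (intro DERIV_sum DERIV_mult 1 2)
      moreover have "(\<Sum>m\<in>UNIV. (mat_exp ((s + t) *\<^sub>R A) ** A) $ i $ m * mat_exp (- t *\<^sub>R A) $ m $ j +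
             - (A ** mat_exp (- t *\<^sub>R A)) $ m $ j * mat_exp ((s + t) *\<^sub>R A) $ i $ m) =
          ((mat_exp ((s + t) *\<^sub>R A) ** A) ** mat_exp (- t *\<^sub>R A)) $ i $ j -
          (mat_exp ((s + t) *\<^sub>R A) ** (A ** mat_exp (- t *\<^sub>R A))) $ i $ j"
        unfolding matrix_matrix_mult_def[of "_ ** _"] matrix_matrix_mult_def[of _ "_ ** _"]
        by (simp add: sum.distrib sum_negf sum_subtractf mult_ac)
      ultimately show ?thesis
        by (simp add: matrix_mul_assoc) (simp add: matrix_matrix_mult_def)
    qed
    then show ?thesis
      using DERIV_isconst_all by blast
  qed
  then show ?thesis by (simp add: vec_eq_iff)
qed

lemma mat_exp_minus: "mat_exp (t *\<^sub>R A) ** mat_exp (- t *\<^sub>R A) = mat 1"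
  using mat_exp_add_minus[of 0 t A] by simp

lemma mat_exp_add: "mat_exp ((s + t) *\<^sub>R A) = mat_exp (s *\<^sub>R A) ** mat_exp (t *\<^sub>R A)"
proof -
  have "mat_exp (s *\<^sub>R A) ** mat_exp (t *\<^sub>R A)
      = mat_exp ((s + t) *\<^sub>R A) ** (mat_exp (- t *\<^sub>R A) ** mat_exp (t *\<^sub>R A))"
    by (simp only: mat_exp_add_minus[of s t A, symmetric] matrix_mul_assoc)
  also have "mat_exp (- t *\<^sub>R A) ** mat_exp (t *\<^sub>R A) = mat 1"
    using mat_exp_minus[of "- t" A] by simp
  finally show ?thesis by simp
qed

lemma mat_exp_transpose: "mat_exp (t *\<^sub>R transpose A) = transpose (mat_exp (t *\<^sub>R A))"
proof -
  have "mat_exp (t *\<^sub>R transpose A) $ i $ j = mat_exp (t *\<^sub>R A) $ j $ i" for i j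
    using mat_exp_entry_sums[of "transpose A" i j t] mat_exp_entry_sums[of A j i t]
    unfolding mat_pow_transpose by (simp add: transpose_def sums_iff)
  then show ?thesis by (simp add: vec_eq_iff transpose_def)
qed

lemma continuous_mat_exp: "continuous_on UNIV (\<lambda>t. mat_exp (t *\<^sub>R A))"
proof -
  have "continuous_on UNIV (\<lambda>t. mat_exp (t *\<^sub>R A) $ i $ j)" for i j
    using mat_exp_entry_deriv[of A i j]
    by (intro continuous_at_imp_continuous_on) (auto intro: DERIV_isCont)
  then have "continuous_on UNIV (\<lambda>t. \<chi> i j. mat_exp (t *\<^sub>R A) $ i $ j)"
    by (intro continuous_on_vec_lambda)
  then show ?thesis by simp
qed

text \<open>At \<open>t = 0\<close> the entries in the Leibniz formula are those of the identity
  matrix. After one factor of a product is differentiated the others remain, so only the identity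
  permutation survives, and it contributes the diagonal sum.\<close>

lemma det_mat_exp_deriv_0:
  fixes A :: "real^'n^'n"
  shows "((\<lambda>t. det (mat_exp (t *\<^sub>R A))) has_real_derivative trace A) (at 0)"
proof -
  have d: "((\<lambda>t. mat_exp (t *\<^sub>R A) $ i $ j) has_real_derivative A $ i $ j) (at 0)" for i j
    using mat_exp_entry_deriv[of A i j 0] by simp
  let ?P = "{p. p permutes (UNIV::'n set)}"
  let ?s = "\<lambda>p. \<Sum>i\<in>UNIV. A $ i $ p i * (\<Prod>k\<in>UNIV - {i}. mat 1 $ k $ p k)"
  have D: "((\<lambda>t. \<Sum>p\<in>?P. of_int (sign p) * (\<Prod>i\<in>UNIV. mat_exp (t *\<^sub>R A) $ i $ p i)) has_real_derivative
     (\<Sum>p\<in>?P. of_int (sign p) * ?s p)) (at 0)"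
  proof (intro DERIV_sum DERIV_cmult)
    fix p
    show "((\<lambda>t. \<Prod>i\<in>UNIV. mat_exp (t *\<^sub>R A) $ i $ p i) has_real_derivative ?s p) (at 0)"
      using has_field_derivative_prod[of UNIV "\<lambda>i t. mat_exp (t *\<^sub>R A) $ i $ p i" "\<lambda>i. A $ i $ p i" 0] d
      by simp
  qed
  have z: "?s p = 0" if "p permutes UNIV" "p \<noteq> id" for p
  proof (rule sum.neutral, intro ballI)
    fix i
    \<comment> \<open>A permutation other than the identity moves at least two points, hence one
      different from the differentiated row \<open>i\<close>.\<close>
    obtain k where k: "k \<noteq> i" "p k \<noteq> k"
    proof (rule ccontr)
      assume *: "\<not> thesis"
      have fp: "p k = k" if "k \<noteq> i" for k using * that \<open>\<And>k. k \<noteq> i \<Longrightarrow> p k \<noteq> k \<Longrightarrow> thesis\<close> by blast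
      have "p i = i"
        using fp \<open>p permutes UNIV\<close> by (metis permutes_inj injD)
      then show False using fp \<open>p \<noteq> id\<close> by (metis eq_id_iff)
    qed
    then have "(\<Prod>k\<in>UNIV - {i}. mat 1 $ k $ p k) = (0::real)"
      by (intro prod_zero) (auto simp: mat_def intro!: bexI[of _ k])
    then show "A $ i $ p i * (\<Prod>k\<in>UNIV - {i}. mat 1 $ k $ p k) = 0" by simp
  qed
  have "(\<Sum>p\<in>?P. of_int (sign p) * ?s p) = (\<Sum>p\<in>{id}. of_int (sign p) * ?s p)"
    by (rule sum.mono_neutral_right) (auto simp: finite_permutations permutes_id z)
  also have "\<dots> = trace A" by (simp add: trace_def mat_def)
  finally show ?thesis using D by (simp add: det_def)
qed

text \<open>Liouville's formula: the group law carries the derivative at 0 to every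
  \<open>t\<close>, so the determinant solves a linear equation with rate \<open>trace A\<close>. It
  later gives the volumes of the shells.\<close>

lemma det_mat_exp: "det (mat_exp (t *\<^sub>R A)) = exp (t * trace A)"
proof -
  let ?d = "\<lambda>t. det (mat_exp (t *\<^sub>R A))"
  have D: "(?d has_real_derivative ?d t * trace A) (at t)" for t
  proof -
    have "((\<lambda>s. ?d t * ?d (- t + s)) has_real_derivative ?d t * trace A) (at t)"
    proof (rule DERIV_cmult)
      have "((\<lambda>s. - t + s) has_real_derivative 1) (at t)" by (auto intro!: derivative_eq_intros)
      from DERIV_chain2[where f="?d" and g="\<lambda>s. - t + s" and x=t and Da="trace A", OF _ this]
      show "((\<lambda>s. ?d (- t + s)) has_real_derivative trace A) (at t)"
        using det_mat_exp_deriv_0[of A] by simp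
    qed
    moreover have "?d t * ?d (- t + s) = ?d s" for s
      by (simp add: det_mul[symmetric] mat_exp_add[symmetric])
    ultimately show ?thesis by simp
  qed
  have "((\<lambda>t. ?d t * exp (- (t * trace A))) has_real_derivative 0) (at t)" for t
    by (auto intro!: derivative_eq_intros D)
  then have "?d t * exp (- (t * trace A)) = ?d 0 * exp (- (0 * trace A))"
    using DERIV_isconst_all by blast
  then show ?thesis by (simp add: exp_minus field_simps)
qed

section \<open>Annihilating polynomials, finiteness of the spectrum and growth of
  exponentials\<close>

abbreviation cmat :: "real^'n^'n \<Rightarrow> complex^'n^'n" where
  "cmat \<equiv> map_matrix complex_of_real"

lemma cmat_mult: "cmat (A ** B) = cmat A ** cmat B"
  by (simp add: vec_eq_iff matrix_matrix_mult_def)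

text \<open>The vector \<open>p(B) v\<close>. Letting polynomials act on single vectors provides
  annihilating polynomials by mere linear dependence, without characteristic polynomials or Jordan
  forms.\<close>

definition poly_act :: "complex^'n^'n \<Rightarrow> complex poly \<Rightarrow> complex^'n \<Rightarrow> complex^'n" where
  "poly_act B p v = (\<Sum>i\<le>degree p. coeff p i *s ((*v) B ^^ i) v)"

lemma poly_act_eq:
  "degree p \<le> N \<Longrightarrow> poly_act B p v = (\<Sum>i\<le>N. coeff p i *s ((*v) B ^^ i) v)"
  unfolding poly_act_def
  by (rule sum.mono_neutral_left) (auto simp: coeff_eq_0)

lemma poly_act_0 [simp]: "poly_act B 0 v = 0"
  by (simp add: poly_act_def)

lemma poly_act_add: "poly_act B (p + q) v = poly_act B p v + poly_act B q v"
  using poly_act_eq[of p "max (degree p) (degree q)" B v] poly_act_eq[of q "max (degree p) (degree q)" B v]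
    poly_act_eq[of "p + q" "max (degree p) (degree q)" B v]
  by (simp add: degree_add_le_max vec.scale_left_distrib sum.distrib)

lemma poly_act_smult: "poly_act B (smult c p) v = c *s poly_act B p v"
  using poly_act_eq[of "smult c p" "degree p" B v]
  by (simp add: degree_smult_le poly_act_def vec.scale_sum_right)

lemma mult_vec_sum:
  fixes B :: "'a::semiring_1^'n^'m"
  shows "B *v (\<Sum>i\<in>I. f i) = (\<Sum>i\<in>I. B *v f i)"
  by (induction I rule: infinite_finite_induct) (auto simp: matrix_vector_right_distrib)

lemma poly_act_pCons: "poly_act B (pCons c p) v = c *s v + B *v poly_act B p v"
proof -
  have "poly_act B (pCons c p) v = (\<Sum>i\<le>Suc (degree p). coeff (pCons c p) i *s ((*v) B ^^ i) v)"
    by (rule poly_act_eq) (rule degree_pCons_le)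
  also have "\<dots> = c *s v + (\<Sum>i\<le>degree p. coeff p i *s ((*v) B ^^ Suc i) v)"
    by (subst sum.atMost_Suc_shift) simp
  also have "\<dots> = c *s v + B *v poly_act B p v"
    by (simp add: poly_act_def mult_vec_sum vector_scalar_commute)
  finally show ?thesis .
qed

lemma poly_act_linear:
  "poly_act B p (v + w) = poly_act B p v + poly_act B p w"
  "poly_act B p (c *s v) = c *s poly_act B p v"
  "poly_act B p 0 = 0"
  by (induction p rule: pCons_induct)
     (simp_all add: poly_act_pCons matrix_vector_right_distrib vec.scale_right_distrib vector_scalar_commute
        mult.commute)

lemma poly_act_mult: "poly_act B (p * q) v = poly_act B p (poly_act B q v)"
proof (induction p)
  case 0
  show ?case by simp
next
  case (pCons a p)
  then show ?case
    by (simp add: poly_act_add poly_act_smult poly_act_pCons)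
qed

lemma poly_act_sum: "poly_act B (\<Sum>i\<in>I. f i) v = (\<Sum>i\<in>I. poly_act B (f i) v)"
  by (induction I rule: infinite_finite_induct) (auto simp: poly_act_add)

lemma poly_act_monom: "poly_act B (monom c i) v = c *s ((*v) B ^^ i) v"
  by (induction i) (auto simp: monom_0 monom_Suc poly_act_pCons vector_scalar_commute)

lemma poly_act_eigenvector:
  assumes "B *v v = z *s v"
  shows "poly_act B p v = poly p z *s v"
  by (induction p) (auto simp: poly_act_pCons assms vector_scalar_commute vec.scale_left_distrib mult.commute)

text \<open>The iterates of \<open>v\<close> under \<open>B\<close> up to the order
  \<open>CARD('n)\<close> are one more than the dimension, hence dependent. Dependence speaks of a
  set of vectors, so coinciding iterates are treated apart, by a difference of two
  monomials.\<close>

lemma poly_act_annihilates: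
  fixes B :: "complex^'n^'n"
  shows "\<exists>p. p \<noteq> 0 \<and> poly_act B p v = 0"
proof -
  define f where "f = (\<lambda>i. ((*v) B ^^ i) v)"
  show ?thesis
  proof (cases "inj_on f {..CARD('n)}")
    case True
    let ?S = "f ` {..CARD('n)}"
    have "card ?S = Suc (CARD('n))" using card_image[OF True] by simp
    then have "vec.dependent ?S"
      using dim_subset_UNIV_cart_gen[of ?S] by (intro vec.dependent_biggerset_general) simp
    then obtain u w where u: "w \<in> ?S" "u w \<noteq> 0" "(\<Sum>x\<in>?S. u x *s x) = 0"
      using vec.dependent_finite[of ?S] by auto
    let ?p = "\<Sum>i\<le>CARD('n). monom (u (f i)) i"
    have "poly_act B ?p v = (\<Sum>i\<le>CARD('n). u (f i) *s f i)"
      by (simp add: poly_act_sum poly_act_monom f_def)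
    also have "\<dots> = 0" using u(3) by (simp add: sum.reindex[OF True])
    finally have "poly_act B ?p v = 0" .
    moreover from u(1) obtain i where i: "i \<le> CARD('n)" "w = f i" by auto
    have "coeff ?p i = u w" using i by (simp add: coeff_sum sum.delta)
    with u(2) have "?p \<noteq> 0" by auto
    ultimately show ?thesis by blast
  next
    case False
    then obtain i j where "i \<noteq> j" "f i = f j" by (auto simp: inj_on_def)
    let ?p = "monom 1 i + monom (-1) j :: complex poly"
    have "poly_act B ?p v = 0"
      using \<open>f i = f j\<close> by (simp add: poly_act_add poly_act_monom f_def)
    moreover have "coeff ?p i = 1" using \<open>i \<noteq> j\<close> by simp
    then have "?p \<noteq> 0" by (intro notI) simp
    ultimately show ?thesis by blast
  qed
qed

text \<open>The product of annihilators of the basis vectors annihilates every vector, so each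
  eigenvalue is one of its finitely many roots. Finiteness is what makes \<open>Min\<close> and
  \<open>Max\<close> of the real parts actual bounds.\<close>

lemma finite_eigenvalues: "finite (eigenvalues (A :: real^'n^'n))"
proof -
  let ?B = "cmat A"
  have "\<forall>i::'n. \<exists>p. p \<noteq> 0 \<and> poly_act ?B p (axis i 1) = 0"
    using poly_act_annihilates by blast
  then obtain p where p: "\<And>i. p i \<noteq> 0" "\<And>i::'n. poly_act ?B (p i) (axis i 1) = 0"
    by metis
  let ?P = "\<Prod>i\<in>UNIV. p i"
  have ax: "poly_act ?B ?P (axis i 1) = 0" for i
  proof -
    have "?P = (\<Prod>j\<in>UNIV - {i}. p j) * p i"
      by (subst prod.remove[of UNIV i]) (auto simp: mult.commute)
    then show ?thesis by (simp add: poly_act_mult p poly_act_linear)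
  qed
  have s: "poly_act ?B ?P (\<Sum>i\<in>I. v $ i *s axis i 1) = 0" for v I
    by (induction I rule: infinite_finite_induct) (auto simp: poly_act_linear ax)
  have all: "poly_act ?B ?P v = 0" for v
    using s[of v UNIV] by (simp add: basis_expansion)
  have "eigenvalues A \<subseteq> {z. poly ?P z = 0}"
  proof
    fix z assume "z \<in> eigenvalues A"
    then obtain v where "v \<noteq> 0" "?B *v v = z *s v" by (auto simp: eigenvalues_def)
    then show "z \<in> {z. poly ?P z = 0}"
      using poly_act_eigenvector[of ?B v z ?P] all[of v] by simp
  qed
  moreover have "finite {z. poly ?P z = 0}"
    by (rule poly_roots_finite) (simp add: p)
  ultimately show ?thesis by (rule finite_subset)
qed

lemma cmat_exp_deriv:
  "((\<lambda>t. (cmat (mat_exp (t *\<^sub>R A)) *v v) $ i) has_vector_derivative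
     (cmat (mat_exp (t *\<^sub>R A)) *v (cmat A *v v)) $ i) (at t)"
proof -
  have "((\<lambda>t. \<Sum>j\<in>UNIV. complex_of_real (mat_exp (t *\<^sub>R A) $ i $ j) * v $ j) has_vector_derivative
      (\<Sum>j\<in>UNIV. complex_of_real ((A ** mat_exp (t *\<^sub>R A)) $ i $ j) * v $ j)) (at t)"
    by (intro has_vector_derivative_sum has_vector_derivative_mult_left has_vector_derivative_of_real)
       (rule mat_exp_entry_deriv)
  moreover have "(\<Sum>j\<in>UNIV. complex_of_real ((A ** mat_exp (t *\<^sub>R A)) $ i $ j) * v $ j)
      = (cmat (mat_exp (t *\<^sub>R A)) *v (cmat A *v v)) $ i"
    unfolding mat_exp_commute matrix_vector_mul_assoc cmat_mult[symmetric]
    by (simp add: matrix_vector_mult_def)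
  ultimately show ?thesis by (simp add: matrix_vector_mult_def)
qed

text \<open>Induction on the degree of a polynomial annihilating \<open>v\<close>: if \<open>\<mu>\<close> is one of its roots, then
  \<open>y t = exp (t A) v\<close> solves \<open>y' = \<mu> y + exp (t A) u\<close> with \<open>u = A v - \<mu> v\<close>, and \<open>u\<close> is annihilated by
  the quotient.\<close>

lemma cmat_exp_growth:
  fixes A :: "real^'n^'n"
  assumes b: "\<And>z. z \<in> eigenvalues A \<Longrightarrow> Re z < b"
    and "p \<noteq> 0" "poly_act (cmat A) p v = 0"
  shows "\<exists>C\<ge>0. \<forall>t\<ge>0. \<forall>i. cmod ((cmat (mat_exp (t *\<^sub>R A)) *v v) $ i) \<le> C * exp (b * t)"
  using assms(2,3)
proof (induction "degree p" arbitrary: p v rule: less_induct)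
  case less
  show ?case
  proof (cases "degree p = 0")
    case True
    then obtain c where "p = [:c:]" by (metis degree_eq_zeroE)
    with less.prems have "v = 0" by (auto simp: poly_act_pCons)
    then show ?thesis by (intro exI[of _ 0]) simp
  next
    case False
    then obtain \<mu> where "poly p \<mu> = 0"
      using fundamental_theorem_of_algebra[of p] constant_degree[of p] by auto
    then obtain r where r: "p = [:- \<mu>, 1:] * r" by (auto simp: poly_eq_0_iff_dvd dvd_def)
    with less.prems have "r \<noteq> 0" by auto
    then have deg: "degree r < degree p" unfolding r by (subst degree_mult_eq) auto
    show ?thesis
    proof (cases "poly_act (cmat A) r v = 0")
      case True
      then show ?thesis using less.hyps[OF deg \<open>r \<noteq> 0\<close>] by blast
    next
      case False
      have comm: "poly_act (cmat A) r (poly_act (cmat A) [:- \<mu>, 1:] v) = 0"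
        using less.prems(2) by (simp only: r poly_act_mult[symmetric] mult.commute[of r])
      have lin: "poly_act (cmat A) [:- \<mu>, 1:] w = cmat A *v w - \<mu> *s w" for w
        by (simp add: poly_act_pCons)
      have "poly_act (cmat A) [:- \<mu>, 1:] (poly_act (cmat A) r v) = 0"
        using less.prems(2) by (simp only: r poly_act_mult)
      \<comment> \<open>The vector obtained by letting \<open>r\<close> act on \<open>v\<close> is
        an eigenvector for \<mu>. This is where the spectral bound enters; its strictness leaves a
        gap \<kappa> > 0 in the exponent.\<close>
      with False have "\<mu> \<in> eigenvalues A"
        unfolding eigenvalues_def lin by auto
      with b have "Re \<mu> < b" by blast
      define \<kappa> where "\<kappa> = b - Re \<mu>"
      have "\<kappa> > 0" using \<open>Re \<mu> < b\<close> by (simp add: \<kappa>_def)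
      define u where "u = cmat A *v v - \<mu> *s v"
      have "poly_act (cmat A) r u = 0" using comm by (simp add: lin u_def)
      from less.hyps[OF deg \<open>r \<noteq> 0\<close> this] obtain C where C: "C \<ge> 0"
        "\<And>t i. t \<ge> 0 \<Longrightarrow> cmod ((cmat (mat_exp (t *\<^sub>R A)) *v u) $ i) \<le> C * exp (b * t)" by blast
      define y where "y = (\<lambda>i t. (cmat (mat_exp (t *\<^sub>R A)) *v v) $ i)"
      \<comment> \<open>Integrating factor: by the induction hypothesis the derivative of
        \<open>z\<close> has modulus at most \<open>C * exp (\<kappa> * t)\<close>, which integrates
        to the same order because \<kappa> > 0.\<close>
      define z where "z = (\<lambda>i t. exp (- \<mu> * of_real t) * y i t)"
      have dz: "(z i has_vector_derivative exp (- \<mu> * of_real t) * (cmat (mat_exp (t *\<^sub>R A)) *v u) $ i) (at t)" for i t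
      proof -
        have "((\<lambda>t. exp (- \<mu> * complex_of_real t)) has_vector_derivative exp (- \<mu> * of_real t) * (- \<mu>)) (at t)"
          by (rule has_vector_derivative_real_field) (auto intro!: derivative_eq_intros)
        note has_vector_derivative_mult[OF this cmat_exp_deriv[of A v i t]]
        then show ?thesis
          unfolding z_def y_def u_def
          by (rule has_vector_derivative_eq_rhs)
             (simp add: matrix_vector_mult_diff_distrib vector_scalar_commute algebra_simps)
      qed
      have norm_exp: "cmod (exp (- \<mu> * of_real t)) = exp (- (Re \<mu> * t))" for t by simp
      have zb: "cmod (z i t - z i 0) \<le> C / \<kappa> * exp (\<kappa> * t)" if "t > 0" for i t
      proof -
        have "cmod (z i t - z i 0) \<le> C / \<kappa> * exp (\<kappa> * t) - C / \<kappa> * exp (\<kappa> * 0)"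
        proof (rule differentiable_bound_general[OF that])
          show "continuous_on {0..t} (z i)"
            using dz by (intro continuous_at_imp_continuous_on ballI has_vector_derivative_continuous)
          show "continuous_on {0..t} (\<lambda>x. C / \<kappa> * exp (\<kappa> * x))"
            by (intro continuous_intros)
          fix x assume x: "0 < x" "x < t"
          show "((\<lambda>x. C / \<kappa> * exp (\<kappa> * x)) has_vector_derivative C * exp (\<kappa> * x)) (at x)"
            unfolding has_real_derivative_iff_has_vector_derivative[symmetric]
            using \<open>\<kappa> > 0\<close> by (auto intro!: derivative_eq_intros)
          show "(z i has_vector_derivative exp (- \<mu> * of_real x) * (cmat (mat_exp (x *\<^sub>R A)) *v u) $ i) (at x)"
            by (rule dz)
          have "cmod (exp (- \<mu> * of_real x) * (cmat (mat_exp (x *\<^sub>R A)) *v u) $ i) \<le>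
              exp (- (Re \<mu> * x)) * (C * exp (b * x))"
            unfolding norm_mult norm_exp using C(2)[of x i] x by (intro mult_left_mono) auto
          also have "\<dots> = C * exp (\<kappa> * x)"
            by (simp add: \<kappa>_def exp_diff exp_minus field_simps left_diff_distrib)
          finally show "cmod (exp (- \<mu> * of_real x) * (cmat (mat_exp (x *\<^sub>R A)) *v u) $ i) \<le> C * exp (\<kappa> * x)" .
        qed
        then show ?thesis using C \<open>\<kappa> > 0\<close> by (smt (verit) divide_nonneg_pos exp_gt_zero mult_nonneg_nonneg)
      qed
      define C' where "C' = (\<Sum>i\<in>UNIV. cmod (v $ i)) + C / \<kappa>"
      have C': "C' \<ge> 0" using C \<open>\<kappa> > 0\<close> by (auto simp: C'_def intro!: add_nonneg_nonneg sum_nonneg)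
      have z0: "z i 0 = v $ i" for i
      proof -
        have "cmat (mat 1 :: real^'n^'n) = mat 1" by (simp add: vec_eq_iff mat_def)
        then show ?thesis by (simp add: z_def y_def)
      qed
      have "cmod (y i t) \<le> C' * exp (b * t)" if "t \<ge> 0" for i t
      proof -
        have e1: "exp (\<kappa> * t) \<ge> 1" using \<open>\<kappa> > 0\<close> that by simp
        have vi: "cmod (v $ i) \<le> (\<Sum>i\<in>UNIV. cmod (v $ i))"
          by (rule member_le_sum) auto
        have "cmod (z i t) \<le> C' * exp (\<kappa> * t)"
        proof (cases "t = 0")
          case True
          then show ?thesis using vi C \<open>\<kappa> > 0\<close> by (simp add: z0 C'_def add_increasing2)
        next
          case False
          have "cmod (z i t) \<le> cmod (v $ i) + cmod (z i t - z i 0)"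
            using norm_triangle_sub[of "z i t" "z i 0"] by (simp add: z0)
          also have "\<dots> \<le> (\<Sum>i\<in>UNIV. cmod (v $ i)) * exp (\<kappa> * t) + C / \<kappa> * exp (\<kappa> * t)"
            using zb[of t i] order_trans[OF vi, of "(\<Sum>i\<in>UNIV. cmod (v $ i)) * exp (\<kappa> * t)"]
              mult_left_mono[OF e1, of "\<Sum>i\<in>UNIV. cmod (v $ i)"] False that
            by (intro add_mono) (simp_all add: sum_nonneg)
          finally show ?thesis by (simp add: C'_def algebra_simps)
        qed
        moreover have "y i t = exp (\<mu> * of_real t) * z i t"
          by (simp add: z_def mult.assoc[symmetric] exp_add[symmetric])
        ultimately have "cmod (y i t) \<le> exp (Re \<mu> * t) * (C' * exp (\<kappa> * t))"
          by (simp add: norm_mult)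
        also have "\<dots> = C' * exp (b * t)"
          by (simp add: \<kappa>_def algebra_simps exp_diff)
        finally show ?thesis .
      qed
      then show ?thesis using C' by (intro exI[of _ C']) (simp add: y_def)
    qed
  qed
qed

text \<open>The columns are the images of the coordinate vectors. A rate \<open>b\<close> strictly
  above all real parts absorbs the polynomial factors that Jordan blocks produce.\<close>

lemma mat_exp_growth:
  fixes A :: "real^'n^'n"
  assumes b: "\<And>z. z \<in> eigenvalues A \<Longrightarrow> Re z < b"
  shows "\<exists>C>0. \<forall>t\<ge>0. norm (mat_exp (t *\<^sub>R A)) \<le> C * exp (b * t)"
proof -
  have "\<exists>C\<ge>0. \<forall>t\<ge>0. \<forall>i. cmod ((cmat (mat_exp (t *\<^sub>R A)) *v axis j 1) $ i) \<le> C * exp (b * t)" for j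
    using cmat_exp_growth[of A b] poly_act_annihilates[of "cmat A"] b by meson
  then obtain C where C: "\<And>j. C j \<ge> 0"
    "\<And>j t i. t \<ge> 0 \<Longrightarrow> cmod ((cmat (mat_exp (t *\<^sub>R A)) *v axis j 1) $ i) \<le> C j * exp (b * t)" by metis
  have e: "\<bar>mat_exp (t *\<^sub>R A) $ i $ j\<bar> \<le> C j * exp (b * t)" if "t \<ge> 0" for i j t
    using C(2)[OF that, of j i]
    by (simp add: matrix_vector_mult_def axis_def if_distrib[of "\<lambda>x. _ * x"] cong: if_cong)
  have "norm (mat_exp (t *\<^sub>R A)) \<le> (\<Sum>i\<in>(UNIV::'n set). \<Sum>j\<in>UNIV. C j) * exp (b * t)" if "t \<ge> 0" for t
  proof -
    have "norm (mat_exp (t *\<^sub>R A)) \<le> (\<Sum>i\<in>UNIV. norm (mat_exp (t *\<^sub>R A) $ i))"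
      unfolding norm_vec_def by (rule L2_set_le_sum) auto
    also have "\<dots> \<le> (\<Sum>i\<in>UNIV. \<Sum>j\<in>UNIV. \<bar>mat_exp (t *\<^sub>R A) $ i $ j\<bar>)"
      by (intro sum_mono norm_le_l1_cart)
    also have "\<dots> \<le> (\<Sum>i\<in>(UNIV::'n set). \<Sum>j\<in>UNIV. C j * exp (b * t))"
      by (intro sum_mono e that)
    finally show ?thesis by (simp add: sum_distrib_right mult.assoc)
  qed
  moreover have "(\<Sum>i\<in>(UNIV::'n set). \<Sum>j\<in>UNIV. C j) * x \<le> ((\<Sum>i\<in>(UNIV::'n set). \<Sum>j\<in>UNIV. C j) + 1) * x"
    if "x \<ge> 0" for x using that by (intro mult_right_mono) auto
  ultimately have "\<forall>t\<ge>0. norm (mat_exp (t *\<^sub>R A)) \<le> ((\<Sum>i\<in>(UNIV::'n set). \<Sum>j\<in>UNIV. C j) + 1) * exp (b * t)"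
    by (meson exp_ge_zero order_trans)
  moreover have "(\<Sum>i\<in>(UNIV::'n set). \<Sum>j\<in>UNIV. C j) + 1 > 0"
    using C(1) by (intro add_nonneg_pos sum_nonneg) auto
  ultimately show ?thesis by blast
qed

section \<open>The Levy exponent\<close>

lemma sphere_measure_id_measurable:
  assumes "sphere_measure \<sigma>"
  shows "(\<lambda>\<theta>. \<theta>) \<in> borel_measurable \<sigma>"
proof -
  have s: "sets \<sigma> = sets (restrict_space borel (sphere 0 1))"
    using assms by (simp add: sphere_measure_def)
  have "(\<lambda>\<theta>. \<theta>) \<in> borel_measurable (restrict_space borel (sphere 0 1))"
    by (rule measurable_restrict_space1) simp
  then show ?thesis using measurable_cong_sets[OF s refl] by blast
qed

lemma sphere_measure_space:
  assumes "sphere_measure \<sigma>"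
  shows "space \<sigma> = sphere 0 1"
  using assms sets_eq_imp_space_eq[of \<sigma> "restrict_space borel (sphere 0 1)"]
  by (simp add: sphere_measure_def space_restrict_space)

lemma nn_integral_polar_measure:
  fixes \<sigma> :: "'a::euclidean_space measure"
  assumes \<sigma>: "sphere_measure \<sigma>"
    and w [measurable]: "(\<lambda>(\<theta>, r). indicator {0<..} r * ennreal (r powr (- \<alpha> - 1) * p r \<theta>))
            \<in> borel_measurable (\<sigma> \<Otimes>\<^sub>M lborel)"
    and f [measurable]: "f \<in> borel_measurable borel"
  shows "(\<integral>\<^sup>+x. f x \<partial>polar_measure \<alpha> p \<sigma>) =
    (\<integral>\<^sup>+\<theta>. (\<integral>\<^sup>+r. indicator {0<..} r * ennreal (r powr (- \<alpha> - 1) * p r \<theta>) * f (r *\<^sub>R \<theta>) \<partial>lborel) \<partial>\<sigma>)"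
proof -
  note [measurable] = sphere_measure_id_measurable[OF \<sigma>]
  have [measurable]: "(\<lambda>(\<theta>, r). r *\<^sub>R \<theta>) \<in> measurable (\<sigma> \<Otimes>\<^sub>M lborel) borel"
    by measurable
  show ?thesis
    unfolding polar_measure_def
    by (simp add: nn_integral_distr nn_integral_density lborel.nn_integral_fst[symmetric] split_beta')
qed

text \<open>The order of magnitude of the Levy exponent at a vector of norm \<open>y\<close>. For
  \<alpha> < 2 the minimum is the square up to \<open>y = 1\<close>, reflecting the second moments
  that tempering makes finite, and the stable power beyond.\<close>

definition truncated_power :: "real \<Rightarrow> real \<Rightarrow> real" where
  "truncated_power \<alpha> y = min (y powr \<alpha>) (y\<^sup>2)"

lemma truncated_power_nonneg [simp]: "0 \<le> truncated_power \<alpha> y"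
  by (simp add: truncated_power_def)

lemma truncated_power_0 [simp]: "truncated_power \<alpha> 0 = 0"
  by (simp add: truncated_power_def)

lemma truncated_power_measurable [measurable]: "truncated_power \<alpha> \<in> borel_measurable borel"
  unfolding truncated_power_def[abs_def] by measurable

lemma truncated_power_mono:
  "0 \<le> x \<Longrightarrow> x \<le> y \<Longrightarrow> 0 \<le> \<alpha> \<Longrightarrow> truncated_power \<alpha> x \<le> truncated_power \<alpha> y"
  unfolding truncated_power_def by (intro min.mono powr_mono2 power_mono) auto

lemma truncated_power_scale:
  assumes "0 \<le> \<alpha>" "\<alpha> \<le> 2" "0 \<le> c" "0 \<le> y"
  shows "truncated_power \<alpha> (c * y) \<le> max 1 (c\<^sup>2) * truncated_power \<alpha> y"
proof -
  have "c powr \<alpha> \<le> max 1 (c\<^sup>2)"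
  proof (cases "c \<le> 1")
    case True
    then show ?thesis using powr_mono2[of \<alpha> c 1] assms by simp
  next
    case False
    then show ?thesis using powr_mono[of \<alpha> 2 c] assms by simp
  qed
  then have "(c * y) powr \<alpha> \<le> max 1 (c\<^sup>2) * y powr \<alpha>"
    using assms by (simp add: powr_mult mult_right_mono)
  moreover have "(c * y)\<^sup>2 \<le> max 1 (c\<^sup>2) * y\<^sup>2"
    by (simp add: power_mult_distrib mult_right_mono)
  ultimately show ?thesis
    unfolding truncated_power_def by (auto simp: min_def not_le intro: order_trans)
qed

text \<open>A sum is at most twice its larger term, which costs the factor 4 in both
  regimes.\<close>

lemma truncated_power_add:
  assumes "0 \<le> \<alpha>" "\<alpha> \<le> 2" "0 \<le> x" "0 \<le> y"
  shows "truncated_power \<alpha> (x + y) \<le> 4 * (truncated_power \<alpha> x + truncated_power \<alpha> y)"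
proof -
  have "truncated_power \<alpha> (x + y) \<le> truncated_power \<alpha> (2 * max x y)"
    using assms by (intro truncated_power_mono) auto
  also have "\<dots> \<le> 4 * truncated_power \<alpha> (max x y)"
    using truncated_power_scale[of \<alpha> 2 "max x y"] assms by simp
  also have "\<dots> \<le> 4 * (truncated_power \<alpha> x + truncated_power \<alpha> y)"
    by (simp add: max_def)
  finally show ?thesis .
qed

lemma powr_mult_square: "0 < r \<Longrightarrow> r powr b * r\<^sup>2 = r powr (b + 2)" for r b :: real
  by (simp add: powr_add)

text \<open>Packages a bound near 0 and a bound at infinity into one dominating function with a
  computable integral. Both indicators contain 1, which is harmless in an upper bound.\<close>

lemma split_bound:
  fixes r x c u v :: real
  assumes "0 \<le> c" "0 \<le> u" "0 \<le> v"
    and "0 < r \<Longrightarrow> r \<le> 1 \<Longrightarrow> x \<le> c * u" "1 < r \<Longrightarrow> x \<le> c * v"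
  shows "indicator {0<..} r * ennreal x \<le>
    ennreal c * (ennreal u * indicator {0..1} r + ennreal v * indicator {1..} r)"
proof -
  consider "r \<le> 0" | "0 < r" "r \<le> 1" | "1 < r" by linarith
  then show ?thesis
  proof cases
    case 2
    then have "ennreal x \<le> ennreal c * ennreal u"
      using assms by (simp add: ennreal_mult[symmetric] ennreal_leI)
    also have "\<dots> \<le> ennreal c * (ennreal u + ennreal v * indicator {1..} r)"
      by (intro mult_left_mono) auto
    finally show ?thesis using 2 by simp
  next
    case 3
    then show ?thesis
      using assms by (simp add: ennreal_mult[symmetric] ennreal_leI)
  qed simp
qed

text \<open>Two separate bounds give the minimum. For the square, \<open>(r * y)\<^sup>2\<close> is
  kept throughout and the exponential makes it integrable at infinity. For the power, the
  exponential is bounded by 1 and scaling \<open>r\<close> by \<open>y\<close> extracts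
  \<open>y powr \<alpha>\<close> from the purely stable integral.\<close>

lemma tempered_radial_integral_bound:
  fixes \<alpha> l :: real
  assumes "0 < \<alpha>" "\<alpha> < 2" "0 < l"
  shows "\<exists>C>0. \<forall>y\<ge>0. (\<integral>\<^sup>+r. indicator {0<..} r * ennreal (r powr (- \<alpha> - 1) * exp (- l * r)) *
      ennreal (min 1 ((r * y)\<^sup>2)) \<partial>lborel) \<le> ennreal (C * truncated_power \<alpha> y)"
proof -
  \<comment> \<open>From \<open>x / 3 \<le> exp (x / 3)\<close>, cubed, at \<open>x = l * r\<close>.
    An inverse cube outweighs the square of \<open>r\<close> for \<open>r \<ge> 1\<close>.\<close>
  define K where "K = 27 / l ^ 3"
  have K: "K > 0" using assms by (simp add: K_def)
  have exp_bound: "exp (- l * r) \<le> K * r powr (-3)" if "r > 0" for r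
  proof -
    have "l * r / 3 \<le> exp (l * r / 3)"
      using exp_ge_add_one_self[of "l * r / 3"] by linarith
    then have "(l * r / 3) ^ 3 \<le> exp (l * r / 3) ^ 3"
      using that assms by (intro power_mono) auto
    then have "(l * r) ^ 3 \<le> 27 * exp (l * r)"
      by (simp add: exp_of_nat_mult[symmetric] power_divide)
    then show ?thesis
      using that assms by (simp add: K_def exp_minus powr_minus field_simps power_mult_distrib)
  qed
  have I0: "(\<integral>\<^sup>+r. ennreal (r powr (1 - \<alpha>)) * indicator {0..1} r \<partial>lborel) = ennreal (1 / (2 - \<alpha>))"
  proof -
    have "((\<lambda>x. x powr (1 - \<alpha>)) has_integral 1 / (2 - \<alpha>)) {0..1}"
      using has_integral_powr_from_0[of "1 - \<alpha>" 1] assms by (simp add: algebra_simps)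
    from nn_integral_has_integral_lebesgue[OF _ this] show ?thesis
      by (simp add: ennreal_mult'' ennreal_indicator nn_integral_completion mult.commute)
  qed
  have I1: "(\<integral>\<^sup>+r. ennreal (r powr (- \<alpha> - 1)) * indicator {1..} r \<partial>lborel) = ennreal (1 / \<alpha>)"
  proof -
    have "((\<lambda>x. x powr (- \<alpha> - 1)) has_integral 1 / \<alpha>) {1..}"
      using has_integral_powr_to_inf[of "- \<alpha> - 1" 1] assms by simp
    from nn_integral_has_integral_lebesgue[OF _ this] show ?thesis
      by (simp add: ennreal_mult'' ennreal_indicator nn_integral_completion mult.commute)
  qed
  \<comment> \<open>One constant for both bounds: the second factor is the sum of the two elementary
    integrals, and \<open>1 + K\<close> bounds the exponential for \<open>r \<le> 1\<close> and the
    exponential times the square of \<open>r\<close> for \<open>r > 1\<close>.\<close>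
  define B where "B = (1 + K) * (1 / (2 - \<alpha>) + 1 / \<alpha>)"
  have B: "B > 0" using assms K by (simp add: B_def add_pos_pos)
  have base: "(\<integral>\<^sup>+r. ennreal c * (ennreal (r powr (1 - \<alpha>)) * indicator {0..1} r +
      ennreal (r powr (- \<alpha> - 1)) * indicator {1..} r) \<partial>lborel) = ennreal (c * (1 / (2 - \<alpha>) + 1 / \<alpha>))"
    if "c \<ge> 0" for c
    using that assms
    by (simp add: nn_integral_cmult nn_integral_add I0 I1 ennreal_mult'' flip: ennreal_plus)
  have sq: "(\<integral>\<^sup>+r. indicator {0<..} r * ennreal (r powr (- \<alpha> - 1) * exp (- l * r)) *
      ennreal (min 1 ((r * y)\<^sup>2)) \<partial>lborel) \<le> ennreal (B * y\<^sup>2)" for y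
  proof -
    have "(\<integral>\<^sup>+r. indicator {0<..} r * ennreal (r powr (- \<alpha> - 1) * exp (- l * r)) *
      ennreal (min 1 ((r * y)\<^sup>2)) \<partial>lborel) \<le>
      (\<integral>\<^sup>+r. ennreal ((1 + K) * y\<^sup>2) * (ennreal (r powr (1 - \<alpha>)) * indicator {0..1} r +
      ennreal (r powr (- \<alpha> - 1)) * indicator {1..} r) \<partial>lborel)"
    proof (rule nn_integral_mono)
      fix r :: real
      have f1: "r powr (- \<alpha> - 1) * exp (- l * r) * (r * y)\<^sup>2 \<le> (1 + K) * y\<^sup>2 * r powr (1 - \<alpha>)"
        if "0 < r" "r \<le> 1"
      proof -
        have "r powr (1 - \<alpha>) = r powr (- \<alpha> - 1) * r\<^sup>2"
          using that powr_mult_square[of r "- \<alpha> - 1"] by simp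
        moreover have "exp (- l * r) \<le> 1 + K" using that assms K
          by (smt (verit) exp_le_one_iff mult_nonneg_nonneg mult_minus_left)
        ultimately show ?thesis
          using mult_right_mono[of "exp (- l * r)" "1 + K" "r powr (- \<alpha> - 1) * r\<^sup>2 * y\<^sup>2"] by (simp add: power_mult_distrib mult_ac)
      qed
      have f2: "r powr (- \<alpha> - 1) * exp (- l * r) * (r * y)\<^sup>2 \<le> (1 + K) * y\<^sup>2 * r powr (- \<alpha> - 1)"
        if "1 < r"
      proof -
        have le: "exp (- l * r) * r\<^sup>2 \<le> K * r powr (-3) * r\<^sup>2"
          using exp_bound[of r] that by (intro mult_right_mono) auto
        have "r powr (-3) * r\<^sup>2 = r powr (-1)"
          using that powr_mult_square[of r "-3"] by simp
        also have "\<dots> \<le> 1" using that by (simp add: powr_minus_divide)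
        finally have "K * (r powr (-3) * r\<^sup>2) \<le> K * 1"
          using K by (intro mult_left_mono) auto
        with le have "exp (- l * r) * r\<^sup>2 \<le> 1 + K" by (simp add: mult.assoc)
        then show ?thesis
          using mult_right_mono[of "exp (- l * r) * r\<^sup>2" "1 + K" "r powr (- \<alpha> - 1) * y\<^sup>2"] by (simp add: power_mult_distrib mult_ac)
      qed
      have f3: "r powr (- \<alpha> - 1) * exp (- l * r) * min 1 ((r * y)\<^sup>2) \<le>
          r powr (- \<alpha> - 1) * exp (- l * r) * (r * y)\<^sup>2"
        by (intro mult_left_mono) auto
      have "indicator {0<..} r * ennreal (r powr (- \<alpha> - 1) * exp (- l * r) * min 1 ((r * y)\<^sup>2)) \<le>
        ennreal ((1 + K) * y\<^sup>2) * (ennreal (r powr (1 - \<alpha>)) * indicator {0..1} r +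
          ennreal (r powr (- \<alpha> - 1)) * indicator {1..} r)"
      proof (rule split_bound)
        show "r powr (- \<alpha> - 1) * exp (- l * r) * min 1 ((r * y)\<^sup>2) \<le> (1 + K) * y\<^sup>2 * r powr (1 - \<alpha>)"
          if "0 < r" "r \<le> 1"
          using f1[OF that] f3 by linarith
        show "r powr (- \<alpha> - 1) * exp (- l * r) * min 1 ((r * y)\<^sup>2) \<le> (1 + K) * y\<^sup>2 * r powr (- \<alpha> - 1)"
          if "1 < r"
          using f2[OF that] f3 by linarith
      qed (use K in simp_all)
      then show "indicator {0<..} r * ennreal (r powr (- \<alpha> - 1) * exp (- l * r)) *
          ennreal (min 1 ((r * y)\<^sup>2)) \<le>
        ennreal ((1 + K) * y\<^sup>2) * (ennreal (r powr (1 - \<alpha>)) * indicator {0..1} r +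
          ennreal (r powr (- \<alpha> - 1)) * indicator {1..} r)"
        by (simp add: ennreal_mult mult.assoc)
    qed
    also have "\<dots> = ennreal (B * y\<^sup>2)"
      using K by (subst base) (auto simp: B_def mult_ac)
    finally show ?thesis .
  qed
  have pw: "(\<integral>\<^sup>+r. indicator {0<..} r * ennreal (r powr (- \<alpha> - 1) * exp (- l * r)) *
      ennreal (min 1 ((r * y)\<^sup>2)) \<partial>lborel) \<le> ennreal (B * y powr \<alpha>)" if "y > 0" for y
  proof -
    let ?g = "\<lambda>r::real. ennreal (y powr (\<alpha> + 1)) * (ennreal (r powr (1 - \<alpha>)) * indicator {0..1} r +
      ennreal (r powr (- \<alpha> - 1)) * indicator {1..} r)"
    have "(\<integral>\<^sup>+r. indicator {0<..} r * ennreal (r powr (- \<alpha> - 1) * exp (- l * r)) *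
      ennreal (min 1 ((r * y)\<^sup>2)) \<partial>lborel) \<le> (\<integral>\<^sup>+r. ?g (0 + y * r) \<partial>lborel)"
    proof (rule nn_integral_mono)
      fix r :: real
      have p1: "r powr (- \<alpha> - 1) * exp (- l * r) * min 1 ((r * y)\<^sup>2) \<le> r powr (- \<alpha> - 1) * min 1 ((y * r)\<^sup>2)"
        if "r > 0"
      proof -
        have "exp (- l * r) \<le> 1" using that assms by simp
        then show ?thesis
          using mult_right_mono[of "exp (- l * r)" 1 "r powr (- \<alpha> - 1) * min 1 ((y * r)\<^sup>2)"] by (simp add: mult_ac)
      qed
      have e: "y powr (\<alpha> + 1) * (y * r) powr (- \<alpha> - 1) = r powr (- \<alpha> - 1)" if "r > 0"
      proof -
        have "y powr (\<alpha> + 1) * y powr (- \<alpha> - 1) = 1"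
          using \<open>y > 0\<close> by (simp add: powr_add[symmetric])
        then show ?thesis using that \<open>y > 0\<close> by (simp add: powr_mult mult.assoc[symmetric])
      qed
      have e2: "y powr (\<alpha> + 1) * (y * r) powr (1 - \<alpha>) = r powr (- \<alpha> - 1) * (y * r)\<^sup>2" if "r > 0"
      proof -
        have "(y * r) powr (1 - \<alpha>) = (y * r) powr (- \<alpha> - 1) * (y * r)\<^sup>2"
          using that \<open>y > 0\<close> powr_mult_square[of "y * r" "- \<alpha> - 1"] by simp
        then show ?thesis using e[OF that] by (metis mult.assoc)
      qed
      have b1: "r powr (- \<alpha> - 1) * exp (- l * r) * min 1 ((r * y)\<^sup>2) \<le> y powr (\<alpha> + 1) * (y * r) powr (1 - \<alpha>)"
        if "r > 0"
        using p1[OF that] e2[OF that] mult_left_mono[of "min 1 ((y * r)\<^sup>2)" "(y * r)\<^sup>2" "r powr (- \<alpha> - 1)"] by simp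
      have b2: "r powr (- \<alpha> - 1) * exp (- l * r) * min 1 ((r * y)\<^sup>2) \<le> y powr (\<alpha> + 1) * (y * r) powr (- \<alpha> - 1)"
        if "r > 0"
        using p1[OF that] e[OF that] mult_left_mono[of "min 1 ((y * r)\<^sup>2)" 1 "r powr (- \<alpha> - 1)"] by simp
      have "indicator {0<..} (y * r) * ennreal (r powr (- \<alpha> - 1) * exp (- l * r) * min 1 ((r * y)\<^sup>2)) \<le> ?g (y * r)"
      proof (rule split_bound)
        have pos: "0 < r" if "0 < y * r"
          using that \<open>y > 0\<close> by (simp add: zero_less_mult_iff)
        show "r powr (- \<alpha> - 1) * exp (- l * r) * min 1 ((r * y)\<^sup>2) \<le> y powr (\<alpha> + 1) * (y * r) powr (1 - \<alpha>)"
          if "0 < y * r" using b1 pos[OF that] .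
        show "r powr (- \<alpha> - 1) * exp (- l * r) * min 1 ((r * y)\<^sup>2) \<le> y powr (\<alpha> + 1) * (y * r) powr (- \<alpha> - 1)"
          if "1 < y * r" using b2 pos that by simp
      qed simp_all
      moreover have "indicator {0<..} (y * r) = (indicator {0<..} r :: ennreal)"
        using \<open>y > 0\<close> by (auto simp: indicator_def zero_less_mult_iff)
      ultimately show "indicator {0<..} r * ennreal (r powr (- \<alpha> - 1) * exp (- l * r)) *
          ennreal (min 1 ((r * y)\<^sup>2)) \<le> ?g (0 + y * r)"
        by (simp add: ennreal_mult mult.assoc)
    qed
    also have "\<dots> = (\<integral>\<^sup>+r. ?g r \<partial>lborel) / ennreal y"
    proof -
      have "(\<integral>\<^sup>+r. ?g r \<partial>lborel) = ennreal \<bar>y\<bar> * (\<integral>\<^sup>+r. ?g (0 + y * r) \<partial>lborel)"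
        using \<open>y > 0\<close> by (intro nn_integral_real_affine) auto
      then have "(\<integral>\<^sup>+r. ?g r \<partial>lborel) = (\<integral>\<^sup>+r. ?g (0 + y * r) \<partial>lborel) * ennreal y"
        using \<open>y > 0\<close> by (simp only: mult.commute abs_of_pos)
      then show ?thesis
        using \<open>y > 0\<close> by (simp only: ennreal_mult_divide_eq ennreal_neq_top ennreal_eq_0_iff not_le if_True simp_thms)
    qed
    also have "\<dots> = ennreal (y powr (\<alpha> + 1) * (1 / (2 - \<alpha>) + 1 / \<alpha>)) / ennreal y"
      by (subst base) auto
    also have "\<dots> = ennreal (y powr \<alpha> * (1 / (2 - \<alpha>) + 1 / \<alpha>))"
      using \<open>y > 0\<close> assms by (subst divide_ennreal) (auto simp: powr_add)
    also have "\<dots> \<le> ennreal (B * y powr \<alpha>)"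
      using K assms by (intro ennreal_leI) (simp add: B_def mult.commute mult_left_mono distrib_right)
    finally show ?thesis .
  qed
  show ?thesis
  proof (intro exI[of _ B] conjI allI impI)
    fix y :: real assume "y \<ge> 0"
    then show "(\<integral>\<^sup>+r. indicator {0<..} r * ennreal (r powr (- \<alpha> - 1) * exp (- l * r)) *
      ennreal (min 1 ((r * y)\<^sup>2)) \<partial>lborel) \<le> ennreal (B * truncated_power \<alpha> y)"
      using sq[of y] pw[of y] by (cases "y = 0") (auto simp: truncated_power_def min_def)
  qed (fact B)
qed

lemma one_minus_cos_le: "1 - cos (x::real) \<le> 2 * min 1 (x\<^sup>2)"
proof -
  have "1 - cos x = 2 * (sin (x / 2))\<^sup>2"
    using cos_double_sin[of "x / 2"] by simp
  moreover have "(sin (x / 2))\<^sup>2 \<le> (x / 2)\<^sup>2"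
    using abs_sin_x_le_abs_x[of "x / 2"] by (simp only: abs_le_square_iff[symmetric])
  moreover have "(x / 2)\<^sup>2 \<le> x\<^sup>2" by (simp add: power_divide)
  moreover have "(sin (x / 2))\<^sup>2 \<le> 1" by (simp add: abs_square_le_1)
  ultimately show ?thesis by auto
qed

lemma inner_truncation_le:
  fixes w x :: "'a::real_inner"
  shows "min 1 ((w \<bullet> x)\<^sup>2) \<le> min 1 ((norm w * norm x)\<^sup>2)"
proof -
  have "(w \<bullet> x)\<^sup>2 \<le> (norm w * norm x)\<^sup>2"
    using Cauchy_Schwarz_ineq2[of w x] by (metis abs_le_square_iff abs_of_nonneg mult_nonneg_nonneg norm_ge_zero)
  then show ?thesis by auto
qed

locale exponential_tempering =
  fixes \<alpha> l :: real and \<sigma> :: "'a::euclidean_space measure"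
  assumes alpha: "0 < \<alpha>" "\<alpha> < 2" and l: "0 < l" and sphere: "sphere_measure \<sigma>"
begin

lemma finite_measure_spectral: "finite_measure \<sigma>"
  using sphere by (simp add: sphere_measure_def)

lemma sphere_id_measurable [measurable]: "(\<lambda>\<theta>. \<theta>) \<in> borel_measurable \<sigma>"
  by (rule sphere_measure_id_measurable[OF sphere])

abbreviation levy where "levy \<equiv> exp_tempered_levy \<alpha> l \<sigma>"

lemma nn_integral_levy:
  assumes [measurable]: "f \<in> borel_measurable borel"
  shows "(\<integral>\<^sup>+x. f x \<partial>levy) =
    (\<integral>\<^sup>+\<theta>. (\<integral>\<^sup>+r. indicator {0<..} r * ennreal (r powr (- \<alpha> - 1) * exp (- l * r)) * f (r *\<^sub>R \<theta>) \<partial>lborel) \<partial>\<sigma>)"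
  unfolding exp_tempered_levy_def
  by (rule nn_integral_polar_measure[OF sphere]) measurable

lemma sets_levy [simp, measurable_cong]: "sets levy = sets borel"
  by (simp add: exp_tempered_levy_def polar_measure_def)

lemma levy_measurable [simp]: "f \<in> measurable levy N \<longleftrightarrow> f \<in> measurable borel N"
  by (simp add: measurable_cong_sets[OF sets_levy refl])

lemma radial_bound:
  obtains C where "C > 0" "\<And>y. y \<ge> 0 \<Longrightarrow>
    (\<integral>\<^sup>+r. indicator {0<..} r * ennreal (r powr (- \<alpha> - 1) * exp (- l * r)) * ennreal (min 1 ((r * y)\<^sup>2)) \<partial>lborel)
      \<le> ennreal (C * truncated_power \<alpha> y)"
  using tempered_radial_integral_bound[OF alpha l] by blast

definition exponent :: "'a \<Rightarrow> real" where
  "exponent w = - exp_tempered_psi \<alpha> l \<sigma> w"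

text \<open>Directions have norm 1, so this is the radial bound times the total mass of \<sigma>,
  enlarged by 1 to be positive. The size and continuity of the exponent and the Levy property of
  image measures all rest on it.\<close>

lemma truncation_bound:
  obtains C where "C > 0" "\<And>y. y \<ge> 0 \<Longrightarrow>
    (\<integral>\<^sup>+x. ennreal (min 1 ((y * norm x)\<^sup>2)) \<partial>levy) \<le> ennreal (C * truncated_power \<alpha> y)"
proof -
  interpret finite_measure \<sigma> by (rule finite_measure_spectral)
  obtain C where C: "C > 0" "\<And>y. y \<ge> 0 \<Longrightarrow>
    (\<integral>\<^sup>+r. indicator {0<..} r * ennreal (r powr (- \<alpha> - 1) * exp (- l * r)) * ennreal (min 1 ((r * y)\<^sup>2)) \<partial>lborel)
      \<le> ennreal (C * truncated_power \<alpha> y)"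
    using radial_bound by blast
  define S where "S = measure \<sigma> (space \<sigma>) + 1"
  have S: "S > 0" by (simp add: S_def add_nonneg_pos)
  have "(\<integral>\<^sup>+x. ennreal (min 1 ((y * norm x)\<^sup>2)) \<partial>levy) \<le> ennreal (C * S * truncated_power \<alpha> y)" if "y \<ge> 0" for y
  proof -
    have "(\<integral>\<^sup>+x. ennreal (min 1 ((y * norm x)\<^sup>2)) \<partial>levy) =
      (\<integral>\<^sup>+\<theta>. (\<integral>\<^sup>+r. indicator {0<..} r * ennreal (r powr (- \<alpha> - 1) * exp (- l * r)) * ennreal (min 1 ((y * norm (r *\<^sub>R \<theta>))\<^sup>2)) \<partial>lborel) \<partial>\<sigma>)"
      by (rule nn_integral_levy) measurable
    also have "\<dots> = (\<integral>\<^sup>+\<theta>. (\<integral>\<^sup>+r. indicator {0<..} r * ennreal (r powr (- \<alpha> - 1) * exp (- l * r)) * ennreal (min 1 ((r * y)\<^sup>2)) \<partial>lborel) \<partial>\<sigma>)"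
      by (intro nn_integral_cong) (auto simp: sphere_measure_space[OF sphere] indicator_def mult.commute power_mult_distrib)
    also have "\<dots> \<le> (\<integral>\<^sup>+\<theta>. ennreal (C * truncated_power \<alpha> y) \<partial>\<sigma>)"
      by (intro nn_integral_mono C that)
    also have "\<dots> = ennreal (C * truncated_power \<alpha> y) * ennreal (measure \<sigma> (space \<sigma>))"
      by (simp add: emeasure_eq_measure)
    also have "\<dots> \<le> ennreal (C * truncated_power \<alpha> y) * ennreal S"
      by (intro mult_left_mono ennreal_leI) (auto simp: S_def)
    also have "\<dots> = ennreal (C * S * truncated_power \<alpha> y)"
      using C S by (simp add: ennreal_mult'[symmetric] mult_ac)
    finally show ?thesis .
  qed
  with C S show thesis by (intro that[of "C * S"]) auto
qed

lemma integrable_truncation: "integrable levy (\<lambda>x. min 1 ((y * norm x)\<^sup>2))" if "y \<ge> 0"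
proof (rule integrableI_nonneg)
  obtain C where C: "C > 0" "\<And>y. y \<ge> 0 \<Longrightarrow>
    (\<integral>\<^sup>+x. ennreal (min 1 ((y * norm x)\<^sup>2)) \<partial>levy) \<le> ennreal (C * truncated_power \<alpha> y)"
    using truncation_bound by blast
  show "(\<integral>\<^sup>+x. ennreal (min 1 ((y * norm x)\<^sup>2)) \<partial>levy) < \<infinity>"
    using C(2)[OF that] by (rule le_less_trans) simp
qed auto

lemma integrable_one_minus_cos: "integrable levy (\<lambda>x. 1 - cos (w \<bullet> x))"
proof (rule Bochner_Integration.integrable_bound)
  show "integrable levy (\<lambda>x. 2 * min 1 ((norm w * norm x)\<^sup>2))"
    by (intro integrable_mult_right integrable_truncation) auto
  have "1 - cos (w \<bullet> x) \<le> 2 * min 1 ((norm w * norm x)\<^sup>2)" for x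
    using one_minus_cos_le[of "w \<bullet> x"] inner_truncation_le[of w x] by linarith
  then show "AE x in levy. norm (1 - cos (w \<bullet> x)) \<le> norm (2 * min 1 ((norm w * norm x)\<^sup>2))"
    by simp
qed auto

lemma exponent_eq: "exponent w = (LINT x|levy. 1 - cos (w \<bullet> x))"
  unfolding exponent_def exp_tempered_psi_def
  by (subst integral_minus[symmetric]) simp

lemma exponent_nn: "ennreal (exponent w) = (\<integral>\<^sup>+x. ennreal (1 - cos (w \<bullet> x)) \<partial>levy)"
  unfolding exponent_eq by (rule nn_integral_eq_integral[symmetric]) (auto simp: integrable_one_minus_cos)

lemma exponent_nonneg: "0 \<le> exponent w"
  unfolding exponent_eq by (intro Bochner_Integration.integral_nonneg) auto

lemma exponent_0: "exponent 0 = 0"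
  by (simp add: exponent_eq)

lemma exponent_bound:
  obtains C where "C > 0" "\<And>w. exponent w \<le> C * truncated_power \<alpha> (norm w)"
proof -
  obtain C where C: "C > 0" "\<And>y. y \<ge> 0 \<Longrightarrow>
    (\<integral>\<^sup>+x. ennreal (min 1 ((y * norm x)\<^sup>2)) \<partial>levy) \<le> ennreal (C * truncated_power \<alpha> y)"
    using truncation_bound by blast
  have "exponent w \<le> 2 * C * truncated_power \<alpha> (norm w)" for w
  proof -
    have "ennreal (exponent w) \<le> (\<integral>\<^sup>+x. 2 * ennreal (min 1 ((norm w * norm x)\<^sup>2)) \<partial>levy)"
      unfolding exponent_nn
    proof (rule nn_integral_mono)
      fix x
      have "1 - cos (w \<bullet> x) \<le> 2 * min 1 ((norm w * norm x)\<^sup>2)"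
        using one_minus_cos_le[of "w \<bullet> x"] inner_truncation_le[of w x] by linarith
      then have "ennreal (1 - cos (w \<bullet> x)) \<le> ennreal (2 * min 1 ((norm w * norm x)\<^sup>2))" by (rule ennreal_leI)
      then show "ennreal (1 - cos (w \<bullet> x)) \<le> 2 * ennreal (min 1 ((norm w * norm x)\<^sup>2))"
        by (simp add: ennreal_mult)
    qed
    also have "\<dots> \<le> 2 * ennreal (C * truncated_power \<alpha> (norm w))"
      by (subst nn_integral_cmult) (auto intro!: mult_left_mono C)
    also have "\<dots> = ennreal (2 * C * truncated_power \<alpha> (norm w))"
      using C by (simp add: ennreal_mult mult.assoc)
    finally show ?thesis using C by (subst (asm) ennreal_le_iff) auto
  qed
  with C show thesis by (intro that[of "2 * C"]) auto
qed

text \<open>The square root of the exponent is the \<open>L\<^sup>2\<close>-norm of \<open>sin (w \<bullet> x / 2)\<close> up to a factor,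
  hence subadditive; the form below avoids roots.\<close>

lemma exponent_add:
  assumes "0 < e"
  shows "exponent (u + v) \<le> (1 + e) * exponent u + (1 + 1 / e) * exponent v"
proof -
  have "1 - cos (a + b) \<le> (1 + e) * (1 - cos a) + (1 + 1 / e) * (1 - cos b)" for a b :: real
  proof -
    have c: "1 - cos x = 2 * (sin (x / 2))\<^sup>2" for x :: real
      using cos_double_sin[of "x / 2"] by simp
    define p q where "p = \<bar>sin (a / 2)\<bar>" and "q = \<bar>sin (b / 2)\<bar>"
    have "\<bar>sin ((a + b) / 2)\<bar> \<le> p + q"
    proof -
      have "\<bar>sin ((a + b) / 2)\<bar> \<le> \<bar>sin (a / 2)\<bar> * \<bar>cos (b / 2)\<bar> + \<bar>cos (a / 2)\<bar> * \<bar>sin (b / 2)\<bar>"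
        unfolding add_divide_distrib sin_add by (rule order_trans[OF abs_triangle_ineq]) (simp add: abs_mult)
      also have "\<dots> \<le> \<bar>sin (a / 2)\<bar> * 1 + 1 * \<bar>sin (b / 2)\<bar>"
        by (intro add_mono mult_mono) auto
      finally show ?thesis by (simp add: p_def q_def)
    qed
    then have "(sin ((a + b) / 2))\<^sup>2 \<le> (p + q)\<^sup>2"
      using abs_le_square_iff[of "sin ((a + b) / 2)" "p + q"] by (simp add: p_def q_def)
    \<comment> \<open>Young's inequality with parameter \<open>e\<close>: the difference of the two
      sides is \<open>(e * p - q)\<^sup>2 / e\<close>.\<close>
    also have "\<dots> \<le> (1 + e) * p\<^sup>2 + (1 + 1 / e) * q\<^sup>2"
    proof -
      have "0 \<le> (e * p - q)\<^sup>2 / e" using assms by simp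
      also have "\<dots> = (1 + e) * p\<^sup>2 + (1 + 1 / e) * q\<^sup>2 - (p + q)\<^sup>2"
        using assms by (simp add: field_simps power2_eq_square)
      finally show ?thesis by simp
    qed
    finally show ?thesis unfolding c by (simp add: p_def q_def)
  qed
  then have "exponent (u + v) \<le> (LINT x|levy. (1 + e) * (1 - cos (u \<bullet> x)) + (1 + 1 / e) * (1 - cos (v \<bullet> x)))"
    unfolding exponent_eq
    by (intro integral_mono integrable_one_minus_cos Bochner_Integration.integrable_add integrable_mult_right)
       (simp add: inner_add_left)
  also have "\<dots> = (1 + e) * exponent u + (1 + 1 / e) * exponent v"
    unfolding exponent_eq by (simp add: integrable_one_minus_cos)
  finally show ?thesis .
qed

lemma exponent_continuous: "continuous_on UNIV exponent"
proof (intro continuous_at_imp_continuous_on ballI, unfold continuous_at_sequentially, intro allI impI)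
  fix w and v :: "nat \<Rightarrow> 'a" assume v: "v \<longlonglongrightarrow> w"
  then have "Bseq v" by (metis convergentI convergent_imp_Bseq)
  then obtain R where R: "R > 0" "\<And>n. norm (v n) \<le> R" by (auto elim: BseqE)
  show "(exponent \<circ> v) \<longlonglongrightarrow> exponent w"
    unfolding comp_def exponent_eq
  proof (rule integral_dominated_convergence[where w="\<lambda>x. 2 * min 1 ((R * norm x)\<^sup>2)"])
    show "integrable levy (\<lambda>x. 2 * min 1 ((R * norm x)\<^sup>2))"
      using R by (intro integrable_mult_right integrable_truncation) auto
    show "AE x in levy. (\<lambda>n. 1 - cos (v n \<bullet> x)) \<longlonglongrightarrow> 1 - cos (w \<bullet> x)"
      using v by (intro AE_I2 tendsto_intros)
    fix n
    show "AE x in levy. norm (1 - cos (v n \<bullet> x)) \<le> 2 * min 1 ((R * norm x)\<^sup>2)"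
    proof (intro AE_I2)
      fix x :: 'a
      have "(norm (v n) * norm x)\<^sup>2 \<le> (R * norm x)\<^sup>2"
        using R by (intro power_mono mult_right_mono) auto
      then show "norm (1 - cos (v n \<bullet> x)) \<le> 2 * min 1 ((R * norm x)\<^sup>2)"
        using one_minus_cos_le[of "v n \<bullet> x"] inner_truncation_le[of "v n" x] by auto
    qed
  qed auto
qed

end

text \<open>A vanishing exponent forces \<open>cos (r * (w \<bullet> \<theta>)) = 1\<close> for
  almost all directions and radii. If \<open>w \<bullet> \<theta> \<noteq> 0\<close>, this fails on
  a whole interval of small radii; hence \<sigma> would be concentrated on the hyperplane orthogonal
  to \<open>w\<close>.\<close>

lemma exponent_eq_0_imp:
  fixes \<sigma> :: "(real^'m) measure"
  assumes "exponential_tempering \<alpha> l \<sigma>" and full: "not_in_hyperspace \<sigma>"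
    and z: "exponential_tempering.exponent \<alpha> l \<sigma> w = 0"
  shows "w = 0"
proof (rule ccontr)
  assume "w \<noteq> 0"
  interpret exponential_tempering \<alpha> l \<sigma> by fact
  let ?q = "\<lambda>r. indicator {0<..} r * ennreal (r powr (- \<alpha> - 1) * exp (- l * r))"
  have "(\<integral>\<^sup>+\<theta>. (\<integral>\<^sup>+r. ?q r * ennreal (1 - cos (w \<bullet> (r *\<^sub>R \<theta>))) \<partial>lborel) \<partial>\<sigma>) = 0"
    using exponent_nn[of w] z nn_integral_levy[of "\<lambda>x. ennreal (1 - cos (w \<bullet> x))"] by simp
  then have "AE \<theta> in \<sigma>. (\<integral>\<^sup>+r. ?q r * ennreal (1 - cos (w \<bullet> (r *\<^sub>R \<theta>))) \<partial>lborel) = 0"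
    by (subst (asm) nn_integral_0_iff_AE) auto
  then have "AE \<theta> in \<sigma>. \<theta> \<in> {x. w \<bullet> x = 0}"
  proof (rule AE_mp, intro AE_I2 impI)
    fix \<theta> assume "(\<integral>\<^sup>+r. ?q r * ennreal (1 - cos (w \<bullet> (r *\<^sub>R \<theta>))) \<partial>lborel) = 0"
    then have "AE r in lborel. ?q r * ennreal (1 - cos (w \<bullet> (r *\<^sub>R \<theta>))) = 0"
      by (subst (asm) nn_integral_0_iff_AE) auto
    then have ae: "AE r in lborel. r > 0 \<longrightarrow> cos (r * (w \<bullet> \<theta>)) = 1"
    proof (rule AE_mp, intro AE_I2 impI)
      fix r :: real assume *: "?q r * ennreal (1 - cos (w \<bullet> (r *\<^sub>R \<theta>))) = 0" and "r > 0"
      then have "1 - cos (r * (w \<bullet> \<theta>)) \<le> 0"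
        by (simp add: ennreal_eq_0_iff mult_le_0_iff)
      then show "cos (r * (w \<bullet> \<theta>)) = 1" by (simp add: antisym)
    qed
    have "w \<bullet> \<theta> = 0"
    proof (rule ccontr)
      assume y: "w \<bullet> \<theta> \<noteq> 0"
      let ?I = "{0<..<pi / \<bar>w \<bullet> \<theta>\<bar>}"
      have "AE r in lborel. r \<notin> ?I"
        using ae
      proof (rule AE_mp, intro AE_I2 impI notI)
        fix r assume r: "r > 0 \<longrightarrow> cos (r * (w \<bullet> \<theta>)) = 1" "r \<in> ?I"
        then have "cos (r * \<bar>w \<bullet> \<theta>\<bar>) = 1"
          by (cases "w \<bullet> \<theta> \<ge> 0") auto
        moreover have "0 < r * \<bar>w \<bullet> \<theta>\<bar>" "r * \<bar>w \<bullet> \<theta>\<bar> < pi"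
          using r y by (auto simp: field_simps)
        ultimately show False using cos_monotone_0_pi[of 0 "r * \<bar>w \<bullet> \<theta>\<bar>"] by simp
      qed
      then have "?I \<in> null_sets lborel"
        using AE_iff_null_sets[of ?I lborel] by simp
      then have "emeasure lborel ?I = 0" by blast
      moreover have "emeasure lborel ?I = ennreal (pi / \<bar>w \<bullet> \<theta>\<bar> - 0)"
        by (rule emeasure_lborel_Ioo) simp
      ultimately show False using y by simp
    qed
    then show "\<theta> \<in> {x. w \<bullet> x = 0}" by simp
  qed
  moreover have "subspace {x. w \<bullet> x = 0}" by (rule subspace_hyperplane)
  moreover have "dim {x. w \<bullet> x = 0} = CARD('m) - 1"
    using dim_hyperplane[OF \<open>w \<noteq> 0\<close>] by simp
  ultimately show False using full unfolding not_in_hyperspace_def by blast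
qed

section \<open>Stochastic integrals\<close>

text \<open>Since \<open>iexp x - 1\<close> has modulus \<open>2 * \<bar>sin (x / 2)\<bar>\<close>,
  characteristic functions are Lipschitz for the truncated distance that metrises convergence in
  probability.\<close>

lemma (in prob_space) norm_iexp_diff_le:
  fixes X Y :: "'a \<Rightarrow> real"
  assumes [measurable]: "X \<in> borel_measurable M" "Y \<in> borel_measurable M"
  shows "cmod ((CLINT \<omega>|M. iexp (X \<omega>)) - (CLINT \<omega>|M. iexp (Y \<omega>)))
    \<le> 2 * expectation (\<lambda>\<omega>. min 1 \<bar>X \<omega> - Y \<omega>\<bar>)"
proof -
  have i: "complex_integrable M (\<lambda>\<omega>. iexp (X \<omega>))" "complex_integrable M (\<lambda>\<omega>. iexp (Y \<omega>))"
    by (auto intro!: integrable_const_bound[where B=1])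
  have "(CLINT \<omega>|M. iexp (X \<omega>)) - (CLINT \<omega>|M. iexp (Y \<omega>)) = (CLINT \<omega>|M. iexp (X \<omega>) - iexp (Y \<omega>))"
    using i by simp
  also have "cmod \<dots> \<le> expectation (\<lambda>\<omega>. cmod (iexp (X \<omega>) - iexp (Y \<omega>)))"
    by (rule integral_norm_bound)
  also have "\<dots> \<le> expectation (\<lambda>\<omega>. 2 * min 1 \<bar>X \<omega> - Y \<omega>\<bar>)"
  proof (rule integral_mono)
    show "integrable M (\<lambda>\<omega>. cmod (iexp (X \<omega>) - iexp (Y \<omega>)))"
      using i by auto
    show "integrable M (\<lambda>\<omega>. 2 * min 1 \<bar>X \<omega> - Y \<omega>\<bar>)"
      by (rule integrable_const_bound[where B=2]) auto
    fix \<omega>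
    have "iexp (X \<omega>) - iexp (Y \<omega>) = iexp (Y \<omega>) * (iexp (X \<omega> - Y \<omega>) - 1)"
      by (simp add: algebra_simps exp_diff)
    then have "cmod (iexp (X \<omega>) - iexp (Y \<omega>)) = 2 * \<bar>sin ((X \<omega> - Y \<omega>) / 2)\<bar>"
      using dist_exp_i_1[of "X \<omega> - Y \<omega>"] by (simp add: norm_mult)
    also have "\<dots> \<le> 2 * min 1 \<bar>X \<omega> - Y \<omega>\<bar>"
      using abs_sin_x_le_abs_x[of "(X \<omega> - Y \<omega>) / 2"] by auto
    finally show "cmod (iexp (X \<omega>) - iexp (Y \<omega>)) \<le> 2 * min 1 \<bar>X \<omega> - Y \<omega>\<bar>" .
  qed
  finally show ?thesis by simp
qed

text \<open>The truncated expectation is a single quantity with a triangle inequality, hence handier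
  than a family of tail probabilities. One direction splits the expectation at \<open>r / 2\<close>,
  the other is Markov's inequality.\<close>

lemma (in prob_space) tendsto_in_prob_iff_expectation:
  fixes X :: "nat \<Rightarrow> 'a \<Rightarrow> 'b::euclidean_space"
  assumes [measurable]: "\<And>k. X k \<in> borel_measurable M" "Z \<in> borel_measurable M"
  shows "tendsto_in_prob M X Z sequentially \<longleftrightarrow>
    (\<lambda>k. expectation (\<lambda>\<omega>. min 1 (norm (X k \<omega> - Z \<omega>)))) \<longlonglongrightarrow> 0"
proof
  let ?e = "\<lambda>k. expectation (\<lambda>\<omega>. min 1 (norm (X k \<omega> - Z \<omega>)))"
  have e0: "?e k \<ge> 0" for k by (intro Bochner_Integration.integral_nonneg) auto
  have int: "integrable M (\<lambda>\<omega>. min 1 (norm (X k \<omega> - Z \<omega>)))" for k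
    by (rule integrable_const_bound[where B=1]) auto
  {
    assume *: "tendsto_in_prob M X Z sequentially"
    show "?e \<longlonglongrightarrow> 0"
    proof (rule LIMSEQ_I)
      fix r :: real assume "0 < r"
      then have "(\<lambda>k. measure M {\<omega>\<in>space M. norm (X k \<omega> - Z \<omega>) > r / 2}) \<longlonglongrightarrow> 0"
        using * half_gt_zero unfolding tendsto_in_prob_def by blast
      then obtain N where N: "\<And>k. k \<ge> N \<Longrightarrow> measure M {\<omega>\<in>space M. norm (X k \<omega> - Z \<omega>) > r / 2} < r / 2"
        using \<open>0 < r\<close> LIMSEQ_D[of _ 0 "r / 2"] by fastforce
      have eb: "?e k \<le> r / 2 + measure M {\<omega>\<in>space M. norm (X k \<omega> - Z \<omega>) > r / 2}" for k
      proof -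
        let ?A = "{\<omega>\<in>space M. norm (X k \<omega> - Z \<omega>) > r / 2}"
        have iA: "integrable M (\<lambda>\<omega>. indicat_real ?A \<omega>)"
          by (rule integrable_const_bound[where B=1]) (auto simp: indicator_def)
        have "?e k \<le> expectation (\<lambda>\<omega>. r / 2 + indicator ?A \<omega>)"
          by (rule integral_mono[OF int Bochner_Integration.integrable_add[OF integrable_const iA]])
             (use \<open>0 < r\<close> in \<open>auto simp: indicator_def\<close>)
        also have "\<dots> = r / 2 + measure M ?A"
          using iA by (subst Bochner_Integration.integral_add) (auto simp: prob_space)
        finally show ?thesis .
      qed
      have "norm (?e k - 0) < r" if "k \<ge> N" for k
        using N[OF that] eb[of k] e0[of k] unfolding real_norm_def by linarith
      then show "\<exists>N. \<forall>k\<ge>N. norm (?e k - 0) < r" by blast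
    qed
  }
  {
    assume *: "?e \<longlonglongrightarrow> 0"
    show "tendsto_in_prob M X Z sequentially"
      unfolding tendsto_in_prob_def
    proof (intro allI impI)
      fix r :: real assume "0 < r"
      \<comment> \<open>The truncated distance never exceeds 1, so Markov's inequality is applied at
        a threshold of at most 1.\<close>
      define r' where "r' = min 1 r"
      have r': "r' > 0" "r' \<le> 1" "r' \<le> r" using \<open>0 < r\<close> by (auto simp: r'_def)
      have b: "measure M {\<omega>\<in>space M. norm (X k \<omega> - Z \<omega>) > r} \<le> ?e k / r'" for k
      proof -
        have "measure M {\<omega>\<in>space M. norm (X k \<omega> - Z \<omega>) > r}
            \<le> measure M {\<omega>\<in>space M. min 1 (norm (X k \<omega> - Z \<omega>)) \<ge> r'}"
          using r' by (intro finite_measure_mono) auto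
        also have "\<dots> \<le> ?e k / r'"
          using integral_Markov_inequality_measure[OF int, where c=r' and A="space M"] r' by auto
        finally show ?thesis .
      qed
      have lim: "(\<lambda>k. ?e k / r') \<longlonglongrightarrow> 0"
        using tendsto_divide[OF * tendsto_const, of r'] r' by simp
      show "(\<lambda>k. measure M {\<omega>\<in>space M. norm (X k \<omega> - Z \<omega>) > r}) \<longlonglongrightarrow> 0"
        by (rule tendsto_sandwich[OF _ _ tendsto_const lim]) (auto simp: b)
    qed
  }
qed

text \<open>Averaging the characteristic function over \<open>[0, T]\<close> gives \<open>E (sin (T Y) / (T Y))\<close>,
  and \<open>sin z / z \<le> 1/2\<close> for \<open>\<bar>z\<bar> \<ge> 2\<close>.\<close>

lemma (in prob_space) tail_bound_char:
  fixes Y :: "'a \<Rightarrow> real"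
  assumes [measurable]: "Y \<in> borel_measurable M" and "0 < \<delta>"
    and K: "\<And>x. 0 \<le> x \<Longrightarrow> x \<le> 2 / \<delta> \<Longrightarrow> expectation (\<lambda>\<omega>. 1 - cos (x * Y \<omega>)) \<le> K"
  shows "measure M {\<omega>\<in>space M. \<bar>Y \<omega>\<bar> > \<delta>} \<le> 2 * K"
proof -
  define T where "T = 2 / \<delta>"
  have T: "T > 0" using \<open>0 < \<delta>\<close> by (simp add: T_def)
  let ?L = "restrict_space lborel {0..T}"
  interpret L: finite_measure ?L
    by (rule finite_measureI) (use T in \<open>simp add: space_restrict_space emeasure_restrict_space\<close>)
  interpret pair: pair_sigma_finite M ?L ..
  have [measurable]: "(\<lambda>x. x) \<in> borel_measurable ?L"
    by (rule measurable_restrict_space1) simp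
  have intp: "integrable (M \<Otimes>\<^sub>M ?L) (\<lambda>(\<omega>, x). 1 - cos (x * Y \<omega>))"
  proof -
    interpret pf: finite_measure "M \<Otimes>\<^sub>M ?L"
      by (intro finite_measure_pair_measure) unfold_locales
    have "norm (1 - cos z) \<le> 2" for z :: real
      using cos_ge_minus_one[of z] cos_le_one[of z] by (simp only: real_norm_def)
    then show ?thesis
      by (intro pf.integrable_const_bound[where B=2]) (auto simp: split_beta')
  qed
  have inner: "(LINT x|?L. 1 - cos (x * y)) \<ge> T / 2 * indicator {y. \<bar>y\<bar> > \<delta>} y" for y :: real
  proof (cases "\<bar>y\<bar> > \<delta>")
    case True
    then have "y \<noteq> 0" using \<open>0 < \<delta>\<close> by auto
    have "(LINT x|?L. 1 - cos (x * y)) = (LINT x:{0..T}|lborel. 1 - cos (x * y))"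
      by (simp add: set_lebesgue_integral_def integral_restrict_space)
    also have "\<dots> = (LINT x|lborel. (1 - cos (x * y)) * indicator {0..T} x)"
      by (simp add: set_lebesgue_integral_def mult.commute)
    also have "\<dots> = (T - sin (T * y) / y) - (0 - sin (0 * y) / y)"
      using T \<open>y \<noteq> 0\<close>
      by (intro integral_FTC_Icc_real) (auto intro!: derivative_eq_intros)
    finally have "(LINT x|?L. 1 - cos (x * y)) = T - sin (T * y) / y" by simp
    moreover have "\<bar>sin (T * y) / y\<bar> \<le> 1 / \<bar>y\<bar>"
      by (simp add: abs_divide divide_right_mono)
    moreover have "1 / \<bar>y\<bar> \<le> 1 / \<delta>"
      using True \<open>0 < \<delta>\<close> by (intro divide_left_mono) auto
    moreover have "1 / \<delta> = T / 2" by (simp add: T_def)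
    ultimately have "T / 2 \<le> (LINT x|?L. 1 - cos (x * y))" by linarith
    then show ?thesis using True by simp
  next
    case False
    then show ?thesis by (auto intro!: Bochner_Integration.integral_nonneg)
  qed
  have "T / 2 * measure M {\<omega>\<in>space M. \<bar>Y \<omega>\<bar> > \<delta>} = expectation (\<lambda>\<omega>. T / 2 * indicator {\<omega>\<in>space M. \<bar>Y \<omega>\<bar> > \<delta>} \<omega>)"
    by simp
  also have "\<dots> \<le> expectation (\<lambda>\<omega>. LINT x|?L. 1 - cos (x * Y \<omega>))"
  proof (rule integral_mono)
    show "integrable M (\<lambda>\<omega>. LINT x|?L. 1 - cos (x * Y \<omega>))"
      using pair.integrable_fst[OF intp] .
    show "integrable M (\<lambda>\<omega>. T / 2 * indicator {\<omega> \<in> space M. \<delta> < \<bar>Y \<omega>\<bar>} \<omega>)"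
      by (intro integrable_mult_right integrable_const_bound[where B=1]) auto
    fix \<omega> assume "\<omega> \<in> space M"
    then show "T / 2 * indicator {\<omega> \<in> space M. \<delta> < \<bar>Y \<omega>\<bar>} \<omega> \<le> (LINT x|?L. 1 - cos (x * Y \<omega>))"
      using inner[of "Y \<omega>"] by (auto simp: indicator_def)
  qed
  also have "\<dots> = (LINT x|?L. expectation (\<lambda>\<omega>. 1 - cos (x * Y \<omega>)))"
    using pair.Fubini_integral[OF intp] by simp
  also have "\<dots> \<le> (LINT x|?L. K)"
  proof (rule integral_mono)
    show "integrable ?L (\<lambda>x. expectation (\<lambda>\<omega>. 1 - cos (x * Y \<omega>)))"
      using pair.integrable_snd[OF intp] .
    fix x assume "x \<in> space ?L"
    then show "expectation (\<lambda>\<omega>. 1 - cos (x * Y \<omega>)) \<le> K"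
      by (intro K) (auto simp: space_restrict_space T_def)
  qed auto
  also have "\<dots> = K * T"
    using T by (simp add: measure_restrict_space space_restrict_space)
  finally show ?thesis using T by (simp add: field_simps)
qed

text \<open>What the integration theory uses of the exponent: continuity serves Fatou's lemma, the
  growth bound serves tails and existence. In \<open>eta_add\<close>, optimising over
  \<open>e\<close> turns the right side into the square of the sum of the roots of
  \<open>\<eta> u\<close> and \<open>\<eta> v\<close>.\<close>

locale levy_exponent =
  fixes \<alpha> :: real and \<eta> :: "'a::euclidean_space \<Rightarrow> real"
  assumes alpha: "0 < \<alpha>" "\<alpha> < 2"
    and eta_continuous: "continuous_on UNIV \<eta>"
    and eta_nonneg: "0 \<le> \<eta> w"
    and eta_0: "\<eta> 0 = 0"
    and eta_minus: "\<eta> (- w) = \<eta> w"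
    and eta_add: "0 < e \<Longrightarrow> \<eta> (u + v) \<le> (1 + e) * \<eta> u + (1 + 1 / e) * \<eta> v"
    and eta_bound_ex: "\<exists>C>0. \<forall>w. \<eta> w \<le> C * truncated_power \<alpha> (norm w)"
begin

lemma eta_measurable [measurable]: "\<eta> \<in> borel_measurable borel"
  using eta_continuous by (rule borel_measurable_continuous_onI)

lemma eta_sum_le: "\<eta> (\<Sum>j\<in>J. x j) \<le> 2 ^ card J * (\<Sum>j\<in>J. \<eta> (x j))"
proof (induction J rule: infinite_finite_induct)
  case (insert i J)
  have "\<eta> (\<Sum>j\<in>insert i J. x j) \<le> 2 * \<eta> (x i) + 2 * \<eta> (\<Sum>j\<in>J. x j)"
    using eta_add[of 1 "x i" "\<Sum>j\<in>J. x j"] insert by simp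
  also have "\<dots> \<le> 2 * (2 ^ card J * \<eta> (x i)) + 2 * (2 ^ card J * (\<Sum>j\<in>J. \<eta> (x j)))"
    using mult_right_mono[OF one_le_power[of "2::real" "card J"] eta_nonneg[of "x i"]] insert by simp
  also have "\<dots> = 2 ^ card (insert i J) * (\<Sum>j\<in>insert i J. \<eta> (x j))"
    using insert by (simp add: algebra_simps)
  finally show ?case .
qed (auto simp: eta_0)

end

text \<open>In terms of roots the two inequalities say
  \<open>\<bar>sqrt (x k) - sqrt L\<bar> \<le> sqrt (d k)\<close>. Without roots, \<open>e\<close>
  is fixed small against \<open>L\<close> before \<open>k\<close> is taken large.\<close>

lemma tendsto_of_quasi_triangle:
  fixes x :: "nat \<Rightarrow> real"
  assumes d: "d \<longlonglongrightarrow> 0"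
    and 1: "\<And>e k. 0 < e \<Longrightarrow> x k \<le> (1 + e) * L + (1 + 1 / e) * d k"
    and 2: "\<And>e k. 0 < e \<Longrightarrow> L \<le> (1 + e) * x k + (1 + 1 / e) * d k"
    and L: "0 \<le> L" and d0: "\<And>k. 0 \<le> d k"
  shows "x \<longlonglongrightarrow> L"
proof (rule LIMSEQ_I)
  fix r :: real assume "0 < r"
  define e where "e = min 1 (r / (4 * L + 4))"
  have e: "0 < e" "e \<le> 1" using \<open>0 < r\<close> L by (auto simp: e_def)
  have eL: "2 * (e * L) < r / 2"
  proof -
    have "e * L \<le> r / (4 * L + 4) * L" using L by (intro mult_right_mono) (auto simp: e_def)
    also have "\<dots> < r / 4" using L \<open>0 < r\<close> by (simp add: field_simps)
    finally show ?thesis by simp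
  qed
  \<comment> \<open>The factor 2 is spent in the lower estimate, where \<open>e * x k\<close> is
    itself replaced by the upper estimate of \<open>x k\<close> and so produces a second multiple of
    \<open>d k\<close>.\<close>
  define c where "c = 2 * (1 + 1 / e)"
  have c: "c > 0" using e by (simp add: c_def add_pos_pos)
  have "r / (2 * c) > 0" using c \<open>0 < r\<close> by simp
  then obtain N where N: "\<And>k. k \<ge> N \<Longrightarrow> d k < r / (2 * c)"
    using LIMSEQ_D[OF d, of "r / (2 * c)"] d0 by fastforce
  show "\<exists>N. \<forall>k\<ge>N. norm (x k - L) < r"
  proof (intro exI[of _ N] allI impI)
    fix k assume "k \<ge> N"
    then have cd: "c * d k < r / 2" using N[of k] c by (simp add: field_simps)
    have "x k - L \<le> e * L + (1 + 1 / e) * d k" using 1[of e k] e by (simp add: algebra_simps)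
    also have "\<dots> \<le> 2 * (e * L) + c * d k"
      using e L d0[of k] mult_right_mono[of "1 + 1 / e" c "d k"] mult_nonneg_nonneg[of e L]
      by (simp add: c_def add_nonneg_nonneg divide_le_cancel add_increasing)
    finally have u: "x k - L < r" using eL cd by linarith
    have dk: "0 \<le> (1 + 1 / e) * d k" by (intro mult_nonneg_nonneg d0) (use e in simp)
    have "e * x k \<le> e * ((1 + 1) * L + (1 + 1 / e) * d k)"
    proof -
      have "x k \<le> (1 + e) * L + (1 + 1 / e) * d k" using 1 e by blast
      also have "\<dots> \<le> (1 + 1) * L + (1 + 1 / e) * d k" using e L d0[of k] by (intro add_mono mult_right_mono) auto
      finally show ?thesis using e by (intro mult_left_mono) auto
    qed
    also have "\<dots> = 2 * (e * L) + e * ((1 + 1 / e) * d k)" by (simp add: algebra_simps)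
    also have "\<dots> \<le> 2 * (e * L) + 1 * ((1 + 1 / e) * d k)"
      using mult_right_mono[OF e(2) dk] by simp
    finally have ex: "e * x k \<le> 2 * (e * L) + 1 * ((1 + 1 / e) * d k)" .
    define m where "m = (1 + 1 / e) * d k"
    have "L \<le> (1 + e) * x k + m" using 2[of e k] e by (simp add: m_def)
    then have "L \<le> x k + e * x k + m" by (simp add: distrib_right)
    moreover have "c * d k = 2 * m" by (simp add: c_def m_def)
    ultimately have "L - x k \<le> 2 * (e * L) + c * d k"
      using ex unfolding m_def[symmetric] by linarith
    then have "L - x k < r" using eL cd by linarith
    with u show "norm (x k - L) < r" by simp
  qed
qed

section \<open>Random measures on finite families and integrals of simple functions\<close>

locale scattered_measure = levy_exponent \<alpha> \<eta>
  for \<alpha> :: real and \<eta> :: "real^'m \<Rightarrow> real" +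
  fixes P :: "'w measure" and M :: "(real^'n) set \<Rightarrow> 'w \<Rightarrow> real^'m"
  assumes scattered: "indep_scattered P M (\<lambda>w. - \<eta> w)"
begin

sublocale prob_space P
  using scattered by (simp add: indep_scattered_def)

lemma M_measurable [measurable]: "A \<in> finite_borel \<Longrightarrow> M A \<in> borel_measurable P"
  using scattered by (simp add: indep_scattered_def)

lemma empty_finite_borel [simp]: "{} \<in> finite_borel"
  by (simp add: finite_borel_def)

lemma M_sums:
  fixes A :: "nat \<Rightarrow> (real^'n) set"
  assumes "disjoint_family A" "range A \<subseteq> finite_borel" "(\<Union>i. A i) \<in> finite_borel"
  shows "AE \<omega> in P. (\<lambda>i. M (A i) \<omega>) sums M (\<Union>i. A i) \<omega>"
  using scattered assms unfolding indep_scattered_def by blast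

lemma char_M:
  assumes "A \<in> finite_borel"
  shows "(CLINT \<omega>|P. iexp (w \<bullet> M A \<omega>)) = exp (of_real (- (measure lborel A * \<eta> w)))"
proof -
  have "char_fun (distr P borel (M A)) w = exp (of_real (measure lborel A * - \<eta> w))"
    using scattered assms unfolding indep_scattered_def by blast
  then show ?thesis
    using assms by (simp add: char_fun_def integral_distr)
qed

text \<open>A constant series converges only if its terms vanish, so additivity over a sequence of
  empty sets settles the value at the empty set.\<close>

lemma M_empty: "AE \<omega> in P. M {} \<omega> = 0"
proof -
  have "AE \<omega> in P. (\<lambda>i::nat. M {} \<omega>) sums M {} \<omega>"
    using M_sums[of "\<lambda>_. {}"] by (simp add: disjoint_family_on_def)
  then show ?thesis
    by (rule AE_mp) (auto dest!: sums_summable simp: summable_const_iff)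
qed

lemma finite_borel_UN:
  "finite I \<Longrightarrow> (\<And>i. i \<in> I \<Longrightarrow> A i \<in> finite_borel) \<Longrightarrow> (\<Union>i\<in>I. A i) \<in> finite_borel"
proof (induction I rule: finite_induct)
  case (insert i I)
  then have "emeasure lborel (A i \<union> (\<Union>i\<in>I. A i)) \<le> emeasure lborel (A i) + emeasure lborel (\<Union>i\<in>I. A i)"
    by (intro emeasure_subadditive) (auto simp: finite_borel_def)
  with insert show ?case
    by (auto simp: finite_borel_def intro: le_less_trans)
qed simp

context
  fixes I :: "'i set" and A :: "'i \<Rightarrow> (real^'n) set"
  assumes fin: "finite I" and disj: "disjoint_family_on A I" and A: "\<And>i. i \<in> I \<Longrightarrow> A i \<in> finite_borel"
begin

text \<open>Additivity and independence are postulated for sequences; a finite family becomes one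
  when it is padded with empty sets.\<close>

lemma padded_sequence:
  "\<exists>B h. bij_betw h {..<card I} I \<and> disjoint_family B \<and> range B \<subseteq> finite_borel \<and>
    (\<forall>n<card I. B n = A (h n)) \<and> (\<forall>n\<ge>card I. B n = {}) \<and> (\<Union>n. B n) = (\<Union>i\<in>I. A i)"
proof -
  obtain h where h: "bij_betw h {..<card I} I"
    using ex_bij_betw_nat_finite[OF fin] by (auto simp: atLeast0LessThan)
  define B where "B = (\<lambda>n. if n < card I then A (h n) else {})"
  have hI: "h n \<in> I" if "n < card I" for n using h that by (auto simp: bij_betw_def)
  have "disjoint_family B"
    unfolding disjoint_family_on_def B_def
  proof (intro ballI impI)
    fix m n :: nat assume "m \<noteq> n"
    show "(if m < card I then A (h m) else {}) \<inter> (if n < card I then A (h n) else {}) = {}"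
    proof (cases "m < card I \<and> n < card I")
      case True
      then have "h m \<noteq> h n" using h \<open>m \<noteq> n\<close> by (auto simp: bij_betw_def inj_on_def)
      then show ?thesis using True disj hI by (auto simp: disjoint_family_on_def)
    qed auto
  qed
  moreover have "range B \<subseteq> finite_borel" using A hI by (auto simp: B_def)
  moreover have "(\<Union>n. B n) = (\<Union>n\<in>{..<card I}. A (h n))" by (auto simp: B_def split: if_splits)
  moreover have "(\<Union>n\<in>{..<card I}. A (h n)) = (\<Union>i\<in>h ` {..<card I}. A i)" by simp
  moreover have "h ` {..<card I} = I" using h by (simp add: bij_betw_def)
  moreover have "(\<forall>n<card I. B n = A (h n)) \<and> (\<forall>n\<ge>card I. B n = {})" by (simp add: B_def)
  ultimately show ?thesis using h by (intro exI[of _ B] exI[of _ h]) simp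
qed

lemma M_finite_UN: "AE \<omega> in P. M (\<Union>i\<in>I. A i) \<omega> = (\<Sum>i\<in>I. M (A i) \<omega>)"
proof -
  obtain B h where B: "bij_betw h {..<card I} I" "disjoint_family B" "range B \<subseteq> finite_borel"
    "\<forall>n<card I. B n = A (h n)" "\<forall>n\<ge>card I. B n = {}" "(\<Union>n. B n) = (\<Union>i\<in>I. A i)"
    using padded_sequence by (elim exE conjE)
  have "AE \<omega> in P. (\<lambda>n. M (B n) \<omega>) sums M (\<Union>n. B n) \<omega>"
    using finite_borel_UN[OF fin A] B by (intro M_sums) auto
  then show ?thesis
    using M_empty
  proof eventually_elim
    case (elim \<omega>)
    then have "(\<lambda>n. M (B n) \<omega>) sums (\<Sum>n<card I. M (B n) \<omega>)"
      using B(5) by (intro sums_finite) auto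
    with elim have "M (\<Union>i\<in>I. A i) \<omega> = (\<Sum>n<card I. M (B n) \<omega>)"
      unfolding B(6) by (blast intro: sums_unique2)
    also have "\<dots> = (\<Sum>n<card I. M (A (h n)) \<omega>)" using B(4) by simp
    also have "\<dots> = (\<Sum>i\<in>I. M (A i) \<omega>)"
      using sum.reindex_bij_betw[OF B(1), of "\<lambda>i. M (A i) \<omega>"] .
    finally show ?case .
  qed
qed

text \<open>Pairing each value with its vector \<open>k i\<close> leaves independent real variables.
  The characteristic function of their sum is a product, here evaluated at 1.\<close>

lemma char_sum_M:
  "(CLINT \<omega>|P. iexp (\<Sum>i\<in>I. k i \<bullet> M (A i) \<omega>)) = exp (of_real (- (\<Sum>i\<in>I. measure lborel (A i) * \<eta> (k i))))"
proof -
  obtain B h where B: "bij_betw h {..<card I} I" "disjoint_family B" "range B \<subseteq> finite_borel"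
    "\<forall>n<card I. B n = A (h n)" "\<forall>n\<ge>card I. B n = {}" "(\<Union>n. B n) = (\<Union>i\<in>I. A i)"
    using padded_sequence by (elim exE conjE)
  have hI: "h n \<in> I" if "n < card I" for n using B(1) that by (auto simp: bij_betw_def)
  have "indep_vars (\<lambda>_. borel) (\<lambda>n. M (B n)) UNIV"
    using scattered B(2,3) unfolding indep_scattered_def by blast
  then have "indep_vars (\<lambda>_. borel) (\<lambda>n. M (B n)) {..<card I}"
    by (rule indep_vars_subset) auto
  then have ind: "indep_vars (\<lambda>_. borel) (\<lambda>n \<omega>. k (h n) \<bullet> M (B n) \<omega>) {..<card I}"
    by (rule indep_vars_compose2[where Y="\<lambda>n x. k (h n) \<bullet> x"]) auto
  have meas: "(\<lambda>\<omega>. k (h n) \<bullet> M (B n) \<omega>) \<in> borel_measurable P" for n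
    using B(3) by (intro borel_measurable_inner M_measurable) auto
  have char1: "char (distr P borel Y) 1 = (CLINT \<omega>|P. iexp (Y \<omega>))" if "Y \<in> borel_measurable P" for Y
    using that by (simp add: char_def integral_distr)
  have "(\<Sum>i\<in>I. k i \<bullet> M (A i) \<omega>) = (\<Sum>n<card I. k (h n) \<bullet> M (B n) \<omega>)" for \<omega>
    using sum.reindex_bij_betw[OF B(1), of "\<lambda>i. k i \<bullet> M (A i) \<omega>"] B(4) by simp
  then have "(CLINT \<omega>|P. iexp (\<Sum>i\<in>I. k i \<bullet> M (A i) \<omega>)) =
      char (distr P borel (\<lambda>\<omega>. \<Sum>n<card I. k (h n) \<bullet> M (B n) \<omega>)) 1"
    using meas by (subst char1) auto
  also have "\<dots> = (\<Prod>n<card I. char (distr P borel (\<lambda>\<omega>. k (h n) \<bullet> M (B n) \<omega>)) 1)"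
    by (rule char_distr_sum[OF ind])
  also have "\<dots> = (\<Prod>n<card I. exp (of_real (- (measure lborel (A (h n)) * \<eta> (k (h n))))))"
    by (intro prod.cong refl, subst char1[OF meas]) (simp add: B(4) char_M A hI)
  also have "\<dots> = (\<Prod>i\<in>I. exp (of_real (- (measure lborel (A i) * \<eta> (k i)))))"
    by (rule prod.reindex_bij_betw[OF B(1)])
  also have "\<dots> = exp (of_real (- (\<Sum>i\<in>I. measure lborel (A i) * \<eta> (k i))))"
    by (simp add: exp_sum[OF fin, symmetric] sum_negf)
  finally show ?thesis .
qed

end

lemma simple_integrand_level_set:
  fixes F :: "real^'n \<Rightarrow> real^'m^'m"
  assumes "simple_integrand F" "D \<noteq> 0"
  shows "{s. F s = D} \<in> finite_borel"
proof -
  have F: "simple_function lborel F" "emeasure lborel {s. F s \<noteq> 0} < \<infinity>"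
    using assms by (auto simp: simple_integrand_def)
  have [measurable]: "F \<in> borel_measurable borel"
    using borel_measurable_simple_function[OF F(1)] by simp
  have s: "{s. F s = D} \<in> sets borel" "{s. F s \<noteq> 0} \<in> sets borel" by measurable
  have "emeasure lborel {s. F s = D} \<le> emeasure lborel {s. F s \<noteq> 0}"
    using s assms(2) by (intro emeasure_mono) auto
  with F s show ?thesis by (auto simp: finite_borel_def)
qed

lemma finite_range_simple: "simple_integrand F \<Longrightarrow> finite (range F)"
  by (auto simp: simple_integrand_def simple_function_def)

lemma simple_stoch_integral_measurable [measurable]:
  assumes "simple_integrand F"
  shows "simple_stoch_integral M F \<in> borel_measurable P"
  unfolding simple_stoch_integral_def[abs_def]
proof (rule borel_measurable_sum)
  fix D assume "D \<in> range F - {0}"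
  then have "{s. F s = D} \<in> finite_borel" using simple_integrand_level_set[OF assms] by simp
  then have [measurable]: "M {s. F s = D} \<in> borel_measurable P" by measurable
  have "(\<lambda>x. D *v x) \<in> borel_measurable borel"
    by (intro borel_measurable_continuous_onI matrix_vector_mult_linear_continuous_on)
  then show "(\<lambda>\<omega>. D *v M {s. F s = D} \<omega>) \<in> borel_measurable P" by measurable
qed

text \<open>The integrals of finitely many simple functions are rewritten over the common level sets
  of their joint function, which are disjoint and hence carry independent values.\<close>

lemma char_simple_stoch_integral:
  fixes F :: "'k::finite \<Rightarrow> real^'n \<Rightarrow> real^'m^'m" and w :: "'k \<Rightarrow> real^'m"
  assumes F: "\<And>j. simple_integrand (F j)"
  defines "u \<equiv> (\<lambda>s. \<Sum>j\<in>UNIV. transpose (F j s) *v w j)"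
  shows "integrable lborel (\<lambda>s. \<eta> (u s))"
    and "(CLINT \<omega>|P. iexp (\<Sum>j\<in>UNIV. w j \<bullet> simple_stoch_integral M (F j) \<omega>)) =
      exp (of_real (- (LINT s|lborel. \<eta> (u s))))"
proof -
  define U where "U = (\<lambda>s j. F j s)"
  \<comment> \<open>Only the common zero set may have infinite measure; every other joint level set
    lies in a level set of some \<open>F j\<close> at a nonzero value.\<close>
  define R where "R = range U - {\<lambda>_. 0}"
  define A where "A = (\<lambda>c. {s. U s = c})"
  define k where "k = (\<lambda>c :: 'k \<Rightarrow> real^'m^'m. \<Sum>j\<in>UNIV. transpose (c j) *v w j)"
  have "range U \<subseteq> Pi\<^sub>E UNIV (\<lambda>j. range (F j))" by (auto simp: U_def)
  moreover have "finite (Pi\<^sub>E (UNIV :: 'k set) (\<lambda>j. range (F j)))"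
    by (rule finite_PiE) (auto intro: finite_range_simple[OF F])
  ultimately have "finite (range U)" by (rule finite_subset)
  then have R: "finite R" by (simp add: R_def)
  have Fm [measurable]: "F j \<in> borel_measurable borel" for j
    using F[of j] borel_measurable_simple_function[of lborel "F j"] by (simp add: simple_integrand_def)
  have AR: "A c \<in> finite_borel" if "c \<in> R" for c
  proof -
    have "c \<noteq> (\<lambda>_. 0)" using that by (simp add: R_def)
    then obtain j where "c j \<noteq> 0" by (auto simp: fun_eq_iff)
    have "A c = (\<Inter>j. {s. F j s = c j})" by (auto simp: A_def U_def)
    also have "\<dots> \<in> sets borel" by measurable
    finally have s: "A c \<in> sets borel" .
    have fb: "{s. F j s = c j} \<in> finite_borel" using simple_integrand_level_set[OF F \<open>c j \<noteq> 0\<close>] .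
    then have "emeasure lborel (A c) \<le> emeasure lborel {s. F j s = c j}"
      by (intro emeasure_mono) (auto simp: A_def U_def finite_borel_def)
    with fb s show ?thesis by (auto simp: finite_borel_def)
  qed
  have disj: "disjoint_family_on A S" for S by (auto simp: disjoint_family_on_def A_def)
  have u_eq: "\<eta> (u s) = (\<Sum>c\<in>R. \<eta> (k c) * indicator (A c) s)" for s
  proof (cases "U s = (\<lambda>_. 0)")
    case True
    then have "u s = 0" unfolding u_def U_def by (auto simp: fun_eq_iff transpose_def vec_eq_iff matrix_vector_mult_def)
    moreover have "indicator (A c) s = (0::real)" if "c \<in> R" for c
      using that True by (auto simp: R_def A_def)
    ultimately show ?thesis by (simp add: eta_0)
  next
    case False
    then have "U s \<in> R" by (auto simp: R_def)
    have "(\<Sum>c\<in>R. \<eta> (k c) * indicator (A c) s) = (\<Sum>c\<in>R. if c = U s then \<eta> (k c) else 0)"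
      by (intro sum.cong) (auto simp: A_def indicator_def)
    also have "\<dots> = \<eta> (k (U s))" using \<open>U s \<in> R\<close> R by simp
    finally show ?thesis by (simp add: u_def k_def U_def)
  qed
  have iA: "integrable lborel (\<lambda>s. \<eta> (k c) * indicator (A c) s)" if "c \<in> R" for c
    using AR[OF that] by (intro integrable_mult_right) (auto simp: finite_borel_def)
  show "integrable lborel (\<lambda>s. \<eta> (u s))"
    unfolding u_eq by (intro Bochner_Integration.integrable_sum iA)
  have int_u: "(LINT s|lborel. \<eta> (u s)) = (\<Sum>c\<in>R. measure lborel (A c) * \<eta> (k c))"
    unfolding u_eq using iA by (simp add: mult.commute)
  have "AE \<omega> in P. simple_stoch_integral M (F j) \<omega> = (\<Sum>c\<in>R. c j *v M (A c) \<omega>)" for j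
  proof -
    \<comment> \<open>A level set of \<open>F j\<close> at a nonzero value is a finite disjoint
      union of joint level sets, so finite additivity applies outside finitely many null
      sets.\<close>
    have lev: "{s. F j s = D} = (\<Union>c\<in>{c\<in>R. c j = D}. A c)" if "D \<noteq> 0" for D
      using that by (auto simp: A_def U_def R_def fun_eq_iff)
    have "AE \<omega> in P. \<forall>D\<in>range (F j) - {0}. M {s. F j s = D} \<omega> = (\<Sum>c\<in>{c\<in>R. c j = D}. M (A c) \<omega>)"
    proof (rule AE_finite_allI)
      show "finite (range (F j) - {0})" using finite_range_simple[OF F] by simp
      fix D assume D: "D \<in> range (F j) - {0}"
      then show "AE \<omega> in P. M {s. F j s = D} \<omega> = (\<Sum>c\<in>{c\<in>R. c j = D}. M (A c) \<omega>)"
        using R AR by (subst lev) (auto intro!: M_finite_UN disj)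
    qed
    then show ?thesis
    proof eventually_elim
      case (elim \<omega>)
      have "simple_stoch_integral M (F j) \<omega> =
          (\<Sum>D\<in>range (F j) - {0}. \<Sum>c\<in>{c\<in>{c\<in>R. c j \<noteq> 0}. c j = D}. c j *v M (A c) \<omega>)"
        unfolding simple_stoch_integral_def
      proof (rule sum.cong[OF refl])
        fix D assume D: "D \<in> range (F j) - {0}"
        have "{c\<in>{c\<in>R. c j \<noteq> 0}. c j = D} = {c\<in>R. c j = D}" using D by auto
        moreover have "D *v M {s. F j s = D} \<omega> = (\<Sum>c\<in>{c\<in>R. c j = D}. c j *v M (A c) \<omega>)"
          using elim D by (simp add: mult_vec_sum)
        ultimately show "D *v M {s. F j s = D} \<omega> = (\<Sum>c\<in>{c\<in>{c\<in>R. c j \<noteq> 0}. c j = D}. c j *v M (A c) \<omega>)"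
          by simp
      qed
      also have "\<dots> = (\<Sum>c\<in>{c\<in>R. c j \<noteq> 0}. c j *v M (A c) \<omega>)"
        using R finite_range_simple[OF F, of j]
        by (intro sum.group) (auto simp: R_def U_def)
      also have "\<dots> = (\<Sum>c\<in>R. c j *v M (A c) \<omega>)"
        using R by (intro sum.mono_neutral_left) auto
      finally show ?case .
    qed
  qed
  then have "AE \<omega> in P. \<forall>j\<in>UNIV. simple_stoch_integral M (F j) \<omega> = (\<Sum>c\<in>R. c j *v M (A c) \<omega>)"
    by (intro AE_finite_allI) auto
  then have "AE \<omega> in P. (\<Sum>j\<in>UNIV. w j \<bullet> simple_stoch_integral M (F j) \<omega>) = (\<Sum>c\<in>R. k c \<bullet> M (A c) \<omega>)"
  proof eventually_elim
    case (elim \<omega>)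
    have "(\<Sum>j\<in>UNIV. w j \<bullet> simple_stoch_integral M (F j) \<omega>) = (\<Sum>j\<in>UNIV. \<Sum>c\<in>R. w j \<bullet> (c j *v M (A c) \<omega>))"
      using elim by (simp add: inner_sum_right)
    also have "\<dots> = (\<Sum>c\<in>R. \<Sum>j\<in>UNIV. (transpose (c j) *v w j) \<bullet> M (A c) \<omega>)"
      by (subst sum.swap) (simp add: dot_lmul_matrix transpose_matrix_vector)
    finally show ?case by (simp add: k_def inner_sum_left)
  qed
  then have "(CLINT \<omega>|P. iexp (\<Sum>j\<in>UNIV. w j \<bullet> simple_stoch_integral M (F j) \<omega>)) =
      (CLINT \<omega>|P. iexp (\<Sum>c\<in>R. k c \<bullet> M (A c) \<omega>))"
    using F AR by (intro integral_cong_AE) (auto simp del: of_real_sum intro!: borel_measurable_sum borel_measurable_inner)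
  also have "\<dots> = exp (of_real (- (\<Sum>c\<in>R. measure lborel (A c) * \<eta> (k c))))"
    by (rule char_sum_M[OF R disj AR])
  finally show "(CLINT \<omega>|P. iexp (\<Sum>j\<in>UNIV. w j \<bullet> simple_stoch_integral M (F j) \<omega>)) =
      exp (of_real (- (LINT s|lborel. \<eta> (u s))))"
    unfolding int_u .
qed

end

declare transpose_matrix_vector [simp del]

section \<open>Passage to the limit in the characteristic function\<close>

lemma ennreal_tendsto_0I:
  fixes f :: "nat \<Rightarrow> ennreal"
  assumes "\<And>e. 0 < e \<Longrightarrow> eventually (\<lambda>k. f k \<le> ennreal e) sequentially"
  shows "f \<longlonglongrightarrow> 0"
proof (rule order_tendstoI)
  fix a :: ennreal assume "0 < a"
  then obtain e where e: "0 < e" "ennreal e < a"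
    by (metis ennreal_0 ennreal_less_zero_iff dense le_less_trans less_top_ennreal not_le order_less_imp_le
        ennreal_eq_0_iff linorder_not_less order.strict_trans top.not_eq_extremum)
  from assms[OF e(1)] show "eventually (\<lambda>k. f k < a) sequentially"
    by eventually_elim (use e in auto)
qed auto

lemma min_one_mult_le:
  fixes x y c :: real
  assumes "0 \<le> c" "0 \<le> x" "y \<le> c * x"
  shows "min 1 y \<le> max 1 c * min 1 x"
proof (cases "x \<le> 1")
  case True
  have "c * x \<le> max 1 c * x" using assms by (intro mult_right_mono) auto
  with assms have "y \<le> max 1 c * x" by linarith
  with True show ?thesis by auto
qed auto

lemma min_one_add_le: "0 \<le> a \<Longrightarrow> 0 \<le> b \<Longrightarrow> y \<le> a + b \<Longrightarrow> min 1 y \<le> min 1 a + min (1::real) b"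
  by auto

lemma transpose_mult_vec_measurable:
  fixes f :: "real^'n \<Rightarrow> real^'m^'m"
  assumes [measurable]: "f \<in> borel_measurable borel"
  shows "(\<lambda>s. transpose (f s) *v w) \<in> borel_measurable borel"
proof -
  have "(\<lambda>A :: real^'m^'m. transpose A *v w) \<in> borel_measurable borel"
    by (intro borel_measurable_continuous_onI)
       (auto intro!: continuous_intros simp: transpose_def matrix_vector_mult_def)
  then show ?thesis by measurable
qed

context scattered_measure
begin

text \<open>Additivity of the random measure, and with it linearity of the simple integral, holds
  only almost surely. Reading the difference as a pair indexed by \<open>bool\<close> with the
  vectors \<open>w\<close> and \<open>- w\<close> leaves this to the joint formula.\<close>

lemma char_simple_diff:
  assumes F: "simple_integrand F" "simple_integrand G"
  shows "integrable lborel (\<lambda>s. \<eta> (transpose (F s - G s) *v w))"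
    and "(CLINT \<omega>|P. iexp (w \<bullet> (simple_stoch_integral M F \<omega> - simple_stoch_integral M G \<omega>))) =
    exp (of_real (- (LINT s|lborel. \<eta> (transpose (F s - G s) *v w))))"
proof -
  let ?F = "\<lambda>b. if b then F else G" and ?w = "\<lambda>b. if b then w else - w"
  have u: "(\<Sum>b\<in>UNIV. transpose (?F b s) *v ?w b) = transpose (F s - G s) *v w" for s
    by (simp add: UNIV_bool transpose_def matrix_vector_mult_def vec_eq_iff sum_negf sum_subtractf
        left_diff_distrib)
  have sF: "simple_integrand (?F b)" for b using F by simp
  have Z: "(\<Sum>b\<in>UNIV. ?w b \<bullet> simple_stoch_integral M (?F b) \<omega>) =
      w \<bullet> (simple_stoch_integral M F \<omega> - simple_stoch_integral M G \<omega>)" for \<omega>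
    by (simp add: UNIV_bool inner_diff_right)
  show "integrable lborel (\<lambda>s. \<eta> (transpose (F s - G s) *v w))"
    using char_simple_stoch_integral(1)[of ?F ?w, OF sF] by (simp only: u)
  show "(CLINT \<omega>|P. iexp (w \<bullet> (simple_stoch_integral M F \<omega> - simple_stoch_integral M G \<omega>))) =
    exp (of_real (- (LINT s|lborel. \<eta> (transpose (F s - G s) *v w))))"
    using char_simple_stoch_integral(2)[of ?F ?w, OF sF] by (simp only: u Z)
qed

text \<open>Convergence in probability makes \<open>\<integral> \<eta> ((F k - F j)\<^sup>T w)\<close> small for large \<open>j\<close>, \<open>k\<close>; Fatou's lemma in \<open>j\<close>
  then replaces \<open>F j\<close> by its limit.\<close>

lemma stoch_integral_approx:
  assumes X: "has_stoch_integral P M f X"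
  obtains F where "\<And>k. simple_integrand (F k)"
    "tendsto_in_prob P (\<lambda>k. simple_stoch_integral M (F k)) X sequentially"
    "\<And>w. (\<lambda>k. \<integral>\<^sup>+s. ennreal (\<eta> (transpose (F k s - f s) *v w)) \<partial>lborel) \<longlonglongrightarrow> 0"
proof -
  have [measurable]: "f \<in> borel_measurable borel" "X \<in> borel_measurable P"
    using X by (auto simp: has_stoch_integral_def)
  obtain F where F: "\<And>k. simple_integrand (F k)" "AE s in lborel. (\<lambda>k. F k s) \<longlonglongrightarrow> f s"
    "tendsto_in_prob P (\<lambda>k. simple_stoch_integral M (F k)) X sequentially"
    using X unfolding has_stoch_integral_def by blast
  have [measurable]: "F k \<in> borel_measurable borel" for k
    using F(1)[of k] borel_measurable_simple_function[of lborel "F k"] by (simp add: simple_integrand_def)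
  define I where "I = (\<lambda>k. simple_stoch_integral M (F k))"
  have [measurable]: "I k \<in> borel_measurable P" for k
    using simple_stoch_integral_measurable[OF F(1)] by (simp add: I_def)
  define e where "e = (\<lambda>k. expectation (\<lambda>\<omega>. min 1 (norm (I k \<omega> - X \<omega>))))"
  have e: "e \<longlonglongrightarrow> 0"
  proof -
    have "tendsto_in_prob P I X sequentially" using F(3) by (simp add: I_def)
    then show ?thesis by (subst (asm) tendsto_in_prob_iff_expectation) (auto simp: e_def)
  qed
  have int_e: "integrable P (\<lambda>\<omega>. min 1 (norm (I k \<omega> - X \<omega>)))" for k
    by (rule integrable_const_bound[where B=1]) auto
  have "(\<lambda>k. \<integral>\<^sup>+s. ennreal (\<eta> (transpose (F k s - f s) *v w)) \<partial>lborel) \<longlonglongrightarrow> 0" for w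
  proof (rule ennreal_tendsto_0I)
    fix r :: real assume "0 < r"
    define K where "K = 2 * max 1 (norm w)"
    have K: "K > 0" by (simp add: K_def)
    define a where "a = (\<lambda>k j. LINT s|lborel. \<eta> (transpose (F k s - F j s) *v w))"
    have ia: "integrable lborel (\<lambda>s. \<eta> (transpose (F k s - F j s) *v w))" for k j
      by (rule char_simple_diff(1)[OF F(1) F(1)])
    \<comment> \<open>The left side is the distance to 1 of the characteristic function of
      \<open>I k - I j\<close>, which the triangle inequality through \<open>X\<close>
      controls.\<close>
    have bound: "1 - exp (- a k j) \<le> K * (e k + e j)" for k j
    proof -
      have "exp (of_real (- a k j)) = (CLINT \<omega>|P. iexp (w \<bullet> I k \<omega> - w \<bullet> I j \<omega>))"
        using char_simple_diff(2)[OF F(1) F(1), of w k j] by (simp only: I_def a_def inner_diff_right)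
      then have "cmod (exp (of_real (- a k j)) - 1) =
          cmod ((CLINT \<omega>|P. iexp (w \<bullet> I k \<omega> - w \<bullet> I j \<omega>)) - (CLINT \<omega>|P. iexp 0))"
        by (simp add: prob_space)
      also have "\<dots> \<le> 2 * expectation (\<lambda>\<omega>. min 1 \<bar>(w \<bullet> I k \<omega> - w \<bullet> I j \<omega>) - 0\<bar>)"
        by (rule norm_iexp_diff_le) auto
      also have "\<dots> \<le> 2 * expectation (\<lambda>\<omega>. max 1 (norm w) * (min 1 (norm (I k \<omega> - X \<omega>)) + min 1 (norm (I j \<omega> - X \<omega>))))"
      proof (intro mult_left_mono integral_mono)
        show "integrable P (\<lambda>\<omega>. max 1 (norm w) * (min 1 (norm (I k \<omega> - X \<omega>)) + min 1 (norm (I j \<omega> - X \<omega>))))"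
          using int_e by (intro integrable_mult_right Bochner_Integration.integrable_add)
        show "integrable P (\<lambda>\<omega>. min 1 \<bar>(w \<bullet> I k \<omega> - w \<bullet> I j \<omega>) - 0\<bar>)"
          by (rule integrable_const_bound[where B=1]) auto
        fix \<omega>
        have "\<bar>(w \<bullet> I k \<omega> - w \<bullet> I j \<omega>) - 0\<bar> \<le> norm w * norm (I k \<omega> - I j \<omega>)"
          using Cauchy_Schwarz_ineq2[of w "I k \<omega> - I j \<omega>"] by (simp add: inner_diff_right)
        then have "min 1 \<bar>(w \<bullet> I k \<omega> - w \<bullet> I j \<omega>) - 0\<bar> \<le> max 1 (norm w) * min 1 (norm (I k \<omega> - I j \<omega>))"
          by (intro min_one_mult_le) auto
        also have "\<dots> \<le> max 1 (norm w) * (min 1 (norm (I k \<omega> - X \<omega>)) + min 1 (norm (I j \<omega> - X \<omega>)))"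
          using norm_triangle_ineq4[of "I k \<omega> - X \<omega>" "I j \<omega> - X \<omega>"]
          by (intro mult_left_mono min_one_add_le) auto
        finally show "min 1 \<bar>(w \<bullet> I k \<omega> - w \<bullet> I j \<omega>) - 0\<bar> \<le>
            max 1 (norm w) * (min 1 (norm (I k \<omega> - X \<omega>)) + min 1 (norm (I j \<omega> - X \<omega>)))" .
      qed simp
      also have "\<dots> = K * (e k + e j)"
        using int_e by (simp add: K_def e_def)
      finally have "cmod (of_real (exp (- a k j) - 1)) \<le> K * (e k + e j)"
        by (simp only: exp_of_real of_real_diff of_real_1)
      then show "1 - exp (- a k j) \<le> K * (e k + e j)" unfolding norm_of_real by linarith
    qed
    \<comment> \<open>With \<open>e k\<close> and \<open>e j\<close> below this threshold the bound
      reads \<open>1 - exp (- a k j) \<le> 1 - exp (- r)\<close>, that is,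
      \<open>a k j \<le> r\<close>.\<close>
    have "0 < (1 - exp (- r)) / (2 * K)" using K \<open>0 < r\<close> by simp
    then obtain N where N: "\<And>k. k \<ge> N \<Longrightarrow> norm (e k - 0) < (1 - exp (- r)) / (2 * K)"
      using LIMSEQ_D[OF e] by blast
    have ar: "a k j \<le> r" if "k \<ge> N" "j \<ge> N" for k j
    proof -
      have "e k + e j \<le> (1 - exp (- r)) / (2 * K) + (1 - exp (- r)) / (2 * K)"
        using N[OF that(1)] N[OF that(2)] by (intro add_mono) auto
      also have "\<dots> = (1 - exp (- r)) / K" using K by (simp add: field_simps)
      finally have "K * (e k + e j) \<le> 1 - exp (- r)" using K by (simp add: field_simps)
      with bound[of k j] have "exp (- r) \<le> exp (- a k j)" by linarith
      then show ?thesis by simp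
    qed
    have "(\<integral>\<^sup>+s. ennreal (\<eta> (transpose (F k s - f s) *v w)) \<partial>lborel) \<le> ennreal r" if "k \<ge> N" for k
    proof -
      have cont: "continuous_on UNIV (\<lambda>B :: real^'m^'m. \<eta> (transpose B *v w))"
        by (rule continuous_on_compose2[OF eta_continuous])
           (auto intro!: continuous_intros simp: transpose_def matrix_vector_mult_def)
      have "(\<integral>\<^sup>+s. ennreal (\<eta> (transpose (F k s - f s) *v w)) \<partial>lborel) \<le>
          (\<integral>\<^sup>+s. liminf (\<lambda>j. ennreal (\<eta> (transpose (F k s - F j s) *v w))) \<partial>lborel)"
        using F(2)
      proof (intro nn_integral_mono_AE, eventually_elim)
        case (elim s)
        then have "(\<lambda>j. F k s - F j s) \<longlonglongrightarrow> F k s - f s" by (intro tendsto_intros)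
        then have "(\<lambda>j. \<eta> (transpose (F k s - F j s) *v w)) \<longlonglongrightarrow> \<eta> (transpose (F k s - f s) *v w)"
          using continuous_on_tendsto_compose[OF cont] by auto
        then have "(\<lambda>j. ennreal (\<eta> (transpose (F k s - F j s) *v w))) \<longlonglongrightarrow> ennreal (\<eta> (transpose (F k s - f s) *v w))"
          by (rule tendsto_ennrealI)
        then show ?case by (simp add: lim_imp_Liminf)
      qed
      also have "\<dots> \<le> liminf (\<lambda>j. \<integral>\<^sup>+s. ennreal (\<eta> (transpose (F k s - F j s) *v w)) \<partial>lborel)"
        by (rule nn_integral_liminf) (measurable, (rule transpose_mult_vec_measurable, measurable)+)
      also have "\<dots> = liminf (\<lambda>j. ennreal (a k j))"
        using ia eta_nonneg by (simp add: a_def nn_integral_eq_integral)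
      also have "\<dots> \<le> limsup (\<lambda>j. ennreal (a k j))"
        by (rule Liminf_le_Limsup) simp
      also have "\<dots> \<le> ennreal r"
        using ar[OF that] by (intro Limsup_bounded) (auto simp: eventually_sequentially intro!: exI[of _ N] ennreal_leI)
      finally show ?thesis .
    qed
    then show "eventually (\<lambda>k. (\<integral>\<^sup>+s. ennreal (\<eta> (transpose (F k s - f s) *v w)) \<partial>lborel) \<le> ennreal r) sequentially"
      by (auto simp: eventually_sequentially)
  qed
  with F show thesis using that[of F] by blast
qed

text \<open>Both sides of the formula for simple integrands converge: the left because the integrals
  converge in probability, the right by \<open>tendsto_of_quasi_triangle\<close>, where the integral
  of \<eta> at the difference of the integrands plays the role of a distance. Several integrands are
  carried along because joint laws are wanted, and the versions \<open>X j\<close> are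
  arbitrary.\<close>

theorem char_stoch_integral:
  fixes f :: "'k::finite \<Rightarrow> real^'n \<Rightarrow> real^'m^'m" and w :: "'k \<Rightarrow> real^'m"
  assumes X: "\<And>j. has_stoch_integral P M (f j) (X j)"
  defines "u \<equiv> (\<lambda>s. \<Sum>j\<in>UNIV. transpose (f j s) *v w j)"
  shows "integrable lborel (\<lambda>s. \<eta> (u s))"
    and "(CLINT \<omega>|P. iexp (\<Sum>j\<in>UNIV. w j \<bullet> X j \<omega>)) = exp (of_real (- (LINT s|lborel. \<eta> (u s))))"
proof -
  have [measurable]: "f j \<in> borel_measurable borel" "X j \<in> borel_measurable P" for j
    using X by (auto simp: has_stoch_integral_def)
  have "\<forall>j. \<exists>F. (\<forall>k. simple_integrand (F k)) \<and>
    tendsto_in_prob P (\<lambda>k. simple_stoch_integral M (F k)) (X j) sequentially \<and>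
    (\<forall>w. (\<lambda>k. \<integral>\<^sup>+s. ennreal (\<eta> (transpose (F k s - f j s) *v w)) \<partial>lborel) \<longlonglongrightarrow> 0)"
  proof
    fix j
    show "\<exists>F. (\<forall>k. simple_integrand (F k)) \<and>
      tendsto_in_prob P (\<lambda>k. simple_stoch_integral M (F k)) (X j) sequentially \<and>
      (\<forall>w. (\<lambda>k. \<integral>\<^sup>+s. ennreal (\<eta> (transpose (F k s - f j s) *v w)) \<partial>lborel) \<longlonglongrightarrow> 0)"
      by (rule stoch_integral_approx[OF X[of j]]) (intro exI conjI allI)
  qed
  from choice[OF this] obtain F where F': "\<forall>j. (\<forall>k. simple_integrand (F j k)) \<and>
    tendsto_in_prob P (\<lambda>k. simple_stoch_integral M (F j k)) (X j) sequentially \<and>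
    (\<forall>w. (\<lambda>k. \<integral>\<^sup>+s. ennreal (\<eta> (transpose (F j k s - f j s) *v w)) \<partial>lborel) \<longlonglongrightarrow> 0)" ..
  have F: "\<And>j k. simple_integrand (F j k)"
    "\<And>j. tendsto_in_prob P (\<lambda>k. simple_stoch_integral M (F j k)) (X j) sequentially"
    "\<And>j w. (\<lambda>k. \<integral>\<^sup>+s. ennreal (\<eta> (transpose (F j k s - f j s) *v w)) \<partial>lborel) \<longlonglongrightarrow> 0"
    using F' by simp_all
  have [measurable]: "F j k \<in> borel_measurable borel" for j k
    using F(1)[of j k] borel_measurable_simple_function[of lborel "F j k"] by (simp add: simple_integrand_def)
  have [measurable]: "simple_stoch_integral M (F j k) \<in> borel_measurable P" for j k
    using simple_stoch_integral_measurable[OF F(1)] .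
  note [measurable] = transpose_mult_vec_measurable
  have um [measurable]: "u \<in> borel_measurable borel" unfolding u_def by measurable
  define v where "v = (\<lambda>k s. \<Sum>j\<in>UNIV. transpose (F j k s) *v w j)"
  have vm [measurable]: "v k \<in> borel_measurable borel" for k unfolding v_def by measurable
  have iv: "integrable lborel (\<lambda>s. \<eta> (v k s))"
    and cv: "(CLINT \<omega>|P. iexp (\<Sum>j\<in>UNIV. w j \<bullet> simple_stoch_integral M (F j k) \<omega>)) = exp (of_real (- (LINT s|lborel. \<eta> (v k s))))"
    for k
    using char_simple_stoch_integral[of "\<lambda>j. F j k" w, OF F(1)] by (auto simp: v_def)
  define \<delta> where "\<delta> = (\<lambda>k. \<integral>\<^sup>+s. ennreal (\<eta> (v k s - u s)) \<partial>lborel)"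
  have "\<delta> \<longlonglongrightarrow> 0"
  proof (rule tendsto_sandwich[OF _ _ tendsto_const])
    let ?b = "\<lambda>k. ennreal (2 ^ CARD('k)) * (\<Sum>j\<in>UNIV. \<integral>\<^sup>+s. ennreal (\<eta> (transpose (F j k s - f j s) *v w j)) \<partial>lborel)"
    have "\<delta> k \<le> ?b k" for k
    proof -
      have "v k s - u s = (\<Sum>j\<in>UNIV. transpose (F j k s - f j s) *v w j)" for s
        by (simp add: v_def u_def sum_subtractf[symmetric] transpose_def matrix_vector_mult_def vec_eq_iff
            left_diff_distrib)
      then have "\<eta> (v k s - u s) \<le> 2 ^ CARD('k) * (\<Sum>j\<in>UNIV. \<eta> (transpose (F j k s - f j s) *v w j))" for s
        using eta_sum_le[of "\<lambda>j. transpose (F j k s - f j s) *v w j" UNIV] by simp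
      then have "\<delta> k \<le> (\<integral>\<^sup>+s. ennreal (2 ^ CARD('k)) * (\<Sum>j\<in>UNIV. ennreal (\<eta> (transpose (F j k s - f j s) *v w j))) \<partial>lborel)"
        unfolding \<delta>_def
        by (intro nn_integral_mono) (simp add: eta_nonneg sum_nonneg ennreal_leI flip: ennreal_mult)
      also have "\<dots> = ?b k"
        by (simp add: nn_integral_cmult nn_integral_sum)
      finally show ?thesis .
    qed
    then show "eventually (\<lambda>k. \<delta> k \<le> ?b k) sequentially" by simp
    have "?b \<longlonglongrightarrow> ennreal (2 ^ CARD('k)) * (\<Sum>j\<in>(UNIV :: 'k set). 0)"
      by (intro ennreal_tendsto_cmult tendsto_sum F(3)) simp
    then show "?b \<longlonglongrightarrow> 0" by simp
  qed auto
  then have "eventually (\<lambda>k. \<delta> k < 1) sequentially" by (rule order_tendstoD) simp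
  \<comment> \<open>Finiteness of the distance is known only from \<open>N\<close> on; shifting the
    index permits real instead of extended integrals.\<close>
  then obtain N where N: "\<And>k. k \<ge> N \<Longrightarrow> \<delta> k < 1" by (auto simp: eventually_sequentially)
  have fin: "\<delta> (k + N) < \<infinity>" for k using N[of "k + N"] by (auto intro: less_trans)
  define d where "d = (\<lambda>k. enn2real (\<delta> (k + N)))"
  have d_eq: "ennreal (d k) = \<delta> (k + N)" for k using fin[of k] by (simp add: d_def less_top)
  have "(\<lambda>k. \<delta> (k + N)) \<longlonglongrightarrow> 0" using \<open>\<delta> \<longlonglongrightarrow> 0\<close> by (rule LIMSEQ_ignore_initial_segment)
  then have d: "d \<longlonglongrightarrow> 0"
    using tendsto_enn2real[of "\<lambda>k. \<delta> (k + N)" 0 sequentially] by (simp add: d_def)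
  have idiff: "integrable lborel (\<lambda>s. \<eta> (v (k + N) s - u s))" for k
    using fin[of k] eta_nonneg by (intro integrableI_nonneg) (auto simp: \<delta>_def)
  have d_int: "d k = (LINT s|lborel. \<eta> (v (k + N) s - u s))" for k
    unfolding d_def \<delta>_def using eta_nonneg by (subst integral_eq_nn_integral) auto
  have sym: "\<eta> (u s - v k s) = \<eta> (v k s - u s)" for k s
    using eta_minus[of "v k s - u s"] by simp
  show iu: "integrable lborel (\<lambda>s. \<eta> (u s))"
  proof (rule Bochner_Integration.integrable_bound)
    show "integrable lborel (\<lambda>s. 2 * \<eta> (v (0 + N) s) + 2 * \<eta> (v (0 + N) s - u s))"
      by (intro Bochner_Integration.integrable_add integrable_mult_right iv idiff)
    have "\<eta> (u s) \<le> 2 * \<eta> (v (0 + N) s) + 2 * \<eta> (v (0 + N) s - u s)" for s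
      using eta_add[of 1 "v (0 + N) s" "u s - v (0 + N) s"] by (simp add: sym)
    then show "AE s in lborel. norm (\<eta> (u s)) \<le> norm (2 * \<eta> (v (0 + N) s) + 2 * \<eta> (v (0 + N) s - u s))"
      by (simp add: eta_nonneg)
  qed auto
  let ?x = "\<lambda>k. LINT s|lborel. \<eta> (v (k + N) s)" and ?L = "LINT s|lborel. \<eta> (u s)"
  have "?x \<longlonglongrightarrow> ?L"
  proof (rule tendsto_of_quasi_triangle[OF d])
    fix e :: real and k assume "0 < e"
    have "?x k \<le> (LINT s|lborel. (1 + e) * \<eta> (u s) + (1 + 1 / e) * \<eta> (v (k + N) s - u s))"
      using eta_add[OF \<open>0 < e\<close>, of "u s" "v (k + N) s - u s" for s]
      by (intro integral_mono iv Bochner_Integration.integrable_add integrable_mult_right iu idiff) simp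
    also have "\<dots> = (1 + e) * ?L + (1 + 1 / e) * d k"
      using iu idiff by (simp add: d_int)
    finally show "?x k \<le> (1 + e) * ?L + (1 + 1 / e) * d k" .
    have "?L \<le> (LINT s|lborel. (1 + e) * \<eta> (v (k + N) s) + (1 + 1 / e) * \<eta> (v (k + N) s - u s))"
      using eta_add[OF \<open>0 < e\<close>, of "v (k + N) s" "u s - v (k + N) s" for s]
      by (intro integral_mono iu Bochner_Integration.integrable_add integrable_mult_right iv idiff) (simp add: sym)
    also have "\<dots> = (1 + e) * ?x k + (1 + 1 / e) * d k"
      using iv idiff by (simp add: d_int)
    finally show "?L \<le> (1 + e) * ?x k + (1 + 1 / e) * d k" .
  qed (auto simp: d_def eta_nonneg)
  then have lim1: "(\<lambda>k. exp (complex_of_real (- ?x k))) \<longlonglongrightarrow> exp (of_real (- ?L))"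
    by (intro tendsto_intros)
  define Z where "Z = (\<lambda>k \<omega>. \<Sum>j\<in>UNIV. w j \<bullet> simple_stoch_integral M (F j k) \<omega>)"
  define Z\<^sub>0 where "Z\<^sub>0 = (\<lambda>\<omega>. \<Sum>j\<in>UNIV. w j \<bullet> X j \<omega>)"
  have [measurable]: "Z k \<in> borel_measurable P" "Z\<^sub>0 \<in> borel_measurable P" for k
    unfolding Z_def Z\<^sub>0_def by measurable
  let ?e = "\<lambda>j k. expectation (\<lambda>\<omega>. min 1 (norm (simple_stoch_integral M (F j k) \<omega> - X j \<omega>)))"
  have ie: "integrable P (\<lambda>\<omega>. min 1 (norm (simple_stoch_integral M (F j k) \<omega> - X j \<omega>)))" for j k
    by (rule integrable_const_bound[where B=1]) auto
  have e0: "?e j \<longlonglongrightarrow> 0" for j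
    using F(2)[of j] by (simp add: tendsto_in_prob_iff_expectation)
  have "(\<lambda>k. (CLINT \<omega>|P. iexp (Z k \<omega>)) - (CLINT \<omega>|P. iexp (Z\<^sub>0 \<omega>))) \<longlonglongrightarrow> 0"
  proof (rule Lim_null_comparison)
    let ?b = "\<lambda>k. 2 * (\<Sum>j\<in>UNIV. max 1 (norm (w j)) * ?e j k)"
    have "cmod ((CLINT \<omega>|P. iexp (Z k \<omega>)) - (CLINT \<omega>|P. iexp (Z\<^sub>0 \<omega>))) \<le> ?b k" for k
    proof -
      have "cmod ((CLINT \<omega>|P. iexp (Z k \<omega>)) - (CLINT \<omega>|P. iexp (Z\<^sub>0 \<omega>))) \<le>
          2 * expectation (\<lambda>\<omega>. min 1 \<bar>Z k \<omega> - Z\<^sub>0 \<omega>\<bar>)"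
        by (rule norm_iexp_diff_le) auto
      also have "\<dots> \<le> 2 * expectation (\<lambda>\<omega>. \<Sum>j\<in>UNIV. max 1 (norm (w j)) * min 1 (norm (simple_stoch_integral M (F j k) \<omega> - X j \<omega>)))"
      proof (intro mult_left_mono integral_mono)
        show "integrable P (\<lambda>\<omega>. min 1 \<bar>Z k \<omega> - Z\<^sub>0 \<omega>\<bar>)"
          by (rule integrable_const_bound[where B=1]) auto
        show "integrable P (\<lambda>\<omega>. \<Sum>j\<in>UNIV. max 1 (norm (w j)) * min 1 (norm (simple_stoch_integral M (F j k) \<omega> - X j \<omega>)))"
          by (intro Bochner_Integration.integrable_sum integrable_mult_right ie)
        fix \<omega>
        let ?y = "\<lambda>j. \<bar>w j \<bullet> (simple_stoch_integral M (F j k) \<omega> - X j \<omega>)\<bar>"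
        have min_sum: "min 1 (\<Sum>j\<in>J. y j) \<le> (\<Sum>j\<in>J. min 1 (y j))" if "\<And>j. 0 \<le> y j" for y :: "'k \<Rightarrow> real" and J
        proof (induction J rule: infinite_finite_induct)
          case (insert i J)
          have "min 1 (y i + (\<Sum>j\<in>J. y j)) \<le> min 1 (y i) + min 1 (\<Sum>j\<in>J. y j)"
            using that by (intro min_one_add_le sum_nonneg) auto
          with insert show ?case by simp
        qed auto
        have "\<bar>Z k \<omega> - Z\<^sub>0 \<omega>\<bar> \<le> (\<Sum>j\<in>UNIV. ?y j)"
          unfolding Z_def Z\<^sub>0_def sum_subtractf[symmetric] inner_diff_right[symmetric] by (rule sum_abs)
        then have "min 1 \<bar>Z k \<omega> - Z\<^sub>0 \<omega>\<bar> \<le> (\<Sum>j\<in>UNIV. min 1 (?y j))"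
          using min_sum[of ?y UNIV] by auto
        also have "\<dots> \<le> (\<Sum>j\<in>UNIV. max 1 (norm (w j)) * min 1 (norm (simple_stoch_integral M (F j k) \<omega> - X j \<omega>)))"
          by (intro sum_mono min_one_mult_le) (auto simp: Cauchy_Schwarz_ineq2)
        finally show "min 1 \<bar>Z k \<omega> - Z\<^sub>0 \<omega>\<bar> \<le> (\<Sum>j\<in>UNIV. max 1 (norm (w j)) * min 1 (norm (simple_stoch_integral M (F j k) \<omega> - X j \<omega>)))" .
      qed simp
      also have "\<dots> = ?b k" using ie by simp
      finally show ?thesis .
    qed
    then show "eventually (\<lambda>k. norm ((CLINT \<omega>|P. iexp (Z k \<omega>)) - (CLINT \<omega>|P. iexp (Z\<^sub>0 \<omega>))) \<le> ?b k) sequentially"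
      by simp
    have "?b \<longlonglongrightarrow> 2 * (\<Sum>j\<in>UNIV. max 1 (norm (w j)) * 0)"
      by (intro tendsto_mult tendsto_const tendsto_sum e0)
    then show "?b \<longlonglongrightarrow> 0" by simp
  qed
  then have "(\<lambda>k. CLINT \<omega>|P. iexp (Z k \<omega>)) \<longlonglongrightarrow> (CLINT \<omega>|P. iexp (Z\<^sub>0 \<omega>))"
    by (simp add: LIM_zero_iff)
  then have "(\<lambda>k. CLINT \<omega>|P. iexp (Z (k + N) \<omega>)) \<longlonglongrightarrow> (CLINT \<omega>|P. iexp (Z\<^sub>0 \<omega>))"
    by (rule LIMSEQ_ignore_initial_segment)
  with lim1 show "(CLINT \<omega>|P. iexp (\<Sum>j\<in>UNIV. w j \<bullet> X j \<omega>)) = exp (of_real (- ?L))"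
    using cv by (auto simp: Z_def Z\<^sub>0_def simp del: of_real_sum intro: LIMSEQ_unique)
qed

end

section \<open>Existence of the integral\<close>

lemma eventually_geometric_imp_convergent:
  fixes S :: "nat \<Rightarrow> 'a::banach"
  assumes "eventually (\<lambda>k. norm (S (Suc k) - S k) \<le> (1/2) ^ k) sequentially"
  shows "convergent S"
proof -
  have "summable (\<lambda>k. S (Suc k) - S k)"
    by (rule summable_comparison_test_ev[OF assms]) (simp add: summable_geometric)
  then have "convergent (\<lambda>n. \<Sum>k<n. S (Suc k) - S k)"
    by (simp add: summable_iff_convergent)
  then have "convergent (\<lambda>n. S n - S 0)"
    by (simp add: sum_lessThan_telescope)
  then show ?thesis
    using convergent_add[OF _ convergent_const[of "S 0"], of "\<lambda>n. S n - S 0"] by simp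
qed

lemma simple_integrand_indicator:
  assumes "simple_integrand F" "A \<in> sets borel"
  shows "simple_integrand (\<lambda>s. indicator A s *\<^sub>R F s)"
proof -
  have F: "simple_function lborel F" "emeasure lborel {s. F s \<noteq> 0} < \<infinity>"
    using assms by (auto simp: simple_integrand_def)
  have [measurable]: "F \<in> borel_measurable borel"
    using borel_measurable_simple_function[OF F(1)] by simp
  have "simple_function lborel (\<lambda>s. indicator A s *\<^sub>R F s)"
    using assms(2) by (intro simple_function_compose2[OF _ F(1), where h="\<lambda>x y. x *\<^sub>R y"] simple_function_indicator) auto
  moreover have "emeasure lborel {s. indicator A s *\<^sub>R F s \<noteq> 0} \<le> emeasure lborel {s. F s \<noteq> 0}"
    by (intro emeasure_mono) auto
  ultimately show ?thesis using F(2) by (auto simp: simple_integrand_def)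
qed

text \<open>Simple functions bounded by \<open>2 * norm (f s)\<close> make dominated convergence
  available: their distance to \<open>f s\<close> is at most \<open>3 * norm (f s)\<close>, which
  costs the factor 9 in the gauge. The cut-off to balls gives supports of finite measure.\<close>

lemma simple_integrand_approx:
  fixes f :: "real^'n \<Rightarrow> real^'m^'m"
  assumes [measurable]: "f \<in> borel_measurable borel"
    and \<alpha>: "0 < \<alpha>" "\<alpha> < 2"
    and int: "integrable lborel (\<lambda>s. truncated_power \<alpha> (norm (f s)))"
  obtains F where "\<And>k. simple_integrand (F k)" "\<And>s. (\<lambda>k. F k s) \<longlonglongrightarrow> f s"
    "\<And>k. integrable lborel (\<lambda>s. truncated_power \<alpha> (norm (F k s - f s)))"
    "(\<lambda>k. LINT s|lborel. truncated_power \<alpha> (norm (F k s - f s))) \<longlonglongrightarrow> 0"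
proof -
  have "f \<in> borel_measurable lborel" by simp
  from borel_measurable_implies_sequence_metric[OF this, of 0] obtain G where G:
    "\<And>i. simple_function lborel (G i)" "\<And>s. (\<lambda>i. G i s) \<longlonglongrightarrow> f s" "\<And>i s. norm (G i s) \<le> 2 * norm (f s)"
    by auto
  define F where "F = (\<lambda>i s. indicator (cball 0 (real i)) s *\<^sub>R G i s)"
  have Gm [measurable]: "G i \<in> borel_measurable borel" for i
    using borel_measurable_simple_function[OF G(1)] by simp
  have Fm [measurable]: "F i \<in> borel_measurable borel" for i
    unfolding F_def by (intro borel_measurable_scaleR borel_measurable_indicator Gm) simp
  have sF: "simple_integrand (F i)" for i
    unfolding simple_integrand_def
  proof
    show "simple_function lborel (F i)"
      unfolding F_def
      by (intro simple_function_compose2[OF _ G(1), where h="\<lambda>x y. x *\<^sub>R y"] simple_function_indicator) auto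
    have "emeasure lborel {s. F i s \<noteq> 0} \<le> emeasure lborel (cball 0 (real i) :: (real^'n) set)"
      by (intro emeasure_mono) (auto simp: F_def indicator_def split: if_splits)
    also have "\<dots> < \<infinity>" using emeasure_compact_finite[OF compact_cball] by simp
    finally show "emeasure lborel {s. F i s \<noteq> 0} < \<infinity>" .
  qed
  have lim: "(\<lambda>i. F i s) \<longlonglongrightarrow> f s" for s
  proof (rule Lim_transform_eventually[OF G(2)])
    obtain N where "norm s \<le> real N" using real_arch_simple by blast
    then have "F i s = G i s" if "i \<ge> N" for i using that by (auto simp: F_def)
    then show "eventually (\<lambda>i. G i s = F i s) sequentially" by (auto simp: eventually_sequentially intro!: exI[of _ N])
  qed
  have bound: "truncated_power \<alpha> (norm (F i s - f s)) \<le> 9 * truncated_power \<alpha> (norm (f s))" for i s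
  proof -
    have "norm (F i s) \<le> 2 * norm (f s)" using G(3)[of i s] by (auto simp: F_def indicator_def)
    then have "norm (F i s - f s) \<le> 3 * norm (f s)" using norm_triangle_ineq4[of "F i s" "f s"] by linarith
    then have "truncated_power \<alpha> (norm (F i s - f s)) \<le> truncated_power \<alpha> (3 * norm (f s))"
      using \<alpha> by (intro truncated_power_mono) auto
    also have "\<dots> \<le> 9 * truncated_power \<alpha> (norm (f s))"
      using truncated_power_scale[of \<alpha> 3 "norm (f s)"] \<alpha> by simp
    finally show ?thesis .
  qed
  have tlim: "(\<lambda>i. truncated_power \<alpha> (norm (F i s - f s))) \<longlonglongrightarrow> 0" for s
  proof (rule tendsto_sandwich[OF _ _ tendsto_const])
    have "(\<lambda>i. (norm (F i s - f s))\<^sup>2) \<longlonglongrightarrow> (norm (f s - f s))\<^sup>2" by (intro tendsto_intros lim)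
    then show "(\<lambda>i. (norm (F i s - f s))\<^sup>2) \<longlonglongrightarrow> 0" by simp
    show "eventually (\<lambda>i. truncated_power \<alpha> (norm (F i s - f s)) \<le> (norm (F i s - f s))\<^sup>2) sequentially"
      by (simp add: truncated_power_def)
  qed simp
  have int9: "integrable lborel (\<lambda>s. 9 * truncated_power \<alpha> (norm (f s)))"
    using int by simp
  have "(\<lambda>k. LINT s|lborel. truncated_power \<alpha> (norm (F k s - f s))) \<longlonglongrightarrow> (LINT s|(lborel :: (real^'n) measure). 0)"
    by (rule integral_dominated_convergence[OF _ _ int9]) (auto simp: tlim bound)
  moreover have "integrable lborel (\<lambda>s. truncated_power \<alpha> (norm (F k s - f s)))" for k
    by (rule Bochner_Integration.integrable_bound[OF int9]) (auto simp: bound)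
  ultimately show thesis using that[of F] sF lim by simp
qed

context scattered_measure
begin

text \<open>The point is uniformity: \<open>K\<close> is chosen for \<delta> before \<open>Y\<close>
  and \<open>G\<close>. Existence of the integral and stochastic continuity both depend on
  this.\<close>

definition tail_constant :: "real \<Rightarrow> real \<Rightarrow> bool" where
  "tail_constant \<delta> K \<longleftrightarrow> K \<ge> 0 \<and> (\<forall>(Y :: 'w \<Rightarrow> real^'m) (G :: real^'n \<Rightarrow> real^'m^'m).
    Y \<in> borel_measurable P \<longrightarrow> G \<in> borel_measurable borel \<longrightarrow>
    integrable lborel (\<lambda>s. truncated_power \<alpha> (norm (G s))) \<longrightarrow>
    (\<forall>w. (CLINT \<omega>|P. iexp (w \<bullet> Y \<omega>)) = exp (of_real (- (LINT s|lborel. \<eta> (transpose (G s) *v w))))) \<longrightarrow>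
    measure P {\<omega>\<in>space P. norm (Y \<omega>) > \<delta>} \<le> K * (LINT s|lborel. truncated_power \<alpha> (norm (G s))))"

text \<open>Each coordinate is compared with \<delta> divided by the dimension. Its characteristic
  function is some \<open>exp (- a)\<close> with \<open>1 - exp (- a) \<le> a\<close>, and the gauge
  bounds \<open>a\<close> uniformly over the frequencies \<open>0 \<le> x \<le> T\<close> that
  \<open>tail_bound_char\<close> averages.\<close>

lemma tail_bound:
  assumes "0 < \<delta>"
  shows "\<exists>K. tail_constant \<delta> K"
proof -
  obtain C where C: "C > 0" "\<And>w. \<eta> w \<le> C * truncated_power \<alpha> (norm w)"
    using eta_bound_ex by blast
  define m where "m = real CARD('m)"
  have m: "m > 0" by (simp add: m_def)
  define T where "T = 2 / (\<delta> / m)"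
  define K where "K = m * (2 * (C * max 1 (T\<^sup>2)))"
  have K: "K \<ge> 0" using C m by (simp add: K_def)
  have "measure P {\<omega>\<in>space P. norm (Y \<omega>) > \<delta>} \<le> K * (LINT s|lborel. truncated_power \<alpha> (norm (G s)))"
    if Y [measurable]: "Y \<in> borel_measurable P" and G [measurable]: "G \<in> borel_measurable borel"
      and int: "integrable lborel (\<lambda>s. truncated_power \<alpha> (norm (G s)))"
      and char: "\<And>w. (CLINT \<omega>|P. iexp (w \<bullet> Y \<omega>)) = exp (of_real (- (LINT s|lborel. \<eta> (transpose (G s) *v w))))"
    for Y :: "'w \<Rightarrow> real^'m" and G :: "real^'n \<Rightarrow> real^'m^'m"
  proof -
    define B where "B = (LINT s|lborel. truncated_power \<alpha> (norm (G s)))"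
    have B0: "B \<ge> 0" unfolding B_def by (intro Bochner_Integration.integral_nonneg) auto
    have Yi [measurable]: "(\<lambda>\<omega>. Y \<omega> $ i) \<in> borel_measurable P" for i
    proof -
      have "(\<lambda>x :: real^'m. x $ i) \<in> borel_measurable borel"
        by (intro borel_measurable_continuous_onI continuous_intros)
      then show ?thesis by measurable
    qed
    have coord: "measure P {\<omega>\<in>space P. \<bar>Y \<omega> $ i\<bar> > \<delta> / m} \<le> 2 * (C * max 1 (T\<^sup>2) * B)" for i
    proof (rule tail_bound_char)
      show "0 < \<delta> / m" using assms m by simp
      fix x :: real assume x: "0 \<le> x" "x \<le> 2 / (\<delta> / m)"
      define w where "w = x *\<^sub>R axis i (1::real)"
      have wY: "w \<bullet> Y \<omega> = x * (Y \<omega> $ i)" for \<omega>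
        by (simp add: w_def inner_axis' )
      define a where "a = (LINT s|lborel. \<eta> (transpose (G s) *v w))"
      have nw: "norm (transpose (G s) *v w) \<le> x * norm (G s)" for s
      proof -
        have "transpose (G s) *v w = x *\<^sub>R (G s $ i)"
          by (simp add: w_def transpose_def matrix_vector_mult_def vec_eq_iff axis_def
              if_distrib[of "\<lambda>y. _ * y"] cong: if_cong)
        then show ?thesis using Finite_Cartesian_Product.norm_nth_le[of "G s" i] x by (simp add: mult_left_mono)
      qed
      have etab: "\<eta> (transpose (G s) *v w) \<le> C * max 1 (T\<^sup>2) * truncated_power \<alpha> (norm (G s))" for s
      proof -
        have "truncated_power \<alpha> (norm (transpose (G s) *v w)) \<le> truncated_power \<alpha> (x * norm (G s))"
          using nw alpha by (intro truncated_power_mono) auto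
        also have "\<dots> \<le> max 1 (x\<^sup>2) * truncated_power \<alpha> (norm (G s))"
          using x alpha by (intro truncated_power_scale) auto
        also have "\<dots> \<le> max 1 (T\<^sup>2) * truncated_power \<alpha> (norm (G s))"
        proof (intro mult_right_mono)
          have "x\<^sup>2 \<le> T\<^sup>2" using x by (intro power_mono) (auto simp: T_def)
          then show "max 1 (x\<^sup>2) \<le> max 1 (T\<^sup>2)" by linarith
        qed simp
        finally show ?thesis using C by (auto intro: order_trans[OF C(2)] simp: mult.assoc)
      qed
      have ib: "integrable lborel (\<lambda>s. C * max 1 (T\<^sup>2) * truncated_power \<alpha> (norm (G s)))"
        using int by simp
      have "a \<le> (LINT s|lborel. C * max 1 (T\<^sup>2) * truncated_power \<alpha> (norm (G s)))"
        unfolding a_def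
      proof (rule integral_mono[OF _ ib])
        show "integrable lborel (\<lambda>s. \<eta> (transpose (G s) *v w))"
          using transpose_mult_vec_measurable[OF G]
          by (intro Bochner_Integration.integrable_bound[OF ib] AE_I2) (auto simp: eta_nonneg intro!: order_trans[OF etab])
      qed (rule etab)
      also have "\<dots> = C * max 1 (T\<^sup>2) * B" by (simp add: B_def)
      finally have aB: "a \<le> C * max 1 (T\<^sup>2) * B" .
      have ii: "complex_integrable P (\<lambda>\<omega>. iexp (w \<bullet> Y \<omega>))"
        by (rule integrable_const_bound[where B=1]) auto
      have ic: "integrable P (\<lambda>\<omega>. cos (x * (Y \<omega> $ i)))"
        by (rule integrable_const_bound[where B=1]) auto
      have "expectation (\<lambda>\<omega>. cos (x * (Y \<omega> $ i))) = Re (CLINT \<omega>|P. iexp (w \<bullet> Y \<omega>))"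
        using ii by (subst integral_Re[symmetric]) (simp_all add: wY Re_exp del: of_real_mult)
      also have "\<dots> = exp (- a)"
        unfolding char a_def[symmetric] by (simp only: exp_of_real Re_complex_of_real)
      finally have "expectation (\<lambda>\<omega>. 1 - cos (x * (Y \<omega> $ i))) = 1 - exp (- a)"
        using ic by (simp add: prob_space)
      also have "\<dots> \<le> a" using exp_ge_add_one_self[of "- a"] by linarith
      finally show "expectation (\<lambda>\<omega>. 1 - cos (x * (Y \<omega> $ i))) \<le> C * max 1 (T\<^sup>2) * B" using aB by linarith
    qed measurable
    have "{\<omega>\<in>space P. norm (Y \<omega>) > \<delta>} \<subseteq> (\<Union>i\<in>UNIV. {\<omega>\<in>space P. \<bar>Y \<omega> $ i\<bar> > \<delta> / m})"
    proof
      fix \<omega> assume \<omega>: "\<omega> \<in> {\<omega>\<in>space P. norm (Y \<omega>) > \<delta>}"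
      have "\<exists>i. \<bar>Y \<omega> $ i\<bar> > \<delta> / m"
      proof (rule ccontr)
        assume "\<not> (\<exists>i. \<bar>Y \<omega> $ i\<bar> > \<delta> / m)"
        then have "(\<Sum>i\<in>UNIV. \<bar>Y \<omega> $ i\<bar>) \<le> (\<Sum>i\<in>(UNIV :: 'm set). \<delta> / m)"
          by (intro sum_mono) (auto simp: not_less)
        also have "\<dots> = \<delta>" using m by (simp add: m_def)
        finally show False using norm_le_l1_cart[of "Y \<omega>"] \<omega> by simp
      qed
      with \<omega> show "\<omega> \<in> (\<Union>i\<in>UNIV. {\<omega>\<in>space P. \<bar>Y \<omega> $ i\<bar> > \<delta> / m})" by blast
    qed
    then have "measure P {\<omega>\<in>space P. norm (Y \<omega>) > \<delta>} \<le> measure P (\<Union>i\<in>UNIV. {\<omega>\<in>space P. \<bar>Y \<omega> $ i\<bar> > \<delta> / m})"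
      by (intro finite_measure_mono) auto
    also have "\<dots> \<le> (\<Sum>i\<in>UNIV. measure P {\<omega>\<in>space P. \<bar>Y \<omega> $ i\<bar> > \<delta> / m})"
      by (intro finite_measure_subadditive_finite) auto
    also have "\<dots> \<le> (\<Sum>i\<in>(UNIV::'m set). 2 * (C * max 1 (T\<^sup>2) * B))"
      by (intro sum_mono coord)
    also have "\<dots> = K * B" by (simp add: K_def m_def)
    finally show ?thesis by (simp add: B_def)
  qed
  with K show ?thesis unfolding tail_constant_def by blast
qed

lemma tail_constantD:
  fixes Y :: "'w \<Rightarrow> real^'m" and G :: "real^'n \<Rightarrow> real^'m^'m"
  assumes "tail_constant \<delta> K" "Y \<in> borel_measurable P" "G \<in> borel_measurable borel"
    "integrable lborel (\<lambda>s. truncated_power \<alpha> (norm (G s)))"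
    "\<And>w. (CLINT \<omega>|P. iexp (w \<bullet> Y \<omega>)) = exp (of_real (- (LINT s|lborel. \<eta> (transpose (G s) *v w))))"
  shows "measure P {\<omega>\<in>space P. norm (Y \<omega>) > \<delta>} \<le> K * (LINT s|lborel. truncated_power \<alpha> (norm (G s)))"
  using assms unfolding tail_constant_def by blast

theorem has_stoch_integral_exists:
  fixes f :: "real^'n \<Rightarrow> real^'m^'m"
  assumes f [measurable]: "f \<in> borel_measurable borel"
    and int: "integrable lborel (\<lambda>s. truncated_power \<alpha> (norm (f s)))"
  shows "\<exists>X. has_stoch_integral P M f X"
proof -
  obtain F0 where F0: "\<And>k. simple_integrand (F0 k)" "\<And>s. (\<lambda>k. F0 k s) \<longlonglongrightarrow> f s"
    "\<And>k. integrable lborel (\<lambda>s. truncated_power \<alpha> (norm (F0 k s - f s)))"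
    "(\<lambda>k. LINT s|lborel. truncated_power \<alpha> (norm (F0 k s - f s))) \<longlonglongrightarrow> 0"
    using simple_integrand_approx[OF f alpha int] by blast
  have "\<forall>k. \<exists>K. tail_constant ((1/2) ^ k) K" by (simp add: tail_bound)
  then obtain K where K: "\<And>k. tail_constant ((1/2) ^ k) (K k)" by metis
  have K0: "K k \<ge> 0" for k using K by (simp add: tail_constant_def)
  \<comment> \<open>The tail constants may grow with \<open>k\<close>, so the accuracy is divided by
    them. The 8 pays for the factor 4 of \<open>truncated_power_add\<close> and for two terms.
    Requiring also \<open>\<rho> (k - 1)\<close> below makes \<open>F (Suc k)\<close> accurate to
    within \<open>\<rho> k\<close>, as \<open>F k\<close> is.\<close>
  define \<rho> where "\<rho> = (\<lambda>k. (1/2) ^ k / (8 * (K k + 1)))"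
  have \<rho>: "\<rho> k > 0" for k using K0[of k] by (simp add: \<rho>_def add_nonneg_pos)
  have "\<exists>n\<ge>k. (LINT s|lborel. truncated_power \<alpha> (norm (F0 n s - f s))) \<le> min (\<rho> k) (\<rho> (k - 1))" for k
  proof -
    have "eventually (\<lambda>n. (LINT s|lborel. truncated_power \<alpha> (norm (F0 n s - f s))) < min (\<rho> k) (\<rho> (k - 1))) sequentially"
      using \<rho> by (intro order_tendstoD(2)[OF F0(4)]) auto
    then obtain N where "\<And>n. n \<ge> N \<Longrightarrow> (LINT s|lborel. truncated_power \<alpha> (norm (F0 n s - f s))) < min (\<rho> k) (\<rho> (k - 1))"
      by (auto simp: eventually_sequentially)
    then show ?thesis by (intro exI[of _ "max k N"]) (auto intro: less_imp_le)
  qed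
  then obtain n where n: "\<And>k. n k \<ge> k"
    "\<And>k. (LINT s|lborel. truncated_power \<alpha> (norm (F0 (n k) s - f s))) \<le> min (\<rho> k) (\<rho> (k - 1))" by metis
  define F where "F = (\<lambda>k. F0 (n k))"
  have sF: "simple_integrand (F k)" for k using F0(1) by (simp add: F_def)
  have Fm [measurable]: "F k \<in> borel_measurable borel" for k
    using sF[of k] borel_measurable_simple_function[of lborel "F k"] by (simp add: simple_integrand_def)
  have iF: "integrable lborel (\<lambda>s. truncated_power \<alpha> (norm (F k s - f s)))" for k
    using F0(3) by (simp add: F_def)
  have Flim: "(\<lambda>k. F k s) \<longlonglongrightarrow> f s" for s
  proof -
    have "filterlim n at_top sequentially"
      by (rule filterlim_at_top_mono[OF filterlim_ident]) (simp add: n)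
    from filterlim_compose[OF F0(2)[of s] this] show ?thesis by (simp add: F_def)
  qed
  \<comment> \<open>Multiplication by an indicator does not increase norms, so one subsequence
    serves all Borel sets \<open>A\<close> at once, as the definition of the integral
    demands.\<close>
  have iD: "integrable lborel (\<lambda>s. truncated_power \<alpha> (norm (indicator A s *\<^sub>R F (Suc k) s - indicator A s *\<^sub>R F k s)))" (is ?i)
    and bD: "(LINT s|lborel. truncated_power \<alpha> (norm (indicator A s *\<^sub>R F (Suc k) s - indicator A s *\<^sub>R F k s))) \<le> (1/2) ^ k / (K k + 1)" (is ?b)
    if [measurable]: "A \<in> sets borel" for A k
  proof -
    let ?g = "\<lambda>s. truncated_power \<alpha> (norm (indicator A s *\<^sub>R F (Suc k) s - indicator A s *\<^sub>R F k s))"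
    let ?h = "\<lambda>s. 4 * (truncated_power \<alpha> (norm (F (Suc k) s - f s)) + truncated_power \<alpha> (norm (F k s - f s)))"
    have ih: "integrable lborel ?h" using iF by simp
    have le: "?g s \<le> ?h s" for s
    proof -
      have "norm (F (Suc k) s - F k s) \<le> norm (F (Suc k) s - f s) + norm (F k s - f s)"
        using norm_triangle_ineq4[of "F (Suc k) s - f s" "F k s - f s"] by simp
      moreover have "norm (indicator A s *\<^sub>R F (Suc k) s - indicator A s *\<^sub>R F k s) \<le> norm (F (Suc k) s - F k s)"
        by (auto simp: indicator_def)
      ultimately have "?g s \<le> truncated_power \<alpha> (norm (F (Suc k) s - f s) + norm (F k s - f s))"
        using alpha by (intro truncated_power_mono) auto
      also have "\<dots> \<le> ?h s" using alpha by (intro truncated_power_add) auto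
      finally show ?thesis .
    qed
    show ?i by (rule Bochner_Integration.integrable_bound[OF ih]) (auto intro!: order_trans[OF le])
    then have "(LINT s|lborel. ?g s) \<le> (LINT s|lborel. ?h s)" by (rule integral_mono[OF _ ih le])
    also have "\<dots> \<le> 4 * (\<rho> k + \<rho> k)"
      using iF n(2)[of k] n(2)[of "Suc k"] by (simp add: F_def)
    also have "\<dots> = (1/2) ^ k / (K k + 1)"
    proof -
      have "4 * (p / (8 * q) + p / (8 * q)) = p / q" for p q :: real by simp
      then show ?thesis by (simp only: \<rho>_def)
    qed
    finally show ?b .
  qed
  define S where "S = (\<lambda>A k. simple_stoch_integral M (\<lambda>s. indicator A s *\<^sub>R F k s))"
  have Sm: "S A k \<in> borel_measurable P" if "A \<in> sets borel" for A k
    unfolding S_def using simple_integrand_indicator[OF sF that] by (rule simple_stoch_integral_measurable)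
  have conv: "AE \<omega> in P. convergent (\<lambda>k. S A k \<omega>)" if A [measurable]: "A \<in> sets borel" for A
  proof -
    note [measurable] = Sm[OF A]
    let ?E = "\<lambda>k. {\<omega>\<in>space P. norm (S A (Suc k) \<omega> - S A k \<omega>) > (1/2) ^ k}"
    have "measure P (?E k) \<le> (1/2) ^ k" for k
    proof -
      have "measure P (?E k) \<le> K k * (LINT s|lborel. truncated_power \<alpha> (norm (indicator A s *\<^sub>R F (Suc k) s - indicator A s *\<^sub>R F k s)))"
      proof -
        have c: "(CLINT \<omega>|P. iexp (w \<bullet> (S A (Suc k) \<omega> - S A k \<omega>))) =
          exp (of_real (- (LINT s|lborel. \<eta> (transpose (indicator A s *\<^sub>R F (Suc k) s - indicator A s *\<^sub>R F k s) *v w))))" for w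
          unfolding S_def by (rule char_simple_diff(2)) (auto intro: simple_integrand_indicator sF A)
        show ?thesis
          by (rule tail_constantD[OF K _ _ iD[OF A] c]) measurable
      qed
      also have "\<dots> \<le> K k * ((1/2) ^ k / (K k + 1))"
        by (intro mult_left_mono bD A K0)
      also have "\<dots> = (1/2) ^ k * (K k / (K k + 1))" by simp
      also have "\<dots> \<le> (1/2) ^ k * 1" using K0[of k] by (intro mult_left_mono) auto
      finally show ?thesis by simp
    qed
    then have mE: "norm (measure P (?E k)) \<le> (1/2) ^ k" for k
      by (simp only: real_norm_def abs_of_nonneg measure_nonneg)
    have "summable (\<lambda>k. measure P (?E k))"
      by (rule summable_comparison_test'[OF summable_geometric[of "1/2::real"], where N=0]) (simp, rule mE)
    then have "AE \<omega> in P. eventually (\<lambda>k. \<omega> \<in> space P - ?E k) sequentially"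
      by (intro borel_cantelli_AE1) (auto simp: less_top[symmetric])
    then show ?thesis
    proof eventually_elim
      case (elim \<omega>)
      then show ?case
        by (intro eventually_geometric_imp_convergent) (auto elim: eventually_mono)
    qed
  qed
  have Z: "\<exists>Z\<in>borel_measurable P. tendsto_in_prob P (S A) Z sequentially" if A [measurable]: "A \<in> sets borel" for A
  proof
    note [measurable] = Sm[OF A]
    let ?Z = "\<lambda>\<omega>. lim (\<lambda>k. S A k \<omega>)"
    show Zm [measurable]: "?Z \<in> borel_measurable P" by measurable
    have "(\<lambda>k. expectation (\<lambda>\<omega>. min 1 (norm (S A k \<omega> - ?Z \<omega>)))) \<longlonglongrightarrow> expectation (\<lambda>\<omega>. 0)"
    proof (rule integral_dominated_convergence[where w="\<lambda>_. 1"])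
      show "AE \<omega> in P. (\<lambda>k. min 1 (norm (S A k \<omega> - ?Z \<omega>))) \<longlonglongrightarrow> 0"
        using conv[OF A]
      proof eventually_elim
        case (elim \<omega>)
        then have "(\<lambda>k. S A k \<omega>) \<longlonglongrightarrow> ?Z \<omega>" by (simp add: convergent_LIMSEQ_iff)
        then have "(\<lambda>k. min 1 (norm (S A k \<omega> - ?Z \<omega>))) \<longlonglongrightarrow> min 1 (norm (?Z \<omega> - ?Z \<omega>))"
          by (intro tendsto_intros)
        then show ?case by simp
      qed
    qed auto
    then show "tendsto_in_prob P (S A) ?Z sequentially"
      by (subst tendsto_in_prob_iff_expectation) auto
  qed
  have SU: "S UNIV = (\<lambda>k. simple_stoch_integral M (F k))" by (simp add: S_def)
  from Z[of UNIV] obtain X where X: "X \<in> borel_measurable P" "tendsto_in_prob P (S UNIV) X sequentially" by auto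
  have "has_stoch_integral P M f X"
    unfolding has_stoch_integral_def
    using X Z Flim sF by (auto simp: S_def intro!: exI[of _ F] f)
  then show ?thesis by blast
qed

end

section \<open>Disintegration\<close>

abbreviation unit_interval :: "real measure" where
  "unit_interval \<equiv> restrict_space lborel {0<..<1}"

lemma prob_space_unit_interval: "prob_space unit_interval"
  by (rule prob_spaceI) (simp add: space_restrict_space emeasure_restrict_space)

lemma measurable_unit_interval: "f \<in> measurable borel N \<Longrightarrow> f \<in> measurable unit_interval N"
  by (rule measurable_restrict_space1) simp

text \<open>The half-line above \<open>x\<close> is the increasing union of the half-lines above
  points slightly larger than \<open>x\<close>, so interlaced inequalities of tails force equality.
  This suits conditional tails, which are given at rational thresholds.\<close>

lemma measure_eqI_interlaced:
  fixes m1 m2 :: "real measure"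
  assumes "finite_measure m1" "finite_measure m2" and s: "sets m1 = sets borel" "sets m2 = sets borel"
    and 12: "\<And>x y. x < y \<Longrightarrow> emeasure m1 {y<..} \<le> emeasure m2 {x<..}"
    and 21: "\<And>x y. x < y \<Longrightarrow> emeasure m2 {y<..} \<le> emeasure m1 {x<..}"
  shows "m1 = m2"
proof (rule measure_eqI_lessThan)
  have *: "emeasure m {x<..} \<le> emeasure m' {x<..}"
    if le: "\<And>x y. x < y \<Longrightarrow> emeasure m {y<..} \<le> emeasure m' {x<..}" and sm: "sets m = sets borel"
    for m m' :: "real measure" and x
  proof -
    let ?A = "\<lambda>n. {x + 1 / real (Suc n)<..}"
    have "{x<..} = (\<Union>n. ?A n)"
    proof (intro set_eqI iffI)
      fix y assume "y \<in> {x<..}"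
      then obtain n where "inverse (real (Suc n)) < y - x" using reals_Archimedean[of "y - x"] by auto
      then show "y \<in> (\<Union>n. ?A n)" by (auto simp: inverse_eq_divide intro!: exI[of _ n])
    next
      fix y assume "y \<in> (\<Union>n. ?A n)"
      then obtain n where "x + 1 / real (Suc n) < y" by blast
      moreover have "0 < 1 / real (Suc n)" by simp
      ultimately have "x < y" by linarith
      then show "y \<in> {x<..}" by simp
    qed
    moreover have "incseq ?A"
    proof (rule incseq_SucI)
      fix n
      have "1 / real (Suc (Suc n)) \<le> 1 / real (Suc n)" by (intro frac_le) auto
      then show "?A n \<subseteq> ?A (Suc n)" unfolding greaterThan_subset_iff by linarith
    qed
    moreover have "range ?A \<subseteq> sets m" by (simp add: image_subset_iff sm)
    ultimately have "emeasure m {x<..} = (SUP n. emeasure m (?A n))"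
      by (simp only: SUP_emeasure_incseq)
    also have "\<dots> \<le> emeasure m' {x<..}" by (intro SUP_least le) auto
    finally show ?thesis .
  qed
  show "emeasure m1 {x<..} = emeasure m2 {x<..}" for x
    using *[OF 12 s(1)] *[OF 21 s(2)] by (intro antisym)
  show "emeasure m1 {x<..} < \<infinity>" for x
    using finite_measure.emeasure_finite[OF assms(1)] by (simp add: less_top[symmetric])
qed (use s in auto)

text \<open>Disintegration in the form of noise outsourcing: the conditional law of the second
  coordinate given the first one is realised as the image of the uniform law under the
  generalised inverse \<open>Y\<close> of the conditional tail functions \<open>f q\<close>, \<open>q\<close> rational.
  In this form no exceptional null set has to be treated separately.\<close>

lemma real_disintegration:
  fixes N :: "('a \<times> real) measure" and L :: "'a measure"
  assumes "finite_measure N" and sN [measurable_cong]: "sets N = sets (L \<Otimes>\<^sub>M borel)"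
  obtains Y where "(\<lambda>(u, \<omega>). Y u \<omega>) \<in> borel_measurable (L \<Otimes>\<^sub>M (borel :: real measure))"
    and "\<And>F. F \<in> borel_measurable (L \<Otimes>\<^sub>M borel) \<Longrightarrow>
      (\<integral>\<^sup>+z. F z \<partial>N) = (\<integral>\<^sup>+u. (\<integral>\<^sup>+\<omega>. F (u, Y u \<omega>) \<partial>unit_interval) \<partial>distr N L fst)"
proof -
  interpret N: finite_measure N by fact
  interpret I: prob_space unit_interval by (rule prob_space_unit_interval)
  have spN: "space N = space L \<times> UNIV"
    using sets_eq_imp_space_eq[OF sN] by (simp add: space_pair_measure)
  have fstN [measurable]: "fst \<in> measurable N L" by measurable
  define \<mu> where "\<mu> = distr N L fst"
  interpret \<mu>: finite_measure \<mu> unfolding \<mu>_def by (rule N.finite_measure_distr) measurable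
  have s\<mu> [measurable_cong]: "sets \<mu> = sets L" by (simp add: \<mu>_def)
  have sp\<mu>: "space \<mu> = space L" by (simp add: \<mu>_def)
  have rect [measurable]: "A \<times> B \<in> sets N" if "A \<in> sets L" "B \<in> sets borel" for A B
    using that by (simp add: sN)
  have \<mu>A: "emeasure \<mu> A = emeasure N (A \<times> UNIV)" if "A \<in> sets L" for A
  proof -
    have "fst -` A \<inter> space N = A \<times> UNIV" using sets.sets_into_space[OF that] by (auto simp: spN)
    then show ?thesis using that by (simp add: \<mu>_def emeasure_distr)
  qed
  \<comment> \<open>For fixed \<open>B\<close> the measure
    \<open>A \<mapsto> N (A \<times> B)\<close> is dominated by the marginal; its density is the
    conditional probability of \<open>B\<close>.\<close>
  have RN: "\<exists>f\<in>borel_measurable L. \<forall>A\<in>sets L. (\<integral>\<^sup>+u. f u * indicator A u \<partial>\<mu>) = emeasure N (A \<times> B)"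
    if B [measurable]: "B \<in> sets borel" for B
  proof -
    define NB where "NB = distr (density N (\<lambda>z. indicator B (snd z))) L fst"
    have sNB: "sets NB = sets \<mu>" by (simp add: NB_def s\<mu>)
    have NBA: "emeasure NB A = emeasure N (A \<times> B)" if A [measurable]: "A \<in> sets L" for A
    proof -
      have "emeasure NB A = (\<integral>\<^sup>+z. indicator B (snd z) * indicator (fst -` A \<inter> space N) z \<partial>N)"
        unfolding NB_def by (subst emeasure_distr) (auto simp: emeasure_density)
      also have "\<dots> = (\<integral>\<^sup>+z. indicator (A \<times> B) z \<partial>N)"
        by (intro nn_integral_cong) (auto simp: indicator_def)
      finally show ?thesis by simp
    qed
    have "absolutely_continuous \<mu> NB"
      unfolding absolutely_continuous_def
    proof
      fix A assume "A \<in> null_sets \<mu>"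
      then have A: "A \<in> sets L" "emeasure N (A \<times> UNIV) = 0" using \<mu>A by (auto simp: null_sets_def s\<mu>)
      have "emeasure N (A \<times> B) \<le> emeasure N (A \<times> UNIV)" using A by (intro emeasure_mono) auto
      with A show "A \<in> null_sets NB" by (simp add: null_sets_def sNB s\<mu> NBA)
    qed
    then obtain f where f [measurable]: "f \<in> borel_measurable \<mu>" and d: "density \<mu> f = NB"
      using \<mu>.Radon_Nikodym sNB by blast
    show ?thesis
    proof (intro bexI[of _ f] ballI)
      fix A assume "A \<in> sets L"
      then show "(\<integral>\<^sup>+u. f u * indicator A u \<partial>\<mu>) = emeasure N (A \<times> B)"
        using NBA[of A] by (simp add: d[symmetric] emeasure_density s\<mu>)
    qed (use f in \<open>simp add: measurable_cong_sets[OF s\<mu> refl]\<close>)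
  qed
  have "\<forall>q::rat. \<exists>f\<in>borel_measurable L. \<forall>A\<in>sets L. (\<integral>\<^sup>+u. f u * indicator A u \<partial>\<mu>) = emeasure N (A \<times> {real_of_rat q<..})"
    using RN by simp
  then obtain f where fm [measurable]: "\<And>q::rat. f q \<in> borel_measurable L"
    and f: "\<And>q A. A \<in> sets L \<Longrightarrow> (\<integral>\<^sup>+u. f q u * indicator A u \<partial>\<mu>) = emeasure N (A \<times> {real_of_rat q<..})"
    by metis
  have eqAE: "AE u in \<mu>. g u = h u"
    if [measurable]: "g \<in> borel_measurable L" "h \<in> borel_measurable L"
      and "\<And>A. A \<in> sets L \<Longrightarrow> (\<integral>\<^sup>+u. g u * indicator A u \<partial>\<mu>) = (\<integral>\<^sup>+u. h u * indicator A u \<partial>\<mu>)"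
    for g h :: "'a \<Rightarrow> ennreal"
  proof (rule \<mu>.density_unique)
    show "density \<mu> g = density \<mu> h"
      by (rule measure_eqI) (auto simp: emeasure_density that s\<mu>)
  qed auto
  \<comment> \<open>The two tails are compared through the density \<open>g\<close> of the strip
    between the thresholds: by uniqueness of densities the larger tail is the sum of the smaller one
    and \<open>g\<close>.\<close>
  have mono1: "AE u in \<mu>. f r u \<le> f q u" if "q \<le> r" for q r
  proof -
    have "{real_of_rat q<..real_of_rat r} \<in> sets borel" by simp
    from RN[OF this] obtain g where g [measurable]: "g \<in> borel_measurable L"
      and gA: "\<And>A. A \<in> sets L \<Longrightarrow> (\<integral>\<^sup>+u. g u * indicator A u \<partial>\<mu>) = emeasure N (A \<times> {real_of_rat q<..real_of_rat r})"
      by auto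
    have "AE u in \<mu>. f q u = f r u + g u"
    proof (rule eqAE)
      fix A assume A [measurable]: "A \<in> sets L"
      have "(\<integral>\<^sup>+u. (f r u + g u) * indicator A u \<partial>\<mu>) = emeasure N (A \<times> {real_of_rat r<..}) + emeasure N (A \<times> {real_of_rat q<..real_of_rat r})"
        by (simp add: distrib_right nn_integral_add f[OF A] gA[OF A])
      also have "\<dots> = emeasure N (A \<times> {real_of_rat r<..} \<union> A \<times> {real_of_rat q<..real_of_rat r})"
        by (rule plus_emeasure) auto
      also have "A \<times> {real_of_rat r<..} \<union> A \<times> {real_of_rat q<..real_of_rat r} = A \<times> {real_of_rat q<..}"
        using that of_rat_less_eq[of q r] by (auto intro: le_less_trans)
      finally show "(\<integral>\<^sup>+u. f q u * indicator A u \<partial>\<mu>) = (\<integral>\<^sup>+u. (f r u + g u) * indicator A u \<partial>\<mu>)"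
        by (simp add: f[OF A])
    qed measurable
    then show ?thesis by eventually_elim simp
  qed
  have "AE u in \<mu>. \<forall>q r. q \<le> r \<longrightarrow> f r u \<le> f q u"
    unfolding AE_all_countable using mono1 by auto
  note mono = this
  have top: "AE u in \<mu>. (SUP n. f (- rat_of_nat n) u) = 1"
  proof (rule eqAE)
    fix A assume A [measurable]: "A \<in> sets L"
    have "(\<integral>\<^sup>+u. (SUP n. f (- rat_of_nat n) u) * indicator A u \<partial>\<mu>) = (\<integral>\<^sup>+u. (SUP n. f (- rat_of_nat n) u * indicator A u) \<partial>\<mu>)"
      by (simp add: SUP_mult_right_ennreal)
    also have "\<dots> = (SUP n. \<integral>\<^sup>+u. f (- rat_of_nat n) u * indicator A u \<partial>\<mu>)"
    proof (rule nn_integral_monotone_convergence_SUP_AE)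
      fix i
      show "AE u in \<mu>. f (- rat_of_nat i) u * indicator A u \<le> f (- rat_of_nat (Suc i)) u * indicator A u"
        by (rule AE_mp[OF mono1[of "- rat_of_nat (Suc i)" "- rat_of_nat i"]]) (auto intro!: AE_I2 mult_right_mono)
    qed measurable
    also have "\<dots> = (SUP n. emeasure N (A \<times> {- real n<..}))"
      using f[OF A] by (simp add: of_rat_minus)
    also have "\<dots> = emeasure N (\<Union>n. A \<times> {- real n<..})"
      by (intro SUP_emeasure_incseq) (auto simp: incseq_def)
    also have "(\<Union>n. A \<times> {- real n<..}) = A \<times> UNIV"
    proof -
      have "\<exists>n. - real n < y" for y
        using reals_Archimedean2[of "- y"] by (auto intro: exI simp: minus_less_iff)
      then show ?thesis by auto
    qed
    finally show "(\<integral>\<^sup>+u. (SUP n. f (- rat_of_nat n) u) * indicator A u \<partial>\<mu>) = (\<integral>\<^sup>+u. 1 * indicator A u \<partial>\<mu>)"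
      using \<mu>A[OF A] by (simp add: s\<mu>)
  qed measurable
  have bot: "AE u in \<mu>. (INF n. f (rat_of_nat n) u) = 0"
  proof -
    have dec: "(\<lambda>n. emeasure N (space L \<times> {real n<..})) \<longlonglongrightarrow> emeasure N (\<Inter>n. space L \<times> {real n<..})"
      by (intro Lim_emeasure_decseq) (auto simp: decseq_def)
    have "(\<Inter>n. space L \<times> {real n<..}) = {}"
    proof -
      have "\<exists>n. \<not> real n < y" for y using reals_Archimedean2[of y] less_asym by blast
      then show ?thesis by auto
    qed
    with dec have lim: "(\<lambda>n. emeasure N (space L \<times> {real n<..})) \<longlonglongrightarrow> 0" by simp
    have "(\<integral>\<^sup>+u. (INF n. f (rat_of_nat n) u) \<partial>\<mu>) \<le> emeasure N (space L \<times> {real n<..})" for n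
    proof -
      have "(\<integral>\<^sup>+u. (INF n. f (rat_of_nat n) u) \<partial>\<mu>) \<le> (\<integral>\<^sup>+u. f (rat_of_nat n) u * indicator (space L) u \<partial>\<mu>)"
        by (intro nn_integral_mono) (auto simp: sp\<mu> intro: INF_lower)
      also have "\<dots> = emeasure N (space L \<times> {real n<..})" by (subst f) auto
      finally show ?thesis .
    qed
    then have "(\<integral>\<^sup>+u. (INF n. f (rat_of_nat n) u) \<partial>\<mu>) \<le> 0"
      by (intro LIMSEQ_le_const[OF lim]) auto
    then show ?thesis by (subst (asm) le_zero_eq, subst (asm) nn_integral_0_iff_AE) auto
  qed
  \<comment> \<open>Taken in the extended reals, with - \<infinity> standing for thresholds that are
    not reached, the supremum is defined and measurable for every \<open>u\<close>. Conversion to a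
    real sends infinite values to 0; for \<omega> in the unit interval these occur only at
    exceptional \<open>u\<close>.\<close>
  define V where "V = (\<lambda>u \<omega>. SUP q. (if ennreal \<omega> < f q u then ereal (real_of_rat q) else - \<infinity>))"
  define Y where "Y = (\<lambda>u \<omega>. real_of_ereal (V u \<omega>))"
  have Ym [measurable]: "(\<lambda>(u, \<omega>). Y u \<omega>) \<in> borel_measurable (L \<Otimes>\<^sub>M borel)"
    unfolding Y_def V_def by measurable
  have Y_gt: "x < Y u \<omega> \<longleftrightarrow> (\<exists>q. x < real_of_rat q \<and> ennreal \<omega> < f q u)"
    if u: "\<forall>q r. q \<le> r \<longrightarrow> f r u \<le> f q u" "(SUP n. f (- rat_of_nat n) u) = 1" "(INF n. f (rat_of_nat n) u) = 0"
      and \<omega>: "0 < \<omega>" "\<omega> < 1" for u \<omega> x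
  proof -
    have "ennreal \<omega> < (SUP n. f (- rat_of_nat n) u)" using \<omega> u(2) by (simp add: ennreal_less_one_iff)
    then obtain n where n: "ennreal \<omega> < f (- rat_of_nat n) u" by (auto simp: less_SUP_iff)
    then have "ereal (real_of_rat (- rat_of_nat n)) \<le> V u \<omega>"
      unfolding V_def by (intro SUP_upper2[of "- rat_of_nat n"]) auto
    then have V1: "V u \<omega> \<noteq> - \<infinity>" by auto
    have "(INF n. f (rat_of_nat n) u) < ennreal \<omega>" using \<omega> u(3) by simp
    then obtain k where k: "f (rat_of_nat k) u < ennreal \<omega>" by (auto simp: INF_less_iff)
    have "V u \<omega> \<le> ereal (real k)"
      unfolding V_def
    proof (intro SUP_least)
      fix q
      have "\<not> ennreal \<omega> < f q u" if "rat_of_nat k \<le> q"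
        using u(1) that k by (meson less_asym less_le_trans not_le order.strict_trans2)
      moreover have "real_of_rat q \<le> real k" if "\<not> rat_of_nat k \<le> q"
        using that by (metis not_le less_imp_le of_rat_less_eq of_rat_of_nat_eq)
      ultimately show "(if ennreal \<omega> < f q u then ereal (real_of_rat q) else - \<infinity>) \<le> ereal (real k)" by auto
    qed
    then have V2: "V u \<omega> \<noteq> \<infinity>" by auto
    have "ereal (Y u \<omega>) = V u \<omega>" using V1 V2 by (cases "V u \<omega>") (auto simp: Y_def)
    then have "x < Y u \<omega> \<longleftrightarrow> ereal x < V u \<omega>" by (metis less_ereal.simps(1))
    also have "\<dots> \<longleftrightarrow> (\<exists>q. x < real_of_rat q \<and> ennreal \<omega> < f q u)"
      unfolding V_def less_SUP_iff by (auto split: if_splits)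
    finally show ?thesis .
  qed
  let ?N' = "distr (\<mu> \<Otimes>\<^sub>M unit_interval) (L \<Otimes>\<^sub>M borel) (\<lambda>(u, \<omega>). (u, Y u \<omega>))"
  have idm [measurable]: "(\<lambda>x. x) \<in> borel_measurable unit_interval" by (rule measurable_unit_interval) simp
  have Ym' [measurable]: "(\<lambda>(u, \<omega>). (u, Y u \<omega>)) \<in> measurable (\<mu> \<Otimes>\<^sub>M unit_interval) (L \<Otimes>\<^sub>M borel)"
  proof -
    have "(\<lambda>u. u) \<in> measurable \<mu> L" using measurable_ident_sets[OF s\<mu>] by (simp add: id_def)
    then have f: "(\<lambda>z. fst z) \<in> measurable (\<mu> \<Otimes>\<^sub>M unit_interval) L"
      by (rule measurable_compose[OF measurable_fst])
    have g: "(\<lambda>z. snd z) \<in> borel_measurable (\<mu> \<Otimes>\<^sub>M unit_interval)"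
      by (rule measurable_compose[OF measurable_snd idm])
    have "(\<lambda>z. (fst z, snd z)) \<in> measurable (\<mu> \<Otimes>\<^sub>M unit_interval) (L \<Otimes>\<^sub>M borel)"
      using f g by (rule measurable_Pair)
    from measurable_compose[OF this Ym] have "(\<lambda>z. Y (fst z) (snd z)) \<in> borel_measurable (\<mu> \<Otimes>\<^sub>M unit_interval)"
      by simp
    from measurable_Pair[OF f this] show ?thesis by (simp add: split_beta')
  qed
  have sec [measurable]: "(\<lambda>\<omega>. Y u \<omega>) \<in> borel_measurable unit_interval" if "u \<in> space L" for u
  proof -
    have "(\<lambda>\<omega>. case (u, \<omega>) of (u, \<omega>) \<Rightarrow> Y u \<omega>) \<in> borel_measurable borel"
      by (rule measurable_compose[OF measurable_Pair1'[OF that] Ym])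
    then show ?thesis unfolding prod.case by (rule measurable_unit_interval)
  qed
  interpret pf: finite_measure "\<mu> \<Otimes>\<^sub>M unit_interval"
    by (intro finite_measure_pair_measure) unfold_locales
  interpret N': finite_measure ?N' by (rule pf.finite_measure_distr) measurable
  have nnN': "(\<integral>\<^sup>+z. F z \<partial>?N') = (\<integral>\<^sup>+u. (\<integral>\<^sup>+\<omega>. F (u, Y u \<omega>) \<partial>unit_interval) \<partial>\<mu>)"
    if [measurable]: "F \<in> borel_measurable (L \<Otimes>\<^sub>M borel)" for F
    by (simp add: nn_integral_distr I.nn_integral_fst[symmetric] split_beta')
  have I_lt: "emeasure unit_interval {\<omega> \<in> space unit_interval. ennreal \<omega> < c} = min 1 c" for c
  proof (cases "c \<ge> 1")
    case True
    then have "{\<omega> \<in> space unit_interval. ennreal \<omega> < c} = space unit_interval"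
      by (auto simp: space_restrict_space intro: less_le_trans[of _ 1] simp: ennreal_less_one_iff)
    then show ?thesis using I.emeasure_space_1 True by (simp add: min_def)
  next
    case False
    then obtain d where d: "c = ennreal d" "0 \<le> d" "d < 1"
      by (cases c) (auto simp: not_le ennreal_less_one_iff)
    then have eq: "{\<omega> \<in> space unit_interval. ennreal \<omega> < c} = {0<..<d}"
      by (auto simp: space_restrict_space ennreal_less_iff)
    have "emeasure unit_interval {0<..<d} = emeasure lborel {0<..<d}"
      using d by (intro emeasure_restrict_space) auto
    then show ?thesis unfolding eq using d False by (simp add: min_def)
  qed
  \<comment> \<open>Right-continuity of \<open>q \<mapsto> f q u\<close> is not established, so the
    tail of \<open>Y u\<close> is only squeezed between conditional tails at neighbouring rationals.
    The interlaced criterion asks for no more.\<close>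
  have good: "AE u in \<mu>. \<forall>x q. (x < real_of_rat q \<longrightarrow> f q u \<le> emeasure unit_interval {\<omega> \<in> space unit_interval. x < Y u \<omega>}) \<and>
      (real_of_rat q \<le> x \<longrightarrow> emeasure unit_interval {\<omega> \<in> space unit_interval. x < Y u \<omega>} \<le> f q u)"
    using mono top bot AE_space
  proof eventually_elim
    case (elim u)
    have uL: "u \<in> space L" using elim by (simp add: sp\<mu>)
    note Yg = Y_gt[OF elim(1-3)]
    have le1: "f q u \<le> 1" for q
    proof -
      obtain n where "- q < rat_of_nat n" using reals_Archimedean2 by blast
      then have "- rat_of_nat n \<le> q" by simp
      then have "f q u \<le> f (- rat_of_nat n) u" using elim(1) by blast
      also have "\<dots> \<le> 1" unfolding elim(2)[symmetric] by (rule SUP_upper) simp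
      finally show ?thesis .
    qed
    have meas: "{\<omega> \<in> space unit_interval. ennreal \<omega> < c} \<in> sets unit_interval"
      "{\<omega> \<in> space unit_interval. x < Y u \<omega>} \<in> sets unit_interval" for x c
      using sec[OF uL] by measurable
    show ?case
    proof (intro allI conjI impI)
      fix x q assume "x < real_of_rat q"
      have "f q u = emeasure unit_interval {\<omega> \<in> space unit_interval. ennreal \<omega> < f q u}"
        unfolding I_lt using le1[of q] by (simp add: min_absorb2)
      also have "\<dots> \<le> emeasure unit_interval {\<omega> \<in> space unit_interval. x < Y u \<omega>}"
        using \<open>x < real_of_rat q\<close> meas by (intro emeasure_mono) (auto simp: Yg space_restrict_space)
      finally show "f q u \<le> emeasure unit_interval {\<omega> \<in> space unit_interval. x < Y u \<omega>}" .
    next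
      fix x q assume q: "real_of_rat q \<le> x"
      have "ennreal \<omega> < f q u" if "x < real_of_rat r" "ennreal \<omega> < f r u" for r \<omega>
      proof -
        have "q \<le> r" using q that(1) by (metis less_imp_le le_less_trans of_rat_less_eq)
        then show ?thesis using elim(1) that(2) less_le_trans by blast
      qed
      then have "emeasure unit_interval {\<omega> \<in> space unit_interval. x < Y u \<omega>} \<le>
          emeasure unit_interval {\<omega> \<in> space unit_interval. ennreal \<omega> < f q u}"
        using meas by (intro emeasure_mono) (auto simp: Yg space_restrict_space)
      also have "\<dots> \<le> f q u" unfolding I_lt by simp
      finally show "emeasure unit_interval {\<omega> \<in> space unit_interval. x < Y u \<omega>} \<le> f q u" .
    qed
  qed
  have N'tail: "emeasure ?N' (A \<times> {x<..}) =
      (\<integral>\<^sup>+u. emeasure unit_interval {\<omega> \<in> space unit_interval. x < Y u \<omega>} * indicator A u \<partial>\<mu>)"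
    if A [measurable]: "A \<in> sets L" for A x
  proof -
    have "emeasure ?N' (A \<times> {x<..}) = (\<integral>\<^sup>+z. indicator (A \<times> {x<..}) z \<partial>?N')" by simp
    also have "\<dots> = (\<integral>\<^sup>+u. (\<integral>\<^sup>+\<omega>. indicator (A \<times> {x<..}) (u, Y u \<omega>) \<partial>unit_interval) \<partial>\<mu>)"
      by (rule nnN') measurable
    also have "\<dots> = (\<integral>\<^sup>+u. emeasure unit_interval {\<omega> \<in> space unit_interval. x < Y u \<omega>} * indicator A u \<partial>\<mu>)"
    proof (rule nn_integral_cong)
      fix u assume "u \<in> space \<mu>"
      then have u: "u \<in> space L" by (simp add: sp\<mu>)
      have m: "{\<omega> \<in> space unit_interval. x < Y u \<omega>} \<in> sets unit_interval"
        using sec[OF u] by measurable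
      have "(\<integral>\<^sup>+\<omega>. indicator (A \<times> {x<..}) (u, Y u \<omega>) \<partial>unit_interval) =
          (\<integral>\<^sup>+\<omega>. indicator A u * indicator {\<omega> \<in> space unit_interval. x < Y u \<omega>} \<omega> \<partial>unit_interval)"
        by (intro nn_integral_cong) (auto simp: indicator_def)
      also have "\<dots> = indicator A u * emeasure unit_interval {\<omega> \<in> space unit_interval. x < Y u \<omega>}"
        using m by (simp add: nn_integral_cmult)
      finally show "(\<integral>\<^sup>+\<omega>. indicator (A \<times> {x<..}) (u, Y u \<omega>) \<partial>unit_interval) =
          emeasure unit_interval {\<omega> \<in> space unit_interval. x < Y u \<omega>} * indicator A u" by (simp add: mult.commute)
    qed
    finally show ?thesis .
  qed
  have em: "emeasure (distr (density K (\<lambda>z. indicator A (fst z))) borel snd) B = emeasure K (A \<times> B)"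
    if [measurable]: "A \<in> sets L" "B \<in> sets borel" and sK [measurable_cong]: "sets K = sets (L \<Otimes>\<^sub>M borel)"
    for A B and K :: "('a \<times> real) measure"
  proof -
    have AB: "A \<times> B \<in> sets K" by (simp add: sK)
    have "emeasure (distr (density K (\<lambda>z. indicator A (fst z))) borel snd) B =
        (\<integral>\<^sup>+z. indicator A (fst z) * indicator (snd -` B \<inter> space K) z \<partial>K)"
      by (subst emeasure_distr) (auto simp: emeasure_density)
    also have "\<dots> = (\<integral>\<^sup>+z. indicator (A \<times> B) z \<partial>K)"
      by (intro nn_integral_cong) (auto simp: indicator_def)
    finally show ?thesis using AB by simp
  qed
  \<comment> \<open>Confining the first coordinate to a fixed \<open>A\<close> reduces equality on
    the product to equality of measures on the line.\<close>
  have slices: "distr (density N (\<lambda>z. indicator A (fst z))) borel snd = distr (density ?N' (\<lambda>z. indicator A (fst z))) borel snd"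
    if A [measurable]: "A \<in> sets L" for A
  proof -
    have fin: "finite_measure (distr (density K (\<lambda>z. indicator A (fst z))) borel snd)"
      if "finite_measure K" "sets K = sets (L \<Otimes>\<^sub>M borel)" for K :: "('a \<times> real) measure"
      using finite_measure.emeasure_finite[OF that(1)]
      by (intro finite_measureI) (simp add: em[OF A _ that(2), of UNIV, simplified])
    have sN': "sets ?N' = sets (L \<Otimes>\<^sub>M borel)" by simp
    show ?thesis
    proof (rule measure_eqI_interlaced)
      fix x y :: real assume "x < y"
      then obtain q where q: "x < real_of_rat q" "real_of_rat q < y" using of_rat_dense by blast
      have "emeasure N (A \<times> {y<..}) \<le> emeasure N (A \<times> {real_of_rat q<..})"
        using q by (intro emeasure_mono) auto
      also have "\<dots> = (\<integral>\<^sup>+u. f q u * indicator A u \<partial>\<mu>)" by (simp add: f)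
      also have "\<dots> \<le> emeasure ?N' (A \<times> {x<..})"
        unfolding N'tail[OF A]
        by (rule nn_integral_mono_AE, rule AE_mp[OF good]) (use q in \<open>auto intro!: AE_I2 mult_right_mono\<close>)
      finally show "emeasure (distr (density N (\<lambda>z. indicator A (fst z))) borel snd) {y<..} \<le>
          emeasure (distr (density ?N' (\<lambda>z. indicator A (fst z))) borel snd) {x<..}"
        by (simp add: em[OF A _ sN] em[OF A _ sN'])
      have "emeasure ?N' (A \<times> {y<..}) \<le> (\<integral>\<^sup>+u. f q u * indicator A u \<partial>\<mu>)"
        unfolding N'tail[OF A]
        by (rule nn_integral_mono_AE, rule AE_mp[OF good]) (use q in \<open>auto intro!: AE_I2 mult_right_mono\<close>)
      also have "\<dots> = emeasure N (A \<times> {real_of_rat q<..})" by (simp add: f)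
      also have "\<dots> \<le> emeasure N (A \<times> {x<..})"
        using q by (intro emeasure_mono) auto
      finally show "emeasure (distr (density ?N' (\<lambda>z. indicator A (fst z))) borel snd) {y<..} \<le>
          emeasure (distr (density N (\<lambda>z. indicator A (fst z))) borel snd) {x<..}"
        by (simp add: em[OF A _ sN] em[OF A _ sN'])
    qed (simp_all add: fin[OF N.finite_measure_axioms sN] fin[OF N'.finite_measure_axioms sN'])
  qed
  have rectangles: "emeasure N (A \<times> B) = emeasure ?N' (A \<times> B)" if A [measurable]: "A \<in> sets L" and B [measurable]: "B \<in> sets borel" for A B
    using slices[OF A] em[OF A B sN] em[OF A B, of ?N'] by simp
  have eq: "N = ?N'"
  proof (rule measure_eqI_generator_eq[where A="\<lambda>_. space L \<times> UNIV" and \<Omega>="space L \<times> UNIV"])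
    show "Int_stable {a \<times> b |a b. a \<in> sets L \<and> b \<in> sets (borel :: real measure)}"
      by (rule Int_stable_pair_measure_generator)
    show "{a \<times> b |a b. a \<in> sets L \<and> b \<in> sets (borel :: real measure)} \<subseteq> Pow (space L \<times> UNIV)"
      using pair_measure_closed[of L "borel :: real measure"] by simp
    show "sets N = sigma_sets (space L \<times> UNIV) {a \<times> b |a b. a \<in> sets L \<and> b \<in> sets borel}"
      using sN by (simp add: sets_pair_measure)
    show "sets ?N' = sigma_sets (space L \<times> UNIV) {a \<times> b |a b. a \<in> sets L \<and> b \<in> sets borel}"
      by (simp add: sets_pair_measure)
    show "range (\<lambda>_::nat. space L \<times> UNIV) \<subseteq> {a \<times> b |a b. a \<in> sets L \<and> b \<in> sets (borel :: real measure)}"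
      by (intro image_subsetI CollectI exI[of _ "space L"] exI[of _ UNIV]) simp
  qed (auto simp: rectangles)
  have "(\<integral>\<^sup>+z. F z \<partial>N) = (\<integral>\<^sup>+u. (\<integral>\<^sup>+\<omega>. F (u, Y u \<omega>) \<partial>unit_interval) \<partial>distr N L fst)"
    if "F \<in> borel_measurable (L \<Otimes>\<^sub>M borel)" for F
  proof -
    have "(\<integral>\<^sup>+z. F z \<partial>N) = (\<integral>\<^sup>+z. F z \<partial>?N')"
      by (rule arg_cong[OF eq, of "\<lambda>K. \<integral>\<^sup>+z. F z \<partial>K"])
    also note nnN'[OF that]
    finally show ?thesis unfolding \<mu>_def .
  qed
  with Ym show thesis by (rule that)
qed

section \<open>Tempered stable laws of stochastic integrals\<close>

lemma exp_diff_le: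
  fixes x y \<xi> m :: real
  assumes "0 \<le> \<xi>" "m \<le> x" "m \<le> y"
  shows "\<bar>exp (- (x * \<xi>)) - exp (- (y * \<xi>))\<bar> \<le> \<bar>x - y\<bar> * (\<xi> * exp (- (m * \<xi>)))"
proof -
  have *: "\<bar>exp (- (x * \<xi>)) - exp (- (y * \<xi>))\<bar> \<le> \<bar>x - y\<bar> * (\<xi> * exp (- (m * \<xi>)))"
    if "m \<le> x" "x \<le> y" for x y
  proof -
    have e: "exp (- (x * \<xi>)) - exp (- (y * \<xi>)) = exp (- (x * \<xi>)) * (1 - exp (- ((y - x) * \<xi>)))"
      by (simp add: algebra_simps exp_add[symmetric])
    have a: "1 - exp (- ((y - x) * \<xi>)) \<le> (y - x) * \<xi>"
      using exp_ge_add_one_self[of "- ((y - x) * \<xi>)"] by linarith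
    have b: "exp (- (x * \<xi>)) \<le> exp (- (m * \<xi>))"
      using assms that by (simp add: mult_right_mono)
    have "0 \<le> (y - x) * \<xi>" using assms that by simp
    then have "exp (- (x * \<xi>)) - exp (- (y * \<xi>)) \<le> exp (- (m * \<xi>)) * ((y - x) * \<xi>)"
      unfolding e by (intro mult_mono a b) auto
    moreover have "exp (- (y * \<xi>)) \<le> exp (- (x * \<xi>))"
      using assms that by (simp add: mult_right_mono)
    ultimately show ?thesis using that by (simp add: mult_ac)
  qed
  show ?thesis
    using *[of x y] *[of y x] assms by (cases "x \<le> y") (auto simp: abs_minus_commute)
qed

text \<open>A positive random rate \<xi> with a weight \<rho> of at most quadratic growth in \<xi>.
  The weight may have infinite expectation, so the transform is studied for \<open>r > 0\<close>.
  Positivity at every point yields the strict signs and the limit 0 at infinity.\<close>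

locale laplace_density = prob_space \<Lambda> for \<Lambda> :: "'w measure" +
  fixes \<xi> \<rho> :: "'w \<Rightarrow> real" and c :: real
  assumes xi_measurable [measurable]: "\<xi> \<in> borel_measurable \<Lambda>"
    and rho_measurable [measurable]: "\<rho> \<in> borel_measurable \<Lambda>"
    and xi_pos: "0 < \<xi> \<omega>" and rho_pos: "0 < \<rho> \<omega>" and rho_le: "\<rho> \<omega> \<le> 1 + c * (\<xi> \<omega>)\<^sup>2" and c: "0 \<le> c"
begin

definition laplace :: "nat \<Rightarrow> real \<Rightarrow> real" where
  "laplace k r = (LINT \<omega>|\<Lambda>. \<xi> \<omega> ^ k * exp (- (r * \<xi> \<omega>)) * \<rho> \<omega>)"

lemma power_exp_bound:
  assumes "0 < r"
  obtains B where "\<And>\<omega>. \<xi> \<omega> ^ k * exp (- (r * \<xi> \<omega>)) \<le> B"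
proof -
  \<comment> \<open>From \<open>u \<le> exp u\<close> at \<open>u = r * x / (k + 1)\<close>. The
    exponent \<open>k + 1\<close> instead of \<open>k\<close> avoids a division by zero at
    \<open>k = 0\<close> and costs nothing for \<open>x > 1\<close>.\<close>
  define B where "B = (real (Suc k) / r) ^ Suc k"
  have "x ^ k * exp (- (r * x)) \<le> max 1 B" if "0 < x" for x
  proof (cases "x \<le> 1")
    case True
    have "x ^ k * exp (- (r * x)) \<le> 1 * 1"
      using True that assms by (intro mult_mono power_le_one) auto
    then show ?thesis by simp
  next
    case False
    have "r * x / real (Suc k) \<le> exp (r * x / real (Suc k))"
      using exp_ge_add_one_self[of "r * x / real (Suc k)"] by linarith
    then have "(r * x / real (Suc k)) ^ Suc k \<le> exp (r * x / real (Suc k)) ^ Suc k"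
      using that assms by (intro power_mono) auto
    also have "\<dots> = exp (r * x)"
      by (simp add: exp_of_nat_mult[symmetric] del: power_Suc of_nat_Suc)
    finally have "(r / real (Suc k)) ^ Suc k * x ^ Suc k \<le> exp (r * x)"
      by (simp add: power_mult_distrib power_divide mult_ac del: power_Suc of_nat_Suc)
    moreover have "(r / real (Suc k)) ^ Suc k * B = 1"
      using assms by (simp add: B_def power_mult_distrib[symmetric] del: power_Suc of_nat_Suc)
    moreover have "B \<ge> 0" using assms by (simp add: B_def)
    ultimately have "x ^ Suc k \<le> B * exp (r * x)"
      by (metis (no_types, opaque_lifting) mult.assoc mult.commute mult.right_neutral mult_left_mono)
    moreover have "x ^ k \<le> x ^ Suc k" using False by (intro power_increasing) auto
    ultimately have "x ^ k \<le> B * exp (r * x)" by linarith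
    then have "x ^ k * exp (- (r * x)) \<le> B * exp (r * x) * exp (- (r * x))" by (intro mult_right_mono) auto
    also have "\<dots> = B" by (simp add: exp_minus)
    finally show ?thesis by simp
  qed
  then show thesis using that xi_pos by blast
qed

lemma integrable_laplace:
  assumes "0 < r"
  shows "integrable \<Lambda> (\<lambda>\<omega>. \<xi> \<omega> ^ k * exp (- (r * \<xi> \<omega>)) * \<rho> \<omega>)"
proof -
  obtain B1 where B1: "\<And>\<omega>. \<xi> \<omega> ^ k * exp (- (r * \<xi> \<omega>)) \<le> B1" using power_exp_bound[OF assms] by blast
  obtain B2 where B2: "\<And>\<omega>. \<xi> \<omega> ^ (k + 2) * exp (- (r * \<xi> \<omega>)) \<le> B2" using power_exp_bound[OF assms] by blast
  show ?thesis
  proof (rule integrable_const_bound[where B="B1 + c * B2"])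
    have "\<xi> \<omega> ^ k * exp (- (r * \<xi> \<omega>)) * \<rho> \<omega> \<le> B1 + c * B2" for \<omega>
    proof -
      have "\<xi> \<omega> ^ k * exp (- (r * \<xi> \<omega>)) * \<rho> \<omega> \<le> \<xi> \<omega> ^ k * exp (- (r * \<xi> \<omega>)) * (1 + c * (\<xi> \<omega>)\<^sup>2)"
        using xi_pos[of \<omega>] by (intro mult_left_mono rho_le) auto
      also have "\<dots> = \<xi> \<omega> ^ k * exp (- (r * \<xi> \<omega>)) + c * (\<xi> \<omega> ^ (k + 2) * exp (- (r * \<xi> \<omega>)))"
        by (simp add: algebra_simps power_add power2_eq_square)
      also have "\<dots> \<le> B1 + c * B2" using B1 B2 c by (intro add_mono mult_left_mono) auto
      finally show ?thesis .
    qed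
    then show "AE \<omega> in \<Lambda>. norm (\<xi> \<omega> ^ k * exp (- (r * \<xi> \<omega>)) * \<rho> \<omega>) \<le> B1 + c * B2"
      using xi_pos rho_pos by (auto simp: abs_mult abs_of_pos)
  qed measurable
qed

lemma laplace_pos: "0 < r \<Longrightarrow> 0 < laplace k r"
proof -
  assume "0 < r"
  have p: "0 < \<xi> \<omega> ^ k * exp (- (r * \<xi> \<omega>)) * \<rho> \<omega>" for \<omega> using xi_pos rho_pos by simp
  have "laplace k r \<noteq> 0"
  proof
    assume "laplace k r = 0"
    then have "AE \<omega> in \<Lambda>. \<xi> \<omega> ^ k * exp (- (r * \<xi> \<omega>)) * \<rho> \<omega> = 0"
      unfolding laplace_def
      using integral_nonneg_eq_0_iff_AE[OF integrable_laplace[OF \<open>0 < r\<close>, of k]] p by (auto intro: less_imp_le)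
    then have "AE \<omega> in \<Lambda>. False" by eventually_elim (use p in \<open>metis less_irrefl\<close>)
    then show False by simp
  qed
  moreover have "laplace k r \<ge> 0"
    unfolding laplace_def by (intro Bochner_Integration.integral_nonneg less_imp_le p)
  ultimately show ?thesis by simp
qed

text \<open>Differentiation under the integral: near \<open>r\<close> the difference quotients are
  dominated by the integrand of the next order at \<open>r / 2\<close>.\<close>

lemma laplace_deriv:
  assumes "0 < r"
  shows "(laplace k has_real_derivative - laplace (Suc k) r) (at r)"
  unfolding has_field_derivative_iff tendsto_at_iff_sequentially
proof (intro allI impI)
  fix X :: "nat \<Rightarrow> real" assume X: "\<forall>n. X n \<in> UNIV - {r}" "X \<longlonglongrightarrow> r"
  have "eventually (\<lambda>n. r / 2 < X n) sequentially"
    using X(2) assms by (intro order_tendstoD(1)) auto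
  then obtain N where N: "\<And>n. n \<ge> N \<Longrightarrow> r / 2 < X n" by (auto simp: eventually_sequentially)
  let ?g = "\<lambda>k r \<omega>. \<xi> \<omega> ^ k * exp (- (r * \<xi> \<omega>)) * \<rho> \<omega>"
  have lim: "(\<lambda>n. LINT \<omega>|\<Lambda>. (?g k (X (n + N)) \<omega> - ?g k r \<omega>) / (X (n + N) - r)) \<longlonglongrightarrow> (LINT \<omega>|\<Lambda>. - ?g (Suc k) r \<omega>)"
  proof (rule integral_dominated_convergence[where w="?g (Suc k) (r / 2)"])
    show "integrable \<Lambda> (?g (Suc k) (r / 2))" using assms by (intro integrable_laplace) simp
    show "AE \<omega> in \<Lambda>. (\<lambda>n. (?g k (X (n + N)) \<omega> - ?g k r \<omega>) / (X (n + N) - r)) \<longlonglongrightarrow> - ?g (Suc k) r \<omega>"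
    proof (rule AE_I2)
      fix \<omega>
      have "((\<lambda>r. ?g k r \<omega>) has_real_derivative - ?g (Suc k) r \<omega>) (at r)"
        by (auto intro!: derivative_eq_intros)
      then have "((\<lambda>y. (?g k y \<omega> - ?g k r \<omega>) / (y - r)) \<longlongrightarrow> - ?g (Suc k) r \<omega>) (at r)"
        by (simp add: has_field_derivative_iff)
      moreover have "filterlim (\<lambda>n. X (n + N)) (at r) sequentially"
        using X LIMSEQ_ignore_initial_segment[OF X(2), of N] by (auto simp: filterlim_at)
      ultimately show "(\<lambda>n. (?g k (X (n + N)) \<omega> - ?g k r \<omega>) / (X (n + N) - r)) \<longlonglongrightarrow> - ?g (Suc k) r \<omega>"
        by (rule filterlim_compose)
    qed
    fix n
    show "AE \<omega> in \<Lambda>. norm ((?g k (X (n + N)) \<omega> - ?g k r \<omega>) / (X (n + N) - r)) \<le> ?g (Suc k) (r / 2) \<omega>"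
    proof (rule AE_I2)
      fix \<omega>
      have ne: "X (n + N) - r \<noteq> 0" using X(1)[rule_format, of "n + N"] by simp
      have "\<bar>exp (- (X (n + N) * \<xi> \<omega>)) - exp (- (r * \<xi> \<omega>))\<bar> \<le> \<bar>X (n + N) - r\<bar> * (\<xi> \<omega> * exp (- (r / 2 * \<xi> \<omega>)))"
        using N[of "n + N"] assms xi_pos[of \<omega>] by (intro exp_diff_le) auto
      then have "\<bar>exp (- (X (n + N) * \<xi> \<omega>)) - exp (- (r * \<xi> \<omega>))\<bar> / \<bar>X (n + N) - r\<bar> \<le> \<xi> \<omega> * exp (- (r / 2 * \<xi> \<omega>))"
        using ne by (simp add: divide_le_eq mult.commute)
      then have le: "\<xi> \<omega> ^ k * \<rho> \<omega> * (\<bar>exp (- (X (n + N) * \<xi> \<omega>)) - exp (- (r * \<xi> \<omega>))\<bar> / \<bar>X (n + N) - r\<bar>) \<le>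
          \<xi> \<omega> ^ k * \<rho> \<omega> * (\<xi> \<omega> * exp (- (r / 2 * \<xi> \<omega>)))"
        using xi_pos[of \<omega>] rho_pos[of \<omega>] by (intro mult_left_mono) auto
      have "norm ((?g k (X (n + N)) \<omega> - ?g k r \<omega>) / (X (n + N) - r)) =
          \<xi> \<omega> ^ k * \<rho> \<omega> * (\<bar>exp (- (X (n + N) * \<xi> \<omega>)) - exp (- (r * \<xi> \<omega>))\<bar> / \<bar>X (n + N) - r\<bar>)"
      proof -
        have "?g k (X (n + N)) \<omega> - ?g k r \<omega> = \<xi> \<omega> ^ k * \<rho> \<omega> * (exp (- (X (n + N) * \<xi> \<omega>)) - exp (- (r * \<xi> \<omega>)))"
          by (simp add: algebra_simps)
        then show ?thesis using xi_pos[of \<omega>] rho_pos[of \<omega>] by (simp add: abs_mult abs_divide)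
      qed
      also note le
      also have "\<xi> \<omega> ^ k * \<rho> \<omega> * (\<xi> \<omega> * exp (- (r / 2 * \<xi> \<omega>))) = ?g (Suc k) (r / 2) \<omega>" by simp
      finally show "norm ((?g k (X (n + N)) \<omega> - ?g k r \<omega>) / (X (n + N) - r)) \<le> ?g (Suc k) (r / 2) \<omega>" .
    qed
  qed auto
  have eq: "(LINT \<omega>|\<Lambda>. (?g k (X (n + N)) \<omega> - ?g k r \<omega>) / (X (n + N) - r)) = (laplace k (X (n + N)) - laplace k r) / (X (n + N) - r)" for n
    using integrable_laplace[of "X (n + N)" k] integrable_laplace[OF assms, of k] N[of "n + N"] assms
    by (simp add: laplace_def)
  have "(\<lambda>n. (laplace k (X (n + N)) - laplace k r) / (X (n + N) - r)) \<longlonglongrightarrow> - laplace (Suc k) r"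
    using lim unfolding eq by (simp add: laplace_def[of "Suc k"])
  then have "(\<lambda>n. (laplace k (X n) - laplace k r) / (X n - r)) \<longlonglongrightarrow> - laplace (Suc k) r"
    by (rule LIMSEQ_offset)
  then show "((\<lambda>y. (laplace k y - laplace k r) / (y - r)) \<circ> X) \<longlonglongrightarrow> - laplace (Suc k) r"
    by (simp add: comp_def)
qed

text \<open>The closed form is proved on the whole half-line at once, because each further
  derivative depends on the preceding one in a neighbourhood.\<close>

lemma laplace_deriv_funpow:
  assumes "0 < r"
  shows "(deriv ^^ k) (laplace 0) r = (-1) ^ k * laplace k r"
    and "(deriv ^^ k) (laplace 0) differentiable (at r)"
proof -
  have *: "\<forall>r>0. (deriv ^^ k) (laplace 0) r = (-1) ^ k * laplace k r"
    and D: "\<forall>r>0. ((deriv ^^ k) (laplace 0) has_real_derivative (-1) ^ Suc k * laplace (Suc k) r) (at r)" for k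
  proof (induction k)
    case 0
    {
      case 1 show ?case by simp
    next
      case 2 show ?case using laplace_deriv by simp
    }
  next
    case (Suc k)
    {
      case 1 show ?case using Suc.IH(2) by (auto dest: DERIV_imp_deriv)
      then have eq: "\<forall>r>0. (deriv ^^ Suc k) (laplace 0) r = (-1) ^ Suc k * laplace (Suc k) r" by simp
    }
    note eq = this
    {
      case 2
      show ?case
      proof (intro allI impI)
        fix r :: real assume "0 < r"
        have "((\<lambda>r. (-1) ^ Suc k * laplace (Suc k) r) has_real_derivative (-1) ^ Suc k * - laplace (Suc (Suc k)) r) (at r)"
          by (intro DERIV_cmult laplace_deriv \<open>0 < r\<close>)
        then have "((deriv ^^ Suc k) (laplace 0) has_real_derivative (-1) ^ Suc k * - laplace (Suc (Suc k)) r) (at r)"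
          by (rule has_field_derivative_transform_within_open[where S="{0<..}"]) (use \<open>0 < r\<close> eq in auto)
        then show "((deriv ^^ Suc k) (laplace 0) has_real_derivative (-1) ^ Suc (Suc k) * laplace (Suc (Suc k)) r) (at r)"
          by simp
      qed
    }
  qed
  show "(deriv ^^ k) (laplace 0) r = (-1) ^ k * laplace k r" using * assms by blast
  show "(deriv ^^ k) (laplace 0) differentiable (at r)"
    using D assms by (auto simp: real_differentiable_def)
qed

lemma laplace_tendsto_0: "(laplace 0 \<longlongrightarrow> 0) at_top"
proof -
  have "((\<lambda>r. LINT \<omega>|\<Lambda>. exp (- (r * \<xi> \<omega>)) * \<rho> \<omega>) \<longlongrightarrow> (LINT \<omega>|\<Lambda>. 0)) at_top"
  proof (rule integral_dominated_convergence_at_top[where w="\<lambda>\<omega>. exp (- (1 * \<xi> \<omega>)) * \<rho> \<omega>"])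
    show "integrable \<Lambda> (\<lambda>\<omega>. exp (- (1 * \<xi> \<omega>)) * \<rho> \<omega>)"
      using integrable_laplace[of 1 0] by simp
    show "eventually (\<lambda>r. AE \<omega> in \<Lambda>. norm (exp (- (r * \<xi> \<omega>)) * \<rho> \<omega>) \<le> exp (- (1 * \<xi> \<omega>)) * \<rho> \<omega>) at_top"
      using eventually_ge_at_top[of "1::real"]
    proof eventually_elim
      case (elim r)
      have "exp (- (r * \<xi> \<omega>)) * \<rho> \<omega> \<le> exp (- (1 * \<xi> \<omega>)) * \<rho> \<omega>" for \<omega>
        using elim xi_pos[of \<omega>] rho_pos[of \<omega>] by (intro mult_right_mono) auto
      then show ?case using rho_pos by (auto simp: abs_mult abs_of_pos)
    qed
    show "AE \<omega> in \<Lambda>. ((\<lambda>r. exp (- (r * \<xi> \<omega>)) * \<rho> \<omega>) \<longlongrightarrow> 0) at_top"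
    proof (rule AE_I2)
      fix \<omega>
      have "filterlim (\<lambda>r. r * \<xi> \<omega>) at_top at_top"
        using xi_pos[of \<omega>] by (intro filterlim_at_top_mult_tendsto_pos[OF tendsto_const] filterlim_ident)
      then have "((\<lambda>r. exp (- (r * \<xi> \<omega>))) \<longlongrightarrow> 0) at_top"
        by (intro filterlim_compose[OF exp_at_bot]) (simp add: filterlim_uminus_at_bot)
      from tendsto_mult_right[OF this, of "\<rho> \<omega>"]
      show "((\<lambda>r. exp (- (r * \<xi> \<omega>)) * \<rho> \<omega>) \<longlongrightarrow> 0) at_top" by (simp add: tendsto_mult_left_zero)
    qed
  qed auto
  then show ?thesis by (simp add: laplace_def[abs_def])
qed

end

text \<open>With \<open>y = - ln m\<close> the rate is \<open>l / m\<close> and the weight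
  \<open>max 1 (m powr (\<alpha> - 2))\<close>, which grows at most quadratically in the rate since
  \<alpha> > 0.\<close>

lemma laplace_density_exp:
  fixes y :: "real \<Rightarrow> real"
  assumes "0 < \<alpha>" "\<alpha> < 2" "0 < l" and [measurable]: "y \<in> borel_measurable unit_interval"
  shows "laplace_density unit_interval (\<lambda>\<omega>. l * exp (y \<omega>)) (\<lambda>\<omega>. max 1 (exp ((2 - \<alpha>) * y \<omega>))) (1 / l\<^sup>2)"
proof -
  interpret prob_space unit_interval by (rule prob_space_unit_interval)
  have *: "max 1 (exp ((2 - \<alpha>) * x)) \<le> 1 + 1 / l\<^sup>2 * (l * exp x)\<^sup>2" for x
  proof -
    have "1 / l\<^sup>2 * (l * exp x)\<^sup>2 = exp (2 * x)"
      using assms by (simp add: power_mult_distrib exp_double)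
    moreover have "exp ((2 - \<alpha>) * x) \<le> 1 + exp (2 * x)"
    proof (cases "x \<ge> 0")
      case True
      then have "exp ((2 - \<alpha>) * x) \<le> exp (2 * x)" using assms by (simp add: mult_right_mono)
      then show ?thesis by (rule order_trans) simp
    next
      case False
      then have "exp ((2 - \<alpha>) * x) \<le> 1" using assms by (simp add: mult_nonneg_nonpos)
      then show ?thesis by (simp add: add_increasing2)
    qed
    ultimately show ?thesis by simp
  qed
  show ?thesis
    by unfold_locales (use assms * in \<open>auto simp: less_max_iff_disj\<close>)
qed

section \<open>Polar form of the image of the Levy measure\<close>

context exponential_tempering
begin

text \<open>The angle is \<open>u = T s \<theta> / m\<close> and the tempering rate \<open>l / m\<close> with \<open>m = norm (T s \<theta>)\<close>; both are
  recorded under the finite measure with density \<open>truncated_power \<alpha> m\<close>, the rate through \<open>y = - ln m\<close>.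
  Conditioning on \<open>u\<close> yields \<open>p\<close>, where \<open>\<rho>\<close> restores the weight: \<open>truncated_power \<alpha> m * \<rho> (- ln m) = m powr \<alpha>\<close>.\<close>

lemma image_levy_polar:
  fixes T :: "'s::euclidean_space \<Rightarrow> 'a \<Rightarrow> 'b::euclidean_space"
  assumes T [measurable]: "(\<lambda>(s, x). T s x) \<in> borel_measurable (borel \<Otimes>\<^sub>M borel)"
    and hom: "\<And>s c x. T s (c *\<^sub>R x) = c *\<^sub>R T s x"
    and bound: "\<And>s x. norm (T s x) \<le> \<tau> s * norm x" and \<tau>: "\<And>s. 0 \<le> \<tau> s"
    and int: "integrable lborel (\<lambda>s. truncated_power \<alpha> (\<tau> s))"
  obtains \<sigma>' p where "sphere_measure \<sigma>'" "tempering_function p"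
    "\<And>F. F \<in> borel_measurable borel \<Longrightarrow> (\<integral>\<^sup>+x. F x \<partial>polar_measure \<alpha> p \<sigma>') =
      (\<integral>\<^sup>+s. (\<integral>\<^sup>+x. F (T s x) * indicator (- {0}) (T s x) \<partial>levy) \<partial>lborel)"
proof -
  interpret S: finite_measure \<sigma> by (rule finite_measure_spectral)
  interpret I: prob_space unit_interval by (rule prob_space_unit_interval)
  interpret LI: pair_sigma_finite lborel unit_interval ..
  define W where "W = (lborel :: 's measure) \<Otimes>\<^sub>M \<sigma>"
  have TW: "(\<lambda>z. T (fst z) (snd z)) \<in> borel_measurable W"
  proof -
    have "(\<lambda>z. (fst z, snd z)) \<in> measurable W (borel \<Otimes>\<^sub>M borel)"
      unfolding W_def
      by (intro measurable_Pair measurable_compose[OF measurable_snd sphere_id_measurable]) simp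
    from measurable_compose[OF this T] show ?thesis by (simp add: split_beta')
  qed
  note [measurable] = TW
  define N0 where "N0 = density W (\<lambda>z. ennreal (truncated_power \<alpha> (norm (T (fst z) (snd z)))))"
  \<comment> \<open>Where \<open>T\<close> vanishes the direction takes the default value 0, but
    there the weight is \<open>truncated_power \<alpha> 0 = 0\<close>, so such points carry no
    mass.\<close>
  define g where "g = (\<lambda>z. (inverse (norm (T (fst z) (snd z))) *\<^sub>R T (fst z) (snd z), - ln (norm (T (fst z) (snd z)))))"
  have gm [measurable]: "g \<in> measurable W (borel \<Otimes>\<^sub>M borel)" unfolding g_def by measurable
  define N where "N = distr N0 (borel \<Otimes>\<^sub>M borel) g"
  have sN: "sets N = sets (borel \<Otimes>\<^sub>M borel)" by (simp add: N_def)
  have gm0 [measurable]: "g \<in> measurable N0 (borel \<Otimes>\<^sub>M borel)" by (simp add: N0_def)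
  have nnN: "(\<integral>\<^sup>+z. G z \<partial>N) = (\<integral>\<^sup>+s. (\<integral>\<^sup>+\<theta>. ennreal (truncated_power \<alpha> (norm (T s \<theta>))) * G (g (s, \<theta>)) \<partial>\<sigma>) \<partial>lborel)"
    if [measurable]: "G \<in> borel_measurable (borel \<Otimes>\<^sub>M borel)" for G
  proof -
    have "(\<integral>\<^sup>+z. G z \<partial>N) = (\<integral>\<^sup>+z. ennreal (truncated_power \<alpha> (norm (T (fst z) (snd z)))) * G (g z) \<partial>W)"
      unfolding N_def N0_def by (simp add: nn_integral_distr nn_integral_density)
    also have "\<dots> = (\<integral>\<^sup>+s. (\<integral>\<^sup>+\<theta>. ennreal (truncated_power \<alpha> (norm (T s \<theta>))) * G (g (s, \<theta>)) \<partial>\<sigma>) \<partial>lborel)"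
      using S.nn_integral_fst[of "\<lambda>z. ennreal (truncated_power \<alpha> (norm (T (fst z) (snd z)))) * G (g z)" lborel]
      by (simp add: W_def[symmetric])
    finally show ?thesis .
  qed
  \<comment> \<open>Disintegration is stated for finite measures. The assumed integrability of the
    gauge, together with the finite mass of \<sigma>, is exactly what bounds the total mass
    here.\<close>
  have "finite_measure N"
  proof (rule finite_measureI)
    have "emeasure N (space N) = (\<integral>\<^sup>+z. 1 \<partial>N)" by simp
    also have "\<dots> = (\<integral>\<^sup>+s. (\<integral>\<^sup>+\<theta>. ennreal (truncated_power \<alpha> (norm (T s \<theta>))) * 1 \<partial>\<sigma>) \<partial>lborel)"
      by (rule nnN) simp
    also have "\<dots> \<le> (\<integral>\<^sup>+s. (\<integral>\<^sup>+\<theta>. ennreal (truncated_power \<alpha> (\<tau> s)) \<partial>\<sigma>) \<partial>lborel)"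
    proof (intro nn_integral_mono)
      fix s \<theta> assume "\<theta> \<in> space \<sigma>"
      then have "norm \<theta> = 1" using sphere_measure_space[OF sphere] by simp
      then have "truncated_power \<alpha> (norm (T s \<theta>)) \<le> truncated_power \<alpha> (\<tau> s)"
        using bound[of s \<theta>] alpha by (intro truncated_power_mono) auto
      then show "ennreal (truncated_power \<alpha> (norm (T s \<theta>))) * 1 \<le> ennreal (truncated_power \<alpha> (\<tau> s))"
        by (simp add: ennreal_leI)
    qed
    also have "\<dots> = (\<integral>\<^sup>+s. ennreal (truncated_power \<alpha> (\<tau> s)) \<partial>lborel) * emeasure \<sigma> (space \<sigma>)"
      using int by (simp add: nn_integral_multc)
    also have "\<dots> < \<infinity>"
      using int by (simp add: nn_integral_eq_integral S.emeasure_eq_measure flip: ennreal_mult')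
    finally show "emeasure N (space N) \<noteq> \<infinity>" by simp
  qed
  from real_disintegration[OF this sN] obtain Y where
    Ym: "(\<lambda>(u, \<omega>). Y u \<omega>) \<in> borel_measurable (borel \<Otimes>\<^sub>M (borel :: real measure))"
    and Y: "\<And>G. G \<in> borel_measurable (borel \<Otimes>\<^sub>M borel) \<Longrightarrow>
      (\<integral>\<^sup>+z. G z \<partial>N) = (\<integral>\<^sup>+u. (\<integral>\<^sup>+\<omega>. G (u, Y u \<omega>) \<partial>unit_interval) \<partial>distr N borel fst)" by blast
  define \<mu> where "\<mu> = distr N borel fst"
  have fstN: "fst \<in> measurable N borel" unfolding measurable_cong_sets[OF sN refl] by simp
  interpret \<mu>: finite_measure \<mu>
    unfolding \<mu>_def by (rule finite_measure.finite_measure_distr[OF \<open>finite_measure N\<close> fstN])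
  have s\<mu>: "sets \<mu> = sets borel" by (simp add: \<mu>_def)
  have sphere\<mu>: "AE u in \<mu>. u \<in> sphere 0 1"
  proof -
    have "(\<integral>\<^sup>+u. indicator (- sphere 0 1) u \<partial>\<mu>) = (\<integral>\<^sup>+z. indicator (- sphere 0 1) (fst z) \<partial>N)"
      unfolding \<mu>_def by (rule nn_integral_distr[OF fstN]) auto
    also have "\<dots> = (\<integral>\<^sup>+s. (\<integral>\<^sup>+\<theta>. ennreal (truncated_power \<alpha> (norm (T s \<theta>))) * indicator (- sphere 0 1) (fst (g (s, \<theta>))) \<partial>\<sigma>) \<partial>lborel)"
      by (rule nnN) measurable
    also have "\<dots> = (\<integral>\<^sup>+s. (\<integral>\<^sup>+\<theta>. 0 \<partial>\<sigma>) \<partial>(lborel :: 's measure))"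
    proof (intro nn_integral_cong)
      fix s \<theta>
      show "ennreal (truncated_power \<alpha> (norm (T s \<theta>))) * indicator (- sphere 0 1) (fst (g (s, \<theta>))) = 0"
        by (cases "T s \<theta> = 0") (auto simp: g_def)
    qed
    finally have "(\<integral>\<^sup>+u. indicator (- sphere 0 1) u \<partial>\<mu>) = 0" by simp
    then have "emeasure \<mu> (- sphere 0 1) = 0" by (simp add: s\<mu>)
    then have "- sphere 0 1 \<in> null_sets \<mu>" by (simp add: null_sets_def s\<mu>)
    from AE_not_in[OF this] show ?thesis by simp
  qed
  \<comment> \<open>The marginal already lives on the sphere; the restriction adapts its
    \<sigma>-algebra to that of a spherical measure.\<close>
  define \<sigma>' where "\<sigma>' = restrict_space \<mu> (sphere 0 1)"
  have sph: "sphere 0 1 \<inter> space \<mu> \<in> sets \<mu>" by (simp add: s\<mu> sets_eq_imp_space_eq[OF s\<mu>])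
  have \<sigma>': "sphere_measure \<sigma>'"
    unfolding sphere_measure_def \<sigma>'_def
    by (intro conjI finite_measure_restrict_space \<mu>.finite_measure_axioms sets_restrict_space_cong s\<mu>)
       (simp add: s\<mu>)
  have nn\<sigma>': "(\<integral>\<^sup>+u. G u \<partial>\<sigma>') = (\<integral>\<^sup>+u. G u \<partial>\<mu>)" for G
    unfolding \<sigma>'_def nn_integral_restrict_space[OF sph]
    by (rule nn_integral_cong_AE) (use sphere\<mu> in eventually_elim, simp)
  define \<rho> where "\<rho> = (\<lambda>y. max 1 (exp ((2 - \<alpha>) * y)))"
  define p where "p = (\<lambda>r u. LINT \<omega>|unit_interval. exp (- (r * (l * exp (Y u \<omega>)))) * \<rho> (Y u \<omega>))"
  have Yu [measurable]: "Y u \<in> borel_measurable unit_interval" for u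
  proof -
    have "(\<lambda>\<omega>. case (u, \<omega>) of (u, \<omega>) \<Rightarrow> Y u \<omega>) \<in> borel_measurable borel"
      by (rule measurable_compose[OF measurable_Pair1' Ym]) simp
    then show ?thesis unfolding prod.case by (rule measurable_unit_interval)
  qed
  have \<rho>m [measurable]: "\<rho> \<in> borel_measurable borel" unfolding \<rho>_def by measurable
  have LD: "laplace_density unit_interval (\<lambda>\<omega>. l * exp (Y u \<omega>)) (\<lambda>\<omega>. \<rho> (Y u \<omega>)) (1 / l\<^sup>2)" for u
    unfolding \<rho>_def using alpha l by (intro laplace_density_exp) auto
  have p_eq: "(\<lambda>r. p r u) = laplace_density.laplace unit_interval (\<lambda>\<omega>. l * exp (Y u \<omega>)) (\<lambda>\<omega>. \<rho> (Y u \<omega>)) 0" for u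
    unfolding laplace_density.laplace_def[OF LD] p_def by simp
  have idI: "(\<lambda>x. x) \<in> borel_measurable unit_interval" by (rule measurable_unit_interval) simp
  have pm: "(\<lambda>(r, u). p r u) \<in> borel_measurable (borel \<Otimes>\<^sub>M borel)"
  proof -
    have f: "(\<lambda>z. (snd (fst z), snd z)) \<in> measurable ((borel \<Otimes>\<^sub>M borel) \<Otimes>\<^sub>M unit_interval) ((borel :: 'b measure) \<Otimes>\<^sub>M borel)"
      by (intro measurable_Pair measurable_compose[OF measurable_snd idI]) simp
    have "(\<lambda>z. Y (snd (fst z)) (snd z)) \<in> borel_measurable (((borel :: real measure) \<Otimes>\<^sub>M borel) \<Otimes>\<^sub>M unit_interval)"
      using measurable_compose[OF f Ym] by simp
    note [measurable] = this
    have "(\<lambda>z. LINT \<omega>|unit_interval. exp (- (fst z * (l * exp (Y (snd z) \<omega>)))) * \<rho> (Y (snd z) \<omega>)) \<in>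
        borel_measurable ((borel :: real measure) \<Otimes>\<^sub>M borel)"
      by (rule I.borel_measurable_lebesgue_integral) (simp add: split_beta')
    then show ?thesis by (simp add: p_def split_beta')
  qed
  have temp: "tempering_function p"
    unfolding tempering_function_def
  proof (intro conjI ballI allI impI)
    show "(\<lambda>(r, \<theta>). p r \<theta>) \<in> borel_measurable (restrict_space borel ({0<..} \<times> sphere 0 1))"
      using pm by (intro measurable_restrict_space1) (simp add: borel_prod)
    fix \<theta> :: 'b
    interpret laplace_density unit_interval "\<lambda>\<omega>. l * exp (Y \<theta> \<omega>)" "\<lambda>\<omega>. \<rho> (Y \<theta> \<omega>)" "1 / l\<^sup>2" by (rule LD)
    show "((\<lambda>r. p r \<theta>) \<longlongrightarrow> 0) at_top" unfolding p_eq by (rule laplace_tendsto_0)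
    fix k and r :: real assume "0 < r"
    show "(deriv ^^ k) (\<lambda>r. p r \<theta>) differentiable at r"
      unfolding p_eq using laplace_deriv_funpow(2)[OF \<open>0 < r\<close>] .
    have "(-1) ^ k * (deriv ^^ k) (\<lambda>r. p r \<theta>) r = laplace k r"
      unfolding p_eq laplace_deriv_funpow(1)[OF \<open>0 < r\<close>] by (simp add: power_mult_distrib[symmetric])
    then show "0 < (-1) ^ k * (deriv ^^ k) (\<lambda>r. p r \<theta>) r"
      using laplace_pos[OF \<open>0 < r\<close>] by simp
  qed
  have p_nn: "ennreal (p r u) = (\<integral>\<^sup>+\<omega>. ennreal (exp (- (r * (l * exp (Y u \<omega>)))) * \<rho> (Y u \<omega>)) \<partial>unit_interval)"
    if "0 < r" for r u
  proof -
    interpret laplace_density unit_interval "\<lambda>\<omega>. l * exp (Y u \<omega>)" "\<lambda>\<omega>. \<rho> (Y u \<omega>)" "1 / l\<^sup>2" by (rule LD)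
    show ?thesis
      unfolding p_def using integrable_laplace[OF that, of 0] rho_pos
      by (intro nn_integral_eq_integral[symmetric]) (auto intro!: AE_I2 mult_nonneg_nonneg less_imp_le)
  qed
  have main: "(\<integral>\<^sup>+x. F x \<partial>polar_measure \<alpha> p \<sigma>') =
      (\<integral>\<^sup>+s. (\<integral>\<^sup>+x. F (T s x) * indicator (- {0}) (T s x) \<partial>levy) \<partial>lborel)"
    if F [measurable]: "F \<in> borel_measurable borel" for F
  proof -
    define G where "G = (\<lambda>z. \<integral>\<^sup>+r. indicator {0<..} r * ennreal (r powr (- \<alpha> - 1)) *
        ennreal (exp (- (r * (l * exp (snd z)))) * \<rho> (snd z)) * F (r *\<^sub>R fst z) \<partial>lborel)"
    have Gm: "G \<in> borel_measurable (borel \<Otimes>\<^sub>M borel)" unfolding G_def by measurable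
    have idS: "(\<lambda>\<theta>. \<theta>) \<in> borel_measurable \<sigma>'" by (rule sphere_measure_id_measurable[OF \<sigma>'])
    have "(\<integral>\<^sup>+x. F x \<partial>polar_measure \<alpha> p \<sigma>') =
      (\<integral>\<^sup>+u. (\<integral>\<^sup>+r. indicator {0<..} r * ennreal (r powr (- \<alpha> - 1) * p r u) * F (r *\<^sub>R u) \<partial>lborel) \<partial>\<sigma>')"
    proof (rule nn_integral_polar_measure[OF \<sigma>' _ F])
      have "(\<lambda>z. (snd z, fst z)) \<in> measurable (\<sigma>' \<Otimes>\<^sub>M lborel) (borel \<Otimes>\<^sub>M borel)"
        by (intro measurable_Pair measurable_compose[OF measurable_fst idS]) simp
      from measurable_compose[OF this pm]
      have [measurable]: "(\<lambda>z. p (snd z) (fst z)) \<in> borel_measurable (\<sigma>' \<Otimes>\<^sub>M lborel)" by simp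
      show "(\<lambda>(u, r). indicator {0<..} r * ennreal (r powr (- \<alpha> - 1) * p r u)) \<in> borel_measurable (\<sigma>' \<Otimes>\<^sub>M lborel)"
        unfolding split_beta' by measurable
    qed
    also have "\<dots> = (\<integral>\<^sup>+u. (\<integral>\<^sup>+\<omega>. G (u, Y u \<omega>) \<partial>unit_interval) \<partial>\<sigma>')"
    proof (rule nn_integral_cong)
      fix u
      let ?h = "\<lambda>r \<omega>. indicator {0<..} r * ennreal (r powr (- \<alpha> - 1)) *
        ennreal (exp (- (r * (l * exp (Y u \<omega>)))) * \<rho> (Y u \<omega>)) * F (r *\<^sub>R u)"
      have "(\<integral>\<^sup>+r. indicator {0<..} r * ennreal (r powr (- \<alpha> - 1) * p r u) * F (r *\<^sub>R u) \<partial>lborel) =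
          (\<integral>\<^sup>+r. (\<integral>\<^sup>+\<omega>. ?h r \<omega> \<partial>unit_interval) \<partial>lborel)"
      proof (rule nn_integral_cong)
        fix r :: real
        show "indicator {0<..} r * ennreal (r powr (- \<alpha> - 1) * p r u) * F (r *\<^sub>R u) = (\<integral>\<^sup>+\<omega>. ?h r \<omega> \<partial>unit_interval)"
        proof (cases "r > 0")
          case True
          have "(\<integral>\<^sup>+\<omega>. ?h r \<omega> \<partial>unit_interval) = indicator {0<..} r * ennreal (r powr (- \<alpha> - 1)) * ennreal (p r u) * F (r *\<^sub>R u)"
            unfolding p_nn[OF True] by (subst nn_integral_multc, measurable, subst nn_integral_cmult, measurable)
          also have "ennreal (r powr (- \<alpha> - 1) * p r u) = ennreal (r powr (- \<alpha> - 1)) * ennreal (p r u)"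
            by (rule ennreal_mult') simp
          then have "indicator {0<..} r * ennreal (r powr (- \<alpha> - 1)) * ennreal (p r u) * F (r *\<^sub>R u) =
              indicator {0<..} r * ennreal (r powr (- \<alpha> - 1) * p r u) * F (r *\<^sub>R u)" by (simp add: mult.assoc)
          finally show ?thesis by simp
        qed simp
      qed
      also have "\<dots> = (\<integral>\<^sup>+\<omega>. (\<integral>\<^sup>+r. ?h r \<omega> \<partial>lborel) \<partial>unit_interval)"
        by (rule LI.Fubini'[symmetric]) measurable
      finally show "(\<integral>\<^sup>+r. indicator {0<..} r * ennreal (r powr (- \<alpha> - 1) * p r u) * F (r *\<^sub>R u) \<partial>lborel) =
          (\<integral>\<^sup>+\<omega>. G (u, Y u \<omega>) \<partial>unit_interval)" by (simp add: G_def)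
    qed
    also have "\<dots> = (\<integral>\<^sup>+z. G z \<partial>N)"
      unfolding nn\<sigma>' Y[OF Gm] \<mu>_def ..
    also have "\<dots> = (\<integral>\<^sup>+s. (\<integral>\<^sup>+\<theta>. ennreal (truncated_power \<alpha> (norm (T s \<theta>))) * G (g (s, \<theta>)) \<partial>\<sigma>) \<partial>lborel)"
      by (rule nnN[OF Gm])
    also have "\<dots> = (\<integral>\<^sup>+s. (\<integral>\<^sup>+\<theta>. (\<integral>\<^sup>+r. indicator {0<..} r * ennreal (r powr (- \<alpha> - 1) * exp (- l * r)) *
        (F (T s (r *\<^sub>R \<theta>)) * indicator (- {0}) (T s (r *\<^sub>R \<theta>))) \<partial>lborel) \<partial>\<sigma>) \<partial>lborel)"
    proof (intro nn_integral_cong)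
      fix s \<theta>
      define m where "m = norm (T s \<theta>)"
      show "ennreal (truncated_power \<alpha> (norm (T s \<theta>))) * G (g (s, \<theta>)) =
        (\<integral>\<^sup>+r. indicator {0<..} r * ennreal (r powr (- \<alpha> - 1) * exp (- l * r)) *
        (F (T s (r *\<^sub>R \<theta>)) * indicator (- {0}) (T s (r *\<^sub>R \<theta>))) \<partial>lborel)"
      \<comment> \<open>If the image vanishes, the weight annihilates the left side and the
        indicator the right side: a Levy measure has no mass at 0.\<close>
      proof (cases "T s \<theta> = 0")
        case True
        then show ?thesis by (simp add: hom)
      next
        case False
        then have m: "m > 0" by (simp add: m_def)
        \<comment> \<open>For \<open>m \<le> 1\<close> the gauge is \<open>m\<^sup>2\<close> and
          \<rho> supplies \<open>m powr (\<alpha> - 2)\<close>; for \<open>m > 1\<close> the gauge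
          is already \<open>m powr \<alpha>\<close> and \<rho> equals 1.\<close>
        have weight: "truncated_power \<alpha> m * \<rho> (- ln m) = m powr \<alpha>"
        proof -
          have e: "exp ((2 - \<alpha>) * - ln m) = m powr (\<alpha> - 2)"
            using m by (simp add: powr_def algebra_simps)
          have sq: "m\<^sup>2 * m powr (\<alpha> - 2) = m powr \<alpha>"
            using powr_mult_square[OF m, of "\<alpha> - 2"] by (simp add: mult.commute)
          show ?thesis
          proof (cases "m \<le> 1")
            case True
            then have "m powr (\<alpha> - 2) \<ge> 1"
              using m alpha powr_mono'[of "\<alpha> - 2" 0 m] by simp
            moreover from this have "m\<^sup>2 \<le> m powr \<alpha>" using m by (simp add: sq[symmetric])
            ultimately show ?thesis
              using sq unfolding truncated_power_def \<rho>_def e by (simp only: max_absorb2 min_absorb2)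
          next
            case False
            then have "m powr (\<alpha> - 2) \<le> 1"
              using m alpha powr_mono[of "\<alpha> - 2" 0 m] by simp
            moreover from this have "m powr \<alpha> \<le> m\<^sup>2" using m by (simp add: sq[symmetric] mult_le_cancel_left1)
            ultimately show ?thesis
              unfolding truncated_power_def \<rho>_def e by (simp only: max_absorb1 min_absorb1 mult_1_right)
          qed
        qed
        let ?k = "\<lambda>r. indicator {0<..} r * ennreal (m powr \<alpha> * (r powr (- \<alpha> - 1) * exp (- (r * (l / m))))) * F ((r / m) *\<^sub>R T s \<theta>)"
        have "exp (- ln m) = 1 / m" using m by (simp add: exp_minus inverse_eq_divide)
        then have "ennreal (truncated_power \<alpha> m) * G (g (s, \<theta>)) = (\<integral>\<^sup>+r. ?k r \<partial>lborel)"
          unfolding G_def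
        proof (subst nn_integral_cmult[symmetric], goal_cases)
          case 2
          show ?case
          proof (rule nn_integral_cong)
            fix r :: real
            have gs: "fst (g (s, \<theta>)) = inverse m *\<^sub>R T s \<theta>" "snd (g (s, \<theta>)) = - ln m"
              by (simp_all add: g_def m_def)
            have "ennreal (truncated_power \<alpha> m) * (ennreal (r powr (- \<alpha> - 1)) * ennreal (exp (- (r * (l / m))) * \<rho> (- ln m))) =
                ennreal (truncated_power \<alpha> m * (r powr (- \<alpha> - 1) * (exp (- (r * (l / m))) * \<rho> (- ln m))))"
              by (simp add: ennreal_mult \<rho>_def)
            also have "\<dots> = ennreal (truncated_power \<alpha> m * \<rho> (- ln m) * (r powr (- \<alpha> - 1) * exp (- (r * (l / m)))))"
              by (simp only: mult_ac)
            finally have w: "ennreal (truncated_power \<alpha> m) * (ennreal (r powr (- \<alpha> - 1)) * ennreal (exp (- (r * (l / m))) * \<rho> (- ln m))) =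
                ennreal (m powr \<alpha> * (r powr (- \<alpha> - 1) * exp (- (r * (l / m)))))" unfolding weight .
            have sc: "r *\<^sub>R inverse m *\<^sub>R T s \<theta> = (r / m) *\<^sub>R T s \<theta>" by (simp add: divide_inverse)
            show "ennreal (truncated_power \<alpha> m) * (indicator {0<..} r * ennreal (r powr (- \<alpha> - 1)) *
                ennreal (exp (- (r * (l * exp (snd (g (s, \<theta>)))))) * \<rho> (snd (g (s, \<theta>)))) * F (r *\<^sub>R fst (g (s, \<theta>)))) = ?k r"
              unfolding gs sc using 2 w[symmetric] by (simp add: mult_ac)
          qed
        qed measurable
        \<comment> \<open>Substitution \<open>r = m * t\<close>: the powers of \<open>m\<close>
          cancel, since \<open>m * m powr \<alpha> * m powr (- \<alpha> - 1) = 1\<close>, and the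
          rate \<open>l / m\<close> becomes \<open>l\<close>.\<close>
        also have "\<dots> = ennreal \<bar>m\<bar> * (\<integral>\<^sup>+t. ?k (0 + m * t) \<partial>lborel)"
          using m by (intro nn_integral_real_affine) auto
        also have "\<dots> = (\<integral>\<^sup>+t. ennreal m * ?k (m * t) \<partial>lborel)"
          using m by (subst nn_integral_cmult) auto
        also have "\<dots> = (\<integral>\<^sup>+r. indicator {0<..} r * ennreal (r powr (- \<alpha> - 1) * exp (- l * r)) *
          (F (T s (r *\<^sub>R \<theta>)) * indicator (- {0}) (T s (r *\<^sub>R \<theta>))) \<partial>lborel)"
        proof (rule nn_integral_cong)
          fix t :: real
          show "ennreal m * ?k (m * t) = indicator {0<..} t * ennreal (t powr (- \<alpha> - 1) * exp (- l * t)) *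
              (F (T s (t *\<^sub>R \<theta>)) * indicator (- {0}) (T s (t *\<^sub>R \<theta>)))"
          proof (cases "t > 0")
            case True
            have "m * (m powr \<alpha> * ((m * t) powr (- \<alpha> - 1) * exp (- (m * t * (l / m))))) = t powr (- \<alpha> - 1) * exp (- l * t)"
            proof -
              have "m * m powr \<alpha> * m powr (- \<alpha> - 1) = m powr (1 + \<alpha> + (- \<alpha> - 1))"
                using m by (simp only: powr_add powr_one)
              then have "m * m powr \<alpha> * m powr (- \<alpha> - 1) = 1" using m by simp
              moreover have "m * t * (l / m) = l * t" using m by simp
              ultimately show ?thesis using m True by (simp add: powr_mult mult.assoc[symmetric])
            qed
            then have "ennreal m * ennreal (m powr \<alpha> * ((m * t) powr (- \<alpha> - 1) * exp (- (m * t * (l / m))))) =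
                ennreal (t powr (- \<alpha> - 1) * exp (- l * t))"
              using m by (subst ennreal_mult[symmetric]) auto
            then show ?thesis
              using True m False by (simp add: hom zero_less_mult_iff mult.assoc[symmetric])
          qed (use m in \<open>simp add: zero_less_mult_iff\<close>)
        qed
        finally show ?thesis by (simp add: m_def)
      qed
    qed
    also have "\<dots> = (\<integral>\<^sup>+s. (\<integral>\<^sup>+x. F (T s x) * indicator (- {0}) (T s x) \<partial>levy) \<partial>lborel)"
    proof (rule nn_integral_cong)
      fix s
      have [measurable]: "T s \<in> borel_measurable borel"
        using measurable_compose[OF measurable_Pair1' T, of s] by simp
      show "(\<integral>\<^sup>+\<theta>. (\<integral>\<^sup>+r. indicator {0<..} r * ennreal (r powr (- \<alpha> - 1) * exp (- l * r)) *
        (F (T s (r *\<^sub>R \<theta>)) * indicator (- {0}) (T s (r *\<^sub>R \<theta>))) \<partial>lborel) \<partial>\<sigma>) =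
        (\<integral>\<^sup>+x. F (T s x) * indicator (- {0}) (T s x) \<partial>levy)"
        by (rule nn_integral_levy[symmetric]) measurable
    qed
    finally show ?thesis .
  qed
  show thesis using that[OF \<sigma>' temp main] .
qed

end

lemma nn_integral_symmetric_sphere:
  fixes \<sigma> :: "'a::euclidean_space measure"
  assumes \<sigma>: "sphere_measure \<sigma>" and sym: "symmetric_measure \<sigma>" and f: "f \<in> borel_measurable \<sigma>"
  shows "(\<integral>\<^sup>+\<theta>. f (- \<theta>) \<partial>\<sigma>) = (\<integral>\<^sup>+\<theta>. f \<theta> \<partial>\<sigma>)"
proof -
  have s: "sets \<sigma> = sets (restrict_space borel (sphere 0 1))"
    using \<sigma> by (simp add: sphere_measure_def)
  have sp: "space \<sigma> = sphere 0 1" by (rule sphere_measure_space[OF \<sigma>])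
  have "(\<lambda>\<theta>. - \<theta>) \<in> borel_measurable \<sigma>"
    using sphere_measure_id_measurable[OF \<sigma>] by measurable
  then have m: "uminus \<in> measurable \<sigma> \<sigma>"
    unfolding measurable_cong_sets[OF refl s] by (intro measurable_restrict_space2) (auto simp: sp)
  have "distr \<sigma> \<sigma> uminus = \<sigma>"
  proof (rule measure_eqI)
    fix A assume "A \<in> sets (distr \<sigma> \<sigma> uminus)"
    then have A: "A \<in> sets \<sigma>" by simp
    have "uminus -` A \<inter> space \<sigma> = uminus ` A"
      using sets.sets_into_space[OF A] by (force simp: sp)
    then show "emeasure (distr \<sigma> \<sigma> uminus) A = emeasure \<sigma> A"
      using sym A by (simp add: emeasure_distr[OF m A] symmetric_measure_def)
  qed simp
  then have "(\<integral>\<^sup>+\<theta>. f \<theta> \<partial>\<sigma>) = (\<integral>\<^sup>+\<theta>. f \<theta> \<partial>distr \<sigma> \<sigma> uminus)" by simp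
  also have "\<dots> = (\<integral>\<^sup>+\<theta>. f (- \<theta>) \<partial>\<sigma>)" by (rule nn_integral_distr[OF m]) (simp add: f)
  finally show ?thesis by simp
qed

lemma norm_matrix_vector_mult_le:
  fixes A :: "real^'n^'m"
  shows "norm (A *v x) \<le> norm A * norm x"
proof -
  have "norm (A *v x) \<le> L2_set (\<lambda>i. norm (A $ i) * norm x) UNIV"
    unfolding norm_vec_def[of "A *v x"]
    by (rule L2_set_mono) (auto simp: matrix_vector_mul_component Cauchy_Schwarz_ineq2)
  also have "\<dots> = norm A * norm x"
    by (simp add: norm_vec_def[of A] L2_set_left_distrib)
  finally show ?thesis .
qed

lemma truncated_power_sum:
  assumes "0 \<le> \<alpha>" "\<alpha> \<le> 2" "\<And>j. j \<in> J \<Longrightarrow> 0 \<le> x j"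
  shows "truncated_power \<alpha> (\<Sum>j\<in>J. x j) \<le> 4 ^ card J * (\<Sum>j\<in>J. truncated_power \<alpha> (x j))"
  using assms(3)
proof (induction J rule: infinite_finite_induct)
  case (insert i J)
  have "truncated_power \<alpha> (\<Sum>j\<in>insert i J. x j) \<le> 4 * (truncated_power \<alpha> (x i) + truncated_power \<alpha> (\<Sum>j\<in>J. x j))"
    using insert assms truncated_power_add[of \<alpha> "x i" "\<Sum>j\<in>J. x j"] by (auto simp: sum_nonneg)
  also have "\<dots> \<le> 4 * (4 ^ card J * truncated_power \<alpha> (x i) + 4 ^ card J * (\<Sum>j\<in>J. truncated_power \<alpha> (x j)))"
    using insert mult_right_mono[OF one_le_power[of "4::real" "card J"] truncated_power_nonneg[of \<alpha> "x i"]]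
    by (intro mult_left_mono add_mono) auto
  also have "\<dots> = 4 ^ card (insert i J) * (\<Sum>j\<in>insert i J. truncated_power \<alpha> (x j))"
    using insert by (simp add: algebra_simps)
  finally show ?case .
qed auto

context exponential_tempering
begin

lemma nn_integral_levy_minus:
  assumes sym: "symmetric_measure \<sigma>" and [measurable]: "f \<in> borel_measurable borel"
  shows "(\<integral>\<^sup>+x. f (- x) \<partial>levy) = (\<integral>\<^sup>+x. f x \<partial>levy)"
proof -
  let ?g = "\<lambda>\<theta>. \<integral>\<^sup>+r. indicator {0<..} r * ennreal (r powr (- \<alpha> - 1) * exp (- l * r)) * f (r *\<^sub>R \<theta>) \<partial>lborel"
  have "?g \<in> borel_measurable \<sigma>" by measurable
  from nn_integral_symmetric_sphere[OF sphere sym this] show ?thesis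
    by (simp add: nn_integral_levy)
qed

text \<open>By symmetry the imaginary part of the compensated integrand is odd and integrates to 0.
  The representation thus holds with drift 0, and the remaining real integral is the given exponent.
  \<open>T\<close> is kept general so that it can collect several integrands into one
  vector.\<close>

lemma tempered_stable_image:
  fixes T :: "'s::euclidean_space \<Rightarrow> 'a \<Rightarrow> 'b::euclidean_space"
  assumes sym: "symmetric_measure \<sigma>"
    and T [measurable]: "(\<lambda>(s, x). T s x) \<in> borel_measurable (borel \<Otimes>\<^sub>M borel)"
    and hom: "\<And>s c x. T s (c *\<^sub>R x) = c *\<^sub>R T s x"
    and bound: "\<And>s x. norm (T s x) \<le> \<tau> s * norm x" and \<tau>: "\<And>s. 0 \<le> \<tau> s"
    and int: "integrable lborel (\<lambda>s. truncated_power \<alpha> (\<tau> s))"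
    and id: "infinitely_divisible \<mu>"
    and char: "\<And>w. char_fun \<mu> w = exp (of_real (- enn2real (\<integral>\<^sup>+s. (\<integral>\<^sup>+x. ennreal (1 - cos (w \<bullet> T s x)) \<partial>levy) \<partial>lborel)))"
  shows "tempered_stable \<alpha> \<mu>"
proof -
  obtain \<sigma>' p where \<sigma>': "sphere_measure \<sigma>'" and p: "tempering_function p"
    and nn: "\<And>F. F \<in> borel_measurable borel \<Longrightarrow> (\<integral>\<^sup>+x. F x \<partial>polar_measure \<alpha> p \<sigma>') =
      (\<integral>\<^sup>+s. (\<integral>\<^sup>+x. F (T s x) * indicator (- {0}) (T s x) \<partial>levy) \<partial>lborel)"
    using image_levy_polar[OF T hom bound \<tau> int] by blast
  define \<nu> where "\<nu> = polar_measure \<alpha> p \<sigma>'"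
  have s\<nu> [measurable_cong]: "sets \<nu> = sets borel" by (simp add: \<nu>_def polar_measure_def)
  note meas\<nu> = measurable_cong_sets[OF s\<nu> refl]
  have Ts [measurable]: "T s \<in> borel_measurable borel" for s
    using measurable_compose[OF measurable_Pair1' T, of s] by simp
  \<comment> \<open>A function that vanishes at 0 does not see the mass at 0 which the indicator
    removes.\<close>
  have nn': "(\<integral>\<^sup>+x. F x \<partial>\<nu>) = (\<integral>\<^sup>+s. (\<integral>\<^sup>+x. F (T s x) \<partial>levy) \<partial>lborel)"
    if "F \<in> borel_measurable borel" "F 0 = 0" for F
    unfolding \<nu>_def nn[OF that(1)]
    by (intro nn_integral_cong) (use that(2) in \<open>auto simp: indicator_def\<close>)
  have sym\<nu>: "(\<integral>\<^sup>+x. F (- x) \<partial>\<nu>) = (\<integral>\<^sup>+x. F x \<partial>\<nu>)" if [measurable]: "F \<in> borel_measurable borel" for F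
  proof -
    have neg: "- T s x = T s (- x)" for s x using hom[of s "-1" x] by simp
    have "(\<integral>\<^sup>+x. F (- x) \<partial>\<nu>) = (\<integral>\<^sup>+s. (\<integral>\<^sup>+x. F (- T s x) * indicator (- {0}) (T s x) \<partial>levy) \<partial>lborel)"
      unfolding \<nu>_def by (rule nn) measurable
    also have "\<dots> = (\<integral>\<^sup>+s. (\<integral>\<^sup>+x. F (T s (- x)) * indicator (- {0}) (T s (- x)) \<partial>levy) \<partial>lborel)"
      by (intro nn_integral_cong) (auto simp: neg[symmetric] indicator_def)
    also have "\<dots> = (\<integral>\<^sup>+s. (\<integral>\<^sup>+x. F (T s x) * indicator (- {0}) (T s x) \<partial>levy) \<partial>lborel)"
    proof (rule nn_integral_cong)
      fix s
      have "(\<lambda>x. F (T s x) * indicator (- {0}) (T s x)) \<in> borel_measurable borel" by measurable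
      from nn_integral_levy_minus[OF sym this]
      show "(\<integral>\<^sup>+x. F (T s (- x)) * indicator (- {0}) (T s (- x)) \<partial>levy) = (\<integral>\<^sup>+x. F (T s x) * indicator (- {0}) (T s x) \<partial>levy)" .
    qed
    finally show ?thesis unfolding \<nu>_def nn[OF that] .
  qed
  have fin: "(\<integral>\<^sup>+x. ennreal (min 1 ((norm x)\<^sup>2)) \<partial>\<nu>) < \<infinity>"
  proof -
    obtain C where C: "C > 0" "\<And>y. y \<ge> 0 \<Longrightarrow>
      (\<integral>\<^sup>+x. ennreal (min 1 ((y * norm x)\<^sup>2)) \<partial>levy) \<le> ennreal (C * truncated_power \<alpha> y)"
      using truncation_bound by blast
    have "(\<integral>\<^sup>+x. ennreal (min 1 ((norm x)\<^sup>2)) \<partial>\<nu>) = (\<integral>\<^sup>+s. (\<integral>\<^sup>+x. ennreal (min 1 ((norm (T s x))\<^sup>2)) \<partial>levy) \<partial>lborel)"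
      by (rule nn') auto
    also have "\<dots> \<le> (\<integral>\<^sup>+s. ennreal (C * truncated_power \<alpha> (\<tau> s)) \<partial>lborel)"
    proof (rule nn_integral_mono)
      fix s
      have "(\<integral>\<^sup>+x. ennreal (min 1 ((norm (T s x))\<^sup>2)) \<partial>levy) \<le> (\<integral>\<^sup>+x. ennreal (min 1 ((\<tau> s * norm x)\<^sup>2)) \<partial>levy)"
      proof (intro nn_integral_mono ennreal_leI)
        fix x
        have "(norm (T s x))\<^sup>2 \<le> (\<tau> s * norm x)\<^sup>2" using bound by (intro power_mono) auto
        then show "min 1 ((norm (T s x))\<^sup>2) \<le> min 1 ((\<tau> s * norm x)\<^sup>2)" by linarith
      qed
      also have "\<dots> \<le> ennreal (C * truncated_power \<alpha> (\<tau> s))" by (rule C(2)[OF \<tau>])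
      finally show "(\<integral>\<^sup>+x. ennreal (min 1 ((norm (T s x))\<^sup>2)) \<partial>levy) \<le> ennreal (C * truncated_power \<alpha> (\<tau> s))" .
    qed
    also have "\<dots> < \<infinity>"
      using int C(1) by (subst nn_integral_eq_integral) auto
    finally show ?thesis .
  qed
  have levy\<nu>: "levy_measure \<nu>"
    unfolding levy_measure_def
  proof (intro conjI s\<nu> fin)
    have "emeasure \<nu> {0} = (\<integral>\<^sup>+x. indicator {0} x \<partial>\<nu>)" by (simp add: s\<nu>)
    also have "\<dots> = 0"
      unfolding \<nu>_def by (subst nn) (auto simp: indicator_def intro!: nn_integral_zero' AE_I2)
    finally show "emeasure \<nu> {0} = 0" .
  qed
  have "has_levy_triplet \<mu> 0 (\<lambda>_. 0) \<nu>"
    unfolding has_levy_triplet_def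
  proof (intro conjI allI levy\<nu>)
    show "linear (\<lambda>_ :: 'b. 0 :: 'b)" by (rule linear_zero)
    fix w :: 'b
    let ?h = "\<lambda>x. iexp (w \<bullet> x) - 1 - \<i> * of_real ((w \<bullet> x) * indicator (cball 0 1) x)"
    have [measurable]: "cball (0::'b) 1 \<in> sets borel" by simp
    have hm [measurable]: "?h \<in> borel_measurable borel" by measurable
    \<comment> \<open>Inside the unit ball this is a second-order Taylor remainder, outside the
      trivial bound 2.\<close>
    have hb: "cmod (?h x) \<le> 2 * max 1 ((norm w)\<^sup>2) * min 1 ((norm x)\<^sup>2)" for x
    proof (cases "norm x \<le> 1")
      case True
      have "cmod (?h x) = cmod (iexp (w \<bullet> x) - (\<Sum>k\<le>1. (\<i> * (w \<bullet> x)) ^ k / fact k))"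
        using True by (simp add: algebra_simps)
      also have "\<dots> \<le> \<bar>w \<bullet> x\<bar> ^ 2 / 2"
        using iexp_approx1[of "w \<bullet> x" 1] by (simp add: numeral_2_eq_2)
      also have "\<dots> \<le> (norm w * norm x)\<^sup>2"
      proof -
        have "\<bar>w \<bullet> x\<bar> ^ 2 \<le> (norm w * norm x)\<^sup>2"
          by (intro power_mono Cauchy_Schwarz_ineq2) simp
        moreover have "0 \<le> \<bar>w \<bullet> x\<bar> ^ 2" by simp
        ultimately show ?thesis by linarith
      qed
      also have "\<dots> \<le> 2 * max 1 ((norm w)\<^sup>2) * (norm x)\<^sup>2"
        unfolding power_mult_distrib by (intro mult_right_mono) auto
      finally show ?thesis using True by (simp add: power_le_one min_absorb2)
    next
      case False
      then have n1: "1 \<le> (norm x)\<^sup>2" by (simp add: one_le_power)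
      have "cmod (?h x) = cmod (iexp (w \<bullet> x) - 1)" using False by simp
      also have "\<dots> \<le> cmod (iexp (w \<bullet> x)) + cmod 1" by (rule norm_triangle_ineq4)
      also have "\<dots> = 2" by simp
      finally show ?thesis using n1 by (simp add: min_absorb1 max.coboundedI1)
    qed
    have ib: "integrable \<nu> (\<lambda>x. 2 * max 1 ((norm w)\<^sup>2) * min 1 ((norm x)\<^sup>2))"
      using fin by (intro integrable_mult_right integrableI_nonneg) (auto simp: meas\<nu>)
    have ih: "complex_integrable \<nu> ?h"
      by (rule Bochner_Integration.integrable_bound[OF ib]) (use hm hb in \<open>auto simp: meas\<nu> intro!: AE_I2 order_trans[OF hb]\<close>)
    have "Im (CLINT x|\<nu>. ?h x) = 0"
    proof -
      let ?i = "\<lambda>x. sin (w \<bullet> x) - (w \<bullet> x) * indicator (cball 0 1) x"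
      have ii: "integrable \<nu> ?i" using integrable_Im[OF ih] by (simp add: Im_exp)
      have im [measurable]: "?i \<in> borel_measurable borel" by measurable
      have odd: "?i (- x) = - ?i x" for x by (simp add: indicator_def)
      have "(\<integral>\<^sup>+x. ennreal (- ?i x) \<partial>\<nu>) = (\<integral>\<^sup>+x. ennreal (?i (- x)) \<partial>\<nu>)" by (simp only: odd)
      also have "\<dots> = (\<integral>\<^sup>+x. ennreal (?i x) \<partial>\<nu>)" by (rule sym\<nu>) measurable
      finally have "(LINT x|\<nu>. ?i x) = 0"
        unfolding real_lebesgue_integral_def[OF ii] by simp
      moreover have "Im (CLINT x|\<nu>. ?h x) = (LINT x|\<nu>. ?i x)"
        using ih by (subst integral_Im[symmetric]) (simp_all add: Im_exp)
      ultimately show ?thesis by simp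
    qed
    moreover have "Re (CLINT x|\<nu>. ?h x) = - enn2real (\<integral>\<^sup>+s. (\<integral>\<^sup>+x. ennreal (1 - cos (w \<bullet> T s x)) \<partial>levy) \<partial>lborel)"
    proof -
      have "Re (CLINT x|\<nu>. ?h x) = (LINT x|\<nu>. - (1 - cos (w \<bullet> x)))"
        using ih by (subst integral_Re[symmetric]) (simp_all add: Re_exp)
      also have "\<dots> = - (LINT x|\<nu>. 1 - cos (w \<bullet> x))" by (rule integral_minus)
      also have "(LINT x|\<nu>. 1 - cos (w \<bullet> x)) = enn2real (\<integral>\<^sup>+x. ennreal (1 - cos (w \<bullet> x)) \<partial>\<nu>)"
        by (rule integral_eq_nn_integral) (auto simp: meas\<nu>)
      also have "(\<integral>\<^sup>+x. ennreal (1 - cos (w \<bullet> x)) \<partial>\<nu>) = (\<integral>\<^sup>+s. (\<integral>\<^sup>+x. ennreal (1 - cos (w \<bullet> T s x)) \<partial>levy) \<partial>lborel)"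
        by (rule nn') auto
      finally show ?thesis .
    qed
    ultimately have "(CLINT x|\<nu>. ?h x) = of_real (- enn2real (\<integral>\<^sup>+s. (\<integral>\<^sup>+x. ennreal (1 - cos (w \<bullet> T s x)) \<partial>levy) \<partial>lborel))"
      by (simp only: complex_eq_iff Re_complex_of_real Im_complex_of_real)
    then show "char_fun \<mu> w = exp (\<i> * of_real (w \<bullet> 0) - of_real (w \<bullet> 0) / 2 + (CLINT x|\<nu>. ?h x))"
      unfolding char by simp
  qed simp_all
  with id \<sigma>' p show ?thesis unfolding tempered_stable_def \<nu>_def by blast
qed

end

section \<open>Real parts and joint laws of several integrals\<close>

definition first_half :: "real^('d + 'd) \<Rightarrow> real^'d" where
  "first_half x = (\<chi> i. x $ Inl i)"

text \<open>The adjoint of \<open>first_half\<close>: testing the real part against \<open>v\<close>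
  amounts to testing the full integral against the embedded vector.\<close>

definition embed_first :: "real^'d \<Rightarrow> real^('d + 'd)" where
  "embed_first v = (\<chi> k. case k of Inl i \<Rightarrow> v $ i | Inr i \<Rightarrow> 0)"

lemma sum_UNIV_Plus:
  fixes f :: "'a::finite + 'b::finite \<Rightarrow> 'c::comm_monoid_add"
  shows "(\<Sum>k\<in>UNIV. f k) = (\<Sum>i\<in>UNIV. f (Inl i)) + (\<Sum>i\<in>UNIV. f (Inr i))"
  unfolding UNIV_Plus_UNIV[symmetric] by (subst sum.Plus) auto

lemma inner_first_half: "v \<bullet> first_half x = embed_first v \<bullet> x"
  by (simp add: inner_vec_def first_half_def embed_first_def sum_UNIV_Plus)

lemma norm_first_half_le: "norm (first_half x) \<le> norm x"
proof -
  have "(\<Sum>i\<in>UNIV. (first_half x $ i)\<^sup>2) \<le> (\<Sum>k\<in>UNIV. (x $ k)\<^sup>2)"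
    by (simp add: sum_UNIV_Plus first_half_def sum_nonneg)
  then show ?thesis by (simp add: norm_vec_def L2_set_def)
qed

lemma first_half_linear:
  "first_half (x + y) = first_half x + first_half y"
  "first_half (x - y) = first_half x - first_half y"
  "first_half (c *\<^sub>R x) = c *\<^sub>R first_half x"
  by (simp_all add: first_half_def vec_eq_iff)

lemma first_half_measurable [measurable]: "first_half \<in> borel_measurable borel"
  unfolding first_half_def[abs_def] by (intro borel_measurable_continuous_onI continuous_intros)

lemma norm_vec_le_sum: "norm (x :: 'a::real_normed_vector^'n) \<le> (\<Sum>i\<in>UNIV. norm (x $ i))"
  unfolding norm_vec_def by (rule L2_set_le_sum) auto

lemma continuous_on_axis:
  fixes g :: "'b::topological_space \<Rightarrow> 'a::{topological_space, zero}"
  assumes "continuous_on S g"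
  shows "continuous_on S (\<lambda>x. axis j (g x) :: 'a^'n)"
  unfolding axis_def
proof (rule continuous_on_vec_lambda)
  show "continuous_on S (\<lambda>x. if i = j then g x else 0)" for i
    using assms by (cases "i = j") auto
qed

lemma integral_lborel_scale:
  fixes f :: "'a::euclidean_space \<Rightarrow> real"
  assumes [measurable]: "f \<in> borel_measurable borel" and "c > 0"
  shows "(LINT x|lborel. f (c *\<^sub>R x)) = (LINT x|lborel. f x) / c ^ DIM('a)"
    and "integrable lborel f \<Longrightarrow> integrable lborel (\<lambda>x. f (c *\<^sub>R x))"
proof -
  have eq: "lborel = density (distr lborel borel (\<lambda>x. 0 + c *\<^sub>R x :: 'a)) (\<lambda>_. ennreal (c ^ DIM('a)))"
    using lborel_affine[of c "0::'a"] assms(2) by simp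
  have "(LINT x|lborel. f x) = (LINT x|density (distr lborel borel (\<lambda>x. 0 + c *\<^sub>R x :: 'a)) (\<lambda>_. ennreal (c ^ DIM('a))). f x)"
    by (rule arg_cong[OF eq, of "\<lambda>K. LINT x|K. f x"])
  also have "\<dots> = c ^ DIM('a) * (LINT x|lborel. f (c *\<^sub>R x))"
    using assms(2) by (subst integral_density) (auto simp: integral_distr)
  finally show "(LINT x|lborel. f (c *\<^sub>R x)) = (LINT x|lborel. f x) / c ^ DIM('a)"
    using assms(2) by simp
  assume "integrable lborel f"
  then have "integrable (density (distr lborel borel (\<lambda>x. 0 + c *\<^sub>R x :: 'a)) (\<lambda>_. ennreal (c ^ DIM('a)))) f"
    by (subst eq[symmetric])
  then have "integrable (distr lborel borel (\<lambda>x. 0 + c *\<^sub>R x :: 'a)) (\<lambda>x. c ^ DIM('a) * f x)"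
    using assms(2) by (subst (asm) integrable_density) auto
  then have "integrable lborel (\<lambda>x. c ^ DIM('a) * f (c *\<^sub>R x))"
    by (subst (asm) integrable_distr_eq) auto
  then show "integrable lborel (\<lambda>x. f (c *\<^sub>R x))" using assms(2) by simp
qed

context exponential_tempering
begin

lemma levy_exponent: "levy_exponent \<alpha> exponent"
proof
  show "\<exists>C>0. \<forall>w. exponent w \<le> C * truncated_power \<alpha> (norm w)" using exponent_bound by metis
  show "exponent (- w) = exponent w" for w unfolding exponent_eq by simp
qed (use alpha exponent_continuous exponent_nonneg exponent_0 exponent_add in auto)

end

locale tempered_scattered = exponential_tempering \<alpha> l \<sigma>
  for \<alpha> l :: real and \<sigma> :: "(real^('d::finite + 'd)) measure" +
  fixes P :: "'w measure" and M :: "(real^'n) set \<Rightarrow> 'w \<Rightarrow> real^('d + 'd)"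
  assumes sym: "symmetric_measure \<sigma>" and indep: "indep_scattered P M (exp_tempered_psi \<alpha> l \<sigma>)"
begin

sublocale sc: scattered_measure \<alpha> exponent P M
proof (intro scattered_measure.intro levy_exponent scattered_measure_axioms.intro)
  show "indep_scattered P M (\<lambda>w. - exponent w)"
    using indep by (simp add: exponent_def)
qed

context
  fixes f :: "'k::finite \<Rightarrow> real^'n \<Rightarrow> real^('d + 'd)^('d + 'd)" and X :: "'k \<Rightarrow> 'w \<Rightarrow> real^('d + 'd)"
  assumes X: "\<And>j. has_stoch_integral P M (f j) (X j)"
begin

lemma integral_measurable [measurable]: "X j \<in> borel_measurable P"
  and integrand_measurable [measurable]: "f j \<in> borel_measurable borel"
  using X by (auto simp: has_stoch_integral_def)

lemma stacked_measurable [measurable]: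
  "(\<lambda>\<omega>. (\<chi> j. first_half (X j \<omega>)) :: real^'d^'k) \<in> borel_measurable P"
proof -
  have "(\<lambda>\<omega>. (\<chi> j. first_half (X j \<omega>)) :: real^'d^'k) =
      (\<lambda>\<omega>. \<Sum>j\<in>UNIV. axis j (first_half (X j \<omega>)))"
    by (auto simp: vec_eq_iff axis_def fun_eq_iff if_distrib[of "\<lambda>v. v $ _"] cong: if_cong)
  moreover have "(\<lambda>v. axis j v :: real^'d^'k) \<in> borel_measurable borel" for j
    by (intro borel_measurable_continuous_onI continuous_on_axis continuous_on_id)
  ultimately show ?thesis by simp
qed

lemma char_stacked:
  "char_fun (distr P borel (\<lambda>\<omega>. (\<chi> j. first_half (X j \<omega>)) :: real^'d^'k)) w =
    exp (of_real (- (LINT s|lborel. exponent (\<Sum>j\<in>UNIV. transpose (f j s) *v embed_first (w $ j)))))"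
proof -
  have "w \<bullet> (\<chi> j. first_half (X j \<omega>)) = (\<Sum>j\<in>UNIV. embed_first (w $ j) \<bullet> X j \<omega>)" for \<omega>
    by (simp add: inner_vec_def[of w] inner_first_half)
  then show ?thesis
    using sc.char_stoch_integral(2)[OF X, of "\<lambda>j. embed_first (w $ j)"]
    by (simp add: char_fun_def integral_distr del: of_real_sum)
qed

lemma borel_prob_stacked: "borel_prob (distr P borel (\<lambda>\<omega>. (\<chi> j. first_half (X j \<omega>)) :: real^'d^'k))"
  unfolding borel_prob_def by (simp add: sc.prob_space_distr)

end

text \<open>An \<open>n\<close>-th root of the law is obtained by a change of variables: replacing \<open>f s\<close> by
  \<open>f (c s)\<close> divides the logarithm of the characteristic function by \<open>c\<close> to the power of the dimension.\<close>

lemma infinitely_divisible_stacked: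
  fixes f :: "'k::finite \<Rightarrow> real^'n \<Rightarrow> real^('d + 'd)^('d + 'd)"
  assumes X: "\<And>j. has_stoch_integral P M (f j) (X j)"
    and int: "\<And>j. integrable lborel (\<lambda>s. truncated_power \<alpha> (norm (f j s)))"
  shows "infinitely_divisible (distr P borel (\<lambda>\<omega>. (\<chi> j. first_half (X j \<omega>)) :: real^'d^'k))"
  unfolding infinitely_divisible_def
proof (intro conjI allI impI borel_prob_stacked[OF X])
  fix n :: nat assume "n > 0"
  \<comment> \<open>Chosen so that dilation by \<open>c\<close> multiplies volumes by
    \<open>n\<close>.\<close>
  define c where "c = root DIM(real^'n) (real n)"
  have dim: "DIM(real^'n) > 0" by simp
  have c: "c > 0" using \<open>n > 0\<close> dim unfolding c_def by (intro real_root_gt_zero) auto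
  have cn: "c ^ DIM(real^'n) = real n" using dim unfolding c_def by (intro real_root_pow_pos2) auto
  note [measurable] = integrand_measurable[of f X, OF X]
  have sc_meas: "(\<lambda>s. f j (c *\<^sub>R s)) \<in> borel_measurable borel" for j by measurable
  have "\<exists>X'. has_stoch_integral P M (\<lambda>s. f j (c *\<^sub>R s)) X'" for j
    using integral_lborel_scale(2)[OF _ c, of "\<lambda>s. truncated_power \<alpha> (norm (f j s))"] int
    by (intro sc.has_stoch_integral_exists sc_meas) auto
  then obtain X' where X': "\<And>j. has_stoch_integral P M (\<lambda>s. f j (c *\<^sub>R s)) (X' j)" by metis
  show "\<exists>\<nu>. borel_prob \<nu> \<and> (\<forall>w. char_fun (distr P borel (\<lambda>\<omega>. (\<chi> j. first_half (X j \<omega>)) :: real^'d^'k)) w = char_fun \<nu> w ^ n)"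
  proof (intro exI conjI allI)
    show "borel_prob (distr P borel (\<lambda>\<omega>. (\<chi> j. first_half (X' j \<omega>)) :: real^'d^'k))"
      by (rule borel_prob_stacked[OF X'])
    fix w :: "real^'d^'k"
    let ?u = "\<lambda>s. \<Sum>j\<in>UNIV. transpose (f j s) *v embed_first (w $ j)"
    note [measurable] = transpose_mult_vec_measurable
    have "?u \<in> borel_measurable borel" by measurable
    then have "(\<lambda>s. exponent (?u s)) \<in> borel_measurable borel" by measurable
    from integral_lborel_scale(1)[OF this c]
    have i: "(LINT s|lborel. exponent (?u (c *\<^sub>R s))) = (LINT s|lborel. exponent (?u s)) / real n"
      unfolding cn .
    have "char_fun (distr P borel (\<lambda>\<omega>. (\<chi> j. first_half (X' j \<omega>)) :: real^'d^'k)) w ^ n =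
        exp (of_nat n * of_real (- ((LINT s|lborel. exponent (?u s)) / real n)))"
      unfolding char_stacked[OF X'] i by (rule exp_of_nat_mult[symmetric])
    also have "of_nat n * of_real (- ((LINT s|lborel. exponent (?u s)) / real n)) = complex_of_real (- (LINT s|lborel. exponent (?u s)))"
      using \<open>n > 0\<close> by simp
    finally show "char_fun (distr P borel (\<lambda>\<omega>. (\<chi> j. first_half (X j \<omega>)) :: real^'d^'k)) w =
        char_fun (distr P borel (\<lambda>\<omega>. (\<chi> j. first_half (X' j \<omega>)) :: real^'d^'k)) w ^ n"
      unfolding char_stacked[OF X] by simp
  qed
qed

text \<open>A vector of integrals corresponds to a single map that stacks
  \<open>first_half (f j s *v x)\<close> over \<open>j\<close>, with the sum of the norms as its
  bound. Joint laws therefore need no argument beyond the one for a single image of the Levy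
  measure.\<close>

theorem tempered_stable_stacked:
  fixes f :: "'k::finite \<Rightarrow> real^'n \<Rightarrow> real^('d + 'd)^('d + 'd)"
  assumes X: "\<And>j. has_stoch_integral P M (f j) (X j)"
    and int: "\<And>j. integrable lborel (\<lambda>s. truncated_power \<alpha> (norm (f j s)))"
  shows "tempered_stable \<alpha> (distr P borel (\<lambda>\<omega>. (\<chi> j. first_half (X j \<omega>)) :: real^'d^'k))"
proof (rule tempered_stable_image[where T="\<lambda>s x. (\<chi> j. first_half (f j s *v x)) :: real^'d^'k"
      and \<tau>="\<lambda>s. \<Sum>j\<in>UNIV. norm (f j s)"])
  note [measurable] = integrand_measurable[of f X, OF X]
  show "(\<lambda>(s, x). (\<chi> j. first_half (f j s *v x)) :: real^'d^'k) \<in> borel_measurable (borel \<Otimes>\<^sub>M borel)"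
  proof -
    have c: "continuous_on UNIV (\<lambda>z :: (real^('d + 'd)^('d + 'd)) \<times> (real^('d + 'd)). axis j (first_half (fst z *v snd z)) :: real^'d^'k)" for j
      unfolding first_half_def matrix_vector_mult_def
      by (intro continuous_on_axis) (auto intro!: continuous_intros)
    have m: "(\<lambda>z :: (real^'n) \<times> (real^('d + 'd)). axis j (first_half (f j (fst z) *v snd z)) :: real^'d^'k) \<in> borel_measurable (borel \<Otimes>\<^sub>M borel)" for j
    proof -
      have "(\<lambda>z. (f j (fst z), snd z)) \<in> measurable ((borel :: (real^'n) measure) \<Otimes>\<^sub>M (borel :: (real^('d + 'd)) measure)) borel"
        unfolding borel_prod[symmetric] by measurable
      from measurable_compose[OF this borel_measurable_continuous_onI[OF c]] show ?thesis by simp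
    qed
    have "(\<lambda>(s, x). (\<chi> j. first_half (f j s *v x)) :: real^'d^'k) =
        (\<lambda>z. \<Sum>j\<in>UNIV. axis j (first_half (f j (fst z) *v snd z)))"
      by (auto simp: vec_eq_iff axis_def fun_eq_iff if_distrib[of "\<lambda>v. v $ _"] cong: if_cong)
    then show ?thesis using m by simp
  qed
  show "(\<chi> j. first_half (f j s *v (c *\<^sub>R x))) = c *\<^sub>R (\<chi> j. first_half (f j s *v x))" for s c x
    by (simp add: vec_eq_iff matrix_vector_mult_scaleR first_half_linear)
  show "norm ((\<chi> j. first_half (f j s *v x)) :: real^'d^'k) \<le> (\<Sum>j\<in>UNIV. norm (f j s)) * norm x" for s x
  proof -
    have "norm ((\<chi> j. first_half (f j s *v x)) :: real^'d^'k) \<le> (\<Sum>j\<in>UNIV. norm (first_half (f j s *v x)))"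
      using norm_vec_le_sum[of "(\<chi> j. first_half (f j s *v x)) :: real^'d^'k"] by simp
    also have "\<dots> \<le> (\<Sum>j\<in>UNIV. norm (f j s) * norm x)"
      by (intro sum_mono order_trans[OF norm_first_half_le] norm_matrix_vector_mult_le)
    finally show ?thesis by (simp add: sum_distrib_right)
  qed
  show "0 \<le> (\<Sum>j\<in>UNIV. norm (f j s))" for s by (intro sum_nonneg) simp
  show "integrable lborel (\<lambda>s. truncated_power \<alpha> (\<Sum>j\<in>UNIV. norm (f j s)))"
  proof (rule Bochner_Integration.integrable_bound)
    show "integrable lborel (\<lambda>s. 4 ^ CARD('k) * (\<Sum>j\<in>UNIV. truncated_power \<alpha> (norm (f j s))))"
      using int by (intro integrable_mult_right Bochner_Integration.integrable_sum)
    have "truncated_power \<alpha> (\<Sum>j\<in>UNIV. norm (f j s)) \<le> 4 ^ CARD('k) * (\<Sum>j\<in>UNIV. truncated_power \<alpha> (norm (f j s)))" for s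
      using alpha by (intro truncated_power_sum) auto
    then show "AE s in lborel. norm (truncated_power \<alpha> (\<Sum>j\<in>UNIV. norm (f j s))) \<le> norm (4 ^ CARD('k) * (\<Sum>j\<in>UNIV. truncated_power \<alpha> (norm (f j s))))"
      by (simp add: sum_nonneg)
  qed measurable
  show "infinitely_divisible (distr P borel (\<lambda>\<omega>. (\<chi> j. first_half (X j \<omega>)) :: real^'d^'k))"
    by (rule infinitely_divisible_stacked[OF X int])
  fix w :: "real^'d^'k"
  let ?u = "\<lambda>s. \<Sum>j\<in>UNIV. transpose (f j s) *v embed_first (w $ j)"
  have u: "w \<bullet> (\<chi> j. first_half (f j s *v x)) = ?u s \<bullet> x" for s x
    by (simp add: inner_vec_def[of w] inner_first_half inner_sum_left dot_lmul_matrix transpose_matrix_vector)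
  note [measurable] = transpose_mult_vec_measurable
  have "?u \<in> borel_measurable borel" by measurable
  then have "(\<lambda>s. exponent (?u s)) \<in> borel_measurable borel" by measurable
  then have "(LINT s|lborel. exponent (?u s)) = enn2real (\<integral>\<^sup>+s. ennreal (exponent (?u s)) \<partial>lborel)"
    by (intro integral_eq_nn_integral) (auto simp: exponent_nonneg)
  also have "(\<integral>\<^sup>+s. ennreal (exponent (?u s)) \<partial>lborel) =
      (\<integral>\<^sup>+s. (\<integral>\<^sup>+x. ennreal (1 - cos (w \<bullet> (\<chi> j. first_half (f j s *v x)))) \<partial>levy) \<partial>lborel)"
    unfolding u exponent_nn ..
  finally show "char_fun (distr P borel (\<lambda>\<omega>. (\<chi> j. first_half (X j \<omega>)) :: real^'d^'k)) w =
      exp (of_real (- enn2real (\<integral>\<^sup>+s. (\<integral>\<^sup>+x. ennreal (1 - cos (w \<bullet> (\<chi> j. first_half (f j s *v x)))) \<partial>levy) \<partial>lborel)))"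
    unfolding char_stacked[OF X] by simp
qed (rule sym)

end

section \<open>Homogeneous weights\<close>

lemma eigenvalues_uminus: "z \<in> eigenvalues (- A) \<Longrightarrow> - z \<in> eigenvalues A"
proof -
  have "cmat (- A) *v v = - (cmat A *v v)" for v
    by (simp add: vec_eq_iff matrix_vector_mult_def sum_negf)
  then show "z \<in> eigenvalues (- A) \<Longrightarrow> - z \<in> eigenvalues A"
    by (auto simp: eigenvalues_def) (metis minus_minus vec.scale_minus_left)
qed

lemma eigenvalues_affine:
  assumes "z \<in> eigenvalues (- A - c *\<^sub>R mat 1)"
  shows "- z - of_real c \<in> eigenvalues A"
proof -
  have entry: "cmat (- A - c *\<^sub>R mat 1) $ i $ j * x = - (of_real (A $ i $ j) * x) - (if i = j then of_real c * x else 0)"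
    for i j and x :: complex
    by (auto simp: mat_def algebra_simps)
  have *: "cmat (- A - c *\<^sub>R mat 1) *v v = - (cmat A *v v) - of_real c *s v" for v
    unfolding vec_eq_iff matrix_vector_mult_def vec_lambda_beta entry
    by (simp add: sum_negf sum_subtractf)
  from assms obtain v where v: "v \<noteq> 0" "- (cmat A *v v) - of_real c *s v = z *s v"
    unfolding eigenvalues_def * by blast
  then have "cmat A *v v = (- z - of_real c) *s v"
    by (simp add: vec_eq_iff algebra_simps) (metis add.commute add_diff_cancel_right' diff_eq_eq minus_diff_eq)
  with v(1) show ?thesis by (auto simp: eigenvalues_def)
qed

lemma mat_powr_bound_large:
  assumes "\<And>z. z \<in> eigenvalues A \<Longrightarrow> Re z < b"
  obtains C where "C > 0" "\<And>c. 1 \<le> c \<Longrightarrow> norm (mat_powr c A) \<le> C * c powr b"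
proof -
  obtain C where C: "C > 0" "\<And>t. 0 \<le> t \<Longrightarrow> norm (mat_exp (t *\<^sub>R A)) \<le> C * exp (b * t)"
    using mat_exp_growth[of A b] assms by blast
  have "norm (mat_powr c A) \<le> C * c powr b" if "1 \<le> c" for c
    using C(2)[of "ln c"] that by (simp add: mat_powr_def powr_def)
  with C show thesis using that by blast
qed

text \<open>For \<open>c \<le> 1\<close> the logarithm is nonpositive, so this is growth in positive
  time for \<open>- A\<close>.\<close>

lemma mat_powr_bound_small:
  assumes "\<And>z. z \<in> eigenvalues A \<Longrightarrow> b < Re z"
  obtains C where "C > 0" "\<And>c. 0 < c \<Longrightarrow> c \<le> 1 \<Longrightarrow> norm (mat_powr c A) \<le> C * c powr b"
proof -
  have "Re z < - b" if "z \<in> eigenvalues (- A)" for z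
    using assms[OF eigenvalues_uminus[OF that]] by simp
  from mat_exp_growth[of "- A", OF this] obtain C where
    C: "C > 0" "\<And>t. 0 \<le> t \<Longrightarrow> norm (mat_exp (t *\<^sub>R (- A))) \<le> C * exp (- b * t)" by blast
  have "norm (mat_powr c A) \<le> C * c powr b" if "0 < c" "c \<le> 1" for c
    using C(2)[of "- ln c"] that by (simp add: mat_powr_def powr_def)
  with C show thesis using that by blast
qed

lemma norm_transpose: "norm (transpose A) = norm (A :: real^'n^'m)"
proof -
  have "(\<Sum>i\<in>UNIV. \<Sum>j\<in>UNIV. (A $ j $ i)\<^sup>2) = (\<Sum>i\<in>UNIV. \<Sum>j\<in>UNIV. (A $ i $ j)\<^sup>2)"
    by (rule sum.swap)
  then show ?thesis
    by (simp add: norm_vec_def L2_set_def transpose_def sum_nonneg)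
qed

text \<open>The library states the scaling of Lebesgue measure under linear maps only for well-ordered
  index types.\<close>

lemma measure_linear_image_cart:
  fixes f :: "real^'n \<Rightarrow> real^'n"
  assumes "linear f" "det (matrix f) \<noteq> 0" "S \<in> lmeasurable"
  shows "f ` S \<in> lmeasurable \<and> measure lebesgue (f ` S) = \<bar>det (matrix f)\<bar> * measure lebesgue S"
proof -
  define scales where "scales = (\<lambda>f :: real^'n \<Rightarrow> real^'n. \<forall>S\<in>lmeasurable.
    f ` S \<in> lmeasurable \<and> measure lebesgue (f ` S) = \<bar>det (matrix f)\<bar> * measure lebesgue S)"
  have sufficient: "scales f"
    if "linear f" and "\<And>a b. cbox a b \<noteq> {} \<Longrightarrow> measure lebesgue (f ` cbox a b) = measure lebesgue (cbox a b)"
      and "\<bar>det (matrix f)\<bar> = 1" for f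
  proof -
    have boxes: "measure lebesgue (f ` cbox a b) = 1 * measure lebesgue (cbox a b)" for a b
      using that(2)[of a b] by (cases "cbox a b = {}") auto
    show ?thesis
      unfolding scales_def that(3)
    proof
      fix S :: "(real^'n) set" assume "S \<in> lmeasurable"
      from measure_linear_sufficient[OF \<open>linear f\<close> this boxes]
      show "f ` S \<in> lmeasurable \<and> measure lebesgue (f ` S) = 1 * measure lebesgue S" by auto
    qed
  qed
  \<comment> \<open>Induction over elementary maps. The condition on the determinant passes to both
    factors of a composition and makes the case of a vanishing row void.\<close>
  have "det (matrix f) \<noteq> 0 \<longrightarrow> scales f"
  proof (rule induct_linear_elementary[OF \<open>linear f\<close>])
    fix f g :: "real^'n \<Rightarrow> real^'n"
    assume lin: "linear f" "linear g"
      and IH: "det (matrix f) \<noteq> 0 \<longrightarrow> scales f" "det (matrix g) \<noteq> 0 \<longrightarrow> scales g"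
    have "det (matrix (f \<circ> g)) = det (matrix f) * det (matrix g)"
      using lin by (simp add: matrix_compose det_mul)
    moreover have "(f \<circ> g) ` S = f ` (g ` S)" for S by (simp add: image_comp)
    ultimately show "det (matrix (f \<circ> g)) \<noteq> 0 \<longrightarrow> scales (f \<circ> g)"
      using IH unfolding scales_def by (simp only:) (simp add: abs_mult)
  next
    fix f :: "real^'n \<Rightarrow> real^'n" and i
    assume "\<And>x. f x $ i = 0"
    then have "row i (matrix f) = 0" by (simp add: row_def matrix_def vec_eq_iff)
    then show "det (matrix f) \<noteq> 0 \<longrightarrow> scales f" using det_zero_row(2) by blast
  next
    fix c :: "'n \<Rightarrow> real"
    have "det (matrix (\<lambda>x :: real^'n. \<chi> i. c i * x $ i)) = prod c UNIV"
      by (subst det_diagonal) (auto simp: matrix_def axis_def)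
    then show "det (matrix (\<lambda>x. \<chi> i. c i * x $ i)) \<noteq> 0 \<longrightarrow> scales (\<lambda>x. \<chi> i. c i * x $ i)"
      by (simp add: scales_def measurable_stretch measure_stretch)
  next
    fix m n :: 'n assume "m \<noteq> n"
    let ?p = "Transposition.transpose m n"
    let ?h = "\<lambda>x :: real^'n. \<chi> i. x $ ?p i"
    have "matrix ?h = (\<chi> i j. mat 1 $ i $ ?p j)"
    proof -
      have "(?p i = j) = (i = ?p j)" for i j by (auto simp: Transposition.transpose_def)
      then show ?thesis unfolding matrix_def vec_eq_iff axis_def mat_def by simp
    qed
    then have "\<bar>det (matrix ?h)\<bar> = 1"
      by (simp add: det_permute_columns[OF permutes_swap_id] abs_mult sign_def)
    moreover have "measure lebesgue (?h ` cbox a b) = measure lebesgue (cbox a b)" if "cbox a b \<noteq> {}" for a b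
    proof -
      have inv: "?h (?h x) = x" for x by (simp add: vec_eq_iff)
      have sub: "?h ` cbox a b \<subseteq> cbox (?h a) (?h b)" for a b by (auto simp: mem_box_cart)
      have im: "?h ` cbox a b = cbox (?h a) (?h b)"
      proof
        have "?h ` (?h ` cbox (?h a) (?h b)) \<subseteq> ?h ` cbox (?h (?h a)) (?h (?h b))"
          by (intro image_mono sub)
        then show "cbox (?h a) (?h b) \<subseteq> ?h ` cbox a b" unfolding inv image_image by simp
      qed (rule sub)
      have "cbox (?h a) (?h b) \<noteq> {}" using that im by blast
      then show ?thesis
        unfolding im using that prod.permute[OF permutes_swap_id, of m UNIV n "\<lambda>i. b $ i - a $ i"]
        by (simp add: content_cbox_cart comp_def)
    qed
    moreover have "linear ?h" by (rule linearI) (auto simp: vec_eq_iff)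
    ultimately show "det (matrix ?h) \<noteq> 0 \<longrightarrow> scales ?h" using sufficient by blast
  next
    fix m n :: 'n assume "m \<noteq> n"
    let ?h = "\<lambda>x :: real^'n. \<chi> i. if i = m then x $ m + x $ n else x $ i"
    have "matrix ?h = (\<chi> i. if i = m then row m (mat 1) + 1 *s row n (mat 1) else row i (mat 1))"
      by (auto simp: matrix_def vec_eq_iff axis_def row_def mat_def)
    then have "det (matrix ?h) = 1"
      using det_row_operation[OF \<open>m \<noteq> n\<close>, of "mat 1" 1] by simp
    moreover have lin: "linear ?h" by (rule linearI) (auto simp: vec_eq_iff algebra_simps)
    moreover have "measure lebesgue (?h ` cbox a b) = measure lebesgue (cbox a b)" if "cbox a b \<noteq> {}" for a b
    proof -
      \<comment> \<open>This translation moves the lower bound of the coordinate \<open>n\<close> to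
        0, since the volume of a sheared box is available when that bound is nonnegative. By
        linearity the image is merely translated as well.\<close>
      define v :: "real^'n" where "v = - axis n (a $ n)"
      have ne: "cbox (v + a) (v + b) \<noteq> {}" using that by (simp add: cbox_translation)
      have "?h ` cbox (v + a) (v + b) = (+) (?h v) ` ?h ` cbox a b"
        unfolding cbox_translation image_image by (simp only: linear_add[OF lin])
      then have "measure lebesgue (?h ` cbox a b) = measure lebesgue (?h ` cbox (v + a) (v + b))"
        by (simp only: measure_translation)
      also have "\<dots> = measure lebesgue (cbox (v + a) (v + b))"
        using \<open>m \<noteq> n\<close> ne by (intro measure_shear_interval) (auto simp: v_def)
      also have "\<dots> = measure lebesgue (cbox a b)"
        unfolding cbox_translation by (rule measure_translation)
      finally show ?thesis .
    qed
    ultimately show "det (matrix ?h) \<noteq> 0 \<longrightarrow> scales ?h" using sufficient by simp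
  qed
  then show ?thesis using assms by (simp add: scales_def)
qed

lemma mat_exp_cancel: "mat_exp (t *\<^sub>R A) *v (mat_exp (- t *\<^sub>R A) *v x) = x"
  by (simp only: matrix_vector_mul_assoc mat_exp_minus matrix_vector_mul_lid)

lemma suminf_geometric_finite:
  fixes r :: real
  assumes "r < 0" "c \<ge> 0"
  shows "(\<Sum>j. ennreal (c * 2 powr (real j * r))) < \<infinity>"
proof -
  have "2 powr r < 1" using assms powr_less_mono[of r 0 2] by simp
  then have "summable (\<lambda>j. c * (2 powr r) ^ j)" by (intro summable_mult summable_geometric) simp
  moreover have "2 powr (real j * r) = (2 powr r) ^ j" for j
    by (simp add: powr_powr[symmetric] powr_realpow[symmetric] mult.commute)
  ultimately have "(\<Sum>j. ennreal (c * 2 powr (real j * r))) \<noteq> top"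
    using assms by (intro ennreal_suminf_neq_top) auto
  then show ?thesis by (simp add: less_top)
qed

section \<open>Level sets and dyadic shells of a homogeneous weight\<close>

locale homogeneous_weight =
  fixes E :: "real^'n^'n" and \<phi> :: "real^'n \<Rightarrow> real"
  assumes Q: "Q_matrix E" and cont: "continuous_on UNIV \<phi>"
    and hom: "adjoint_homogeneous E \<phi>" and pos: "x \<noteq> 0 \<Longrightarrow> 0 < \<phi> x"
begin

lemma phi_measurable [measurable]: "\<phi> \<in> borel_measurable borel"
  using cont by (rule borel_measurable_continuous_onI)

lemma phi_mat_exp: "x \<noteq> 0 \<Longrightarrow> \<phi> (mat_exp (t *\<^sub>R transpose E) *v x) = exp t * \<phi> x"
  using hom[unfolded adjoint_homogeneous_def, rule_format, of "exp t" x] by (simp add: mat_powr_def)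

text \<open>A point of the level set outside the unit ball is carried back by the flow until it
  meets the unit sphere, at some time \<open>t \<le> 0\<close>. There \<phi> equals
  \<open>exp t\<close> and is at least its minimum \<open>m\<close> over the sphere, so
  \<open>t \<ge> ln m\<close>. Hence the point is reached from the sphere within a bounded
  time.\<close>

lemma level_set_bounded: obtains R where "R > 0" "\<And>x. x \<noteq> 0 \<Longrightarrow> \<phi> x = 1 \<Longrightarrow> norm x \<le> R"
proof -
  let ?E = "transpose E"
  \<comment> \<open>Halving keeps \<open>a\<close> strictly below all real parts; inserting 1 keeps
    the set nonempty in every case.\<close>
  define a where "a = Min (insert 1 (Re ` eigenvalues E)) / 2"
  have fin: "finite (Re ` eigenvalues E)" using finite_eigenvalues by blast
  have a: "a > 0" using fin Q by (auto simp: a_def Q_matrix_def)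
  have "a < Re z" if "z \<in> eigenvalues E" for z
  proof -
    have "2 * a \<le> Re z" unfolding a_def using fin that by simp
    with a show ?thesis by linarith
  qed
  then obtain C where C: "C > 0" "\<And>c. 0 < c \<Longrightarrow> c \<le> 1 \<Longrightarrow> norm (mat_powr c E) \<le> C * c powr a"
    using mat_powr_bound_small[of E a] by metis
  have Ct: "norm (mat_exp (t *\<^sub>R ?E)) \<le> C * exp (a * t)" if "t \<le> 0" for t
  proof -
    have "norm (mat_exp (t *\<^sub>R ?E)) = norm (mat_powr (exp t) E)"
      by (simp add: mat_exp_transpose norm_transpose mat_powr_def)
    also have "\<dots> \<le> C * exp t powr a" using that by (intro C) auto
    finally show ?thesis by (simp add: powr_def)
  qed
  have "compact (sphere (0 :: real^'n) 1)" "sphere (0 :: real^'n) 1 \<noteq> {}" by auto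
  then obtain u0 where u0: "u0 \<in> sphere 0 1" "\<And>u. u \<in> sphere 0 1 \<Longrightarrow> \<phi> u0 \<le> \<phi> u"
    using continuous_attains_inf[of "sphere 0 1" \<phi>] continuous_on_subset[OF cont] by (metis subset_UNIV)
  define m where "m = \<phi> u0"
  have m: "m > 0" using u0(1) pos[of u0] by (force simp: m_def)
  have "compact ((\<lambda>t. mat_exp (t *\<^sub>R ?E)) ` {0..\<bar>ln m\<bar>})"
    by (intro compact_continuous_image continuous_on_subset[OF continuous_mat_exp]) auto
  then have "bounded ((\<lambda>t. mat_exp (t *\<^sub>R ?E)) ` {0..\<bar>ln m\<bar>})" by (rule compact_imp_bounded)
  then obtain R0 where R0: "\<And>t. t \<in> {0..\<bar>ln m\<bar>} \<Longrightarrow> norm (mat_exp (t *\<^sub>R ?E)) \<le> R0"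
    unfolding bounded_iff by blast
  have "norm x \<le> max 1 R0" if x: "x \<noteq> 0" "\<phi> x = 1" for x
  proof (cases "norm x \<le> 1")
    case False
    define f where "f = (\<lambda>t. norm (mat_exp (t *\<^sub>R ?E) *v x))"
    have "continuous_on UNIV f"
      unfolding f_def matrix_vector_mult_def by (intro continuous_intros continuous_mat_exp)
    then have contf: "continuous_on A f" for A by (rule continuous_on_subset) simp
    have "((\<lambda>t. C * exp (a * t) * norm x) \<longlongrightarrow> 0) at_bot"
    proof -
      have "filterlim (\<lambda>t. a * t) at_bot at_bot"
        using a by (intro filterlim_tendsto_pos_mult_at_bot[OF tendsto_const]) (auto intro: filterlim_ident)
      then have "((\<lambda>t. exp (a * t)) \<longlongrightarrow> 0) at_bot" by (rule filterlim_compose[OF exp_at_bot])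
      from tendsto_mult_left_zero[OF tendsto_mult_right_zero[OF this]] show ?thesis .
    qed
    then have "eventually (\<lambda>t. C * exp (a * t) * norm x < 1) at_bot" by (rule order_tendstoD) simp
    moreover have "eventually (\<lambda>t::real. t \<le> 0) at_bot" by (rule eventually_le_at_bot)
    ultimately have "eventually (\<lambda>t. C * exp (a * t) * norm x < 1 \<and> t \<le> 0) at_bot" by (rule eventually_conj)
    then obtain t0 where t0: "C * exp (a * t0) * norm x < 1" "t0 \<le> 0"
      by (auto simp: eventually_at_bot_linorder)
    have "f t0 \<le> norm (mat_exp (t0 *\<^sub>R ?E)) * norm x" unfolding f_def by (rule norm_matrix_vector_mult_le)
    also have "\<dots> \<le> C * exp (a * t0) * norm x" using Ct[OF t0(2)] by (intro mult_right_mono) auto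
    finally have "f t0 \<le> 1" using t0 by simp
    moreover have "1 \<le> f 0" using False by (simp add: f_def)
    ultimately obtain t where t: "t0 \<le> t" "t \<le> 0" "f t = 1"
      using IVT'[of f t0 1 0] t0 contf by auto
    define u where "u = mat_exp (t *\<^sub>R ?E) *v x"
    have "u \<in> sphere 0 1" using t by (simp add: u_def f_def)
    then have "m \<le> \<phi> u" using u0 by (simp add: m_def)
    also have "\<dots> = exp t" using x by (simp add: u_def phi_mat_exp)
    finally have "ln m \<le> t" using m by (metis ln_exp ln_le_cancel_iff exp_gt_zero)
    then have "- t \<in> {0..\<bar>ln m\<bar>}" using t by auto
    have "x = mat_exp (- t *\<^sub>R ?E) *v u"
      using mat_exp_cancel[of "- t" ?E x] by (simp add: u_def)
    then have "norm x \<le> norm (mat_exp (- t *\<^sub>R ?E)) * norm u"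
      using norm_matrix_vector_mult_le[of "mat_exp (- t *\<^sub>R ?E)" u] by simp
    also have "\<dots> \<le> R0" using R0[OF \<open>- t \<in> {0..\<bar>ln m\<bar>}\<close>] \<open>u \<in> sphere 0 1\<close> by simp
    finally show ?thesis by simp
  qed simp
  then show thesis using that[of "max 1 R0"] by auto
qed

text \<open>Generalised polar coordinates: \<open>s\<close> is reached by the flow at time
  \<open>ln (\<phi> s)\<close> from a point \<open>y\<close> with \<open>\<phi> y = 1\<close>, and
  such points are bounded.\<close>

lemma norm_le_mat_powr:
  obtains R where "R > 0" "\<And>s. s \<noteq> 0 \<Longrightarrow> norm s \<le> R * norm (mat_powr (\<phi> s) E)"
proof -
  obtain R where R: "R > 0" "\<And>x. x \<noteq> 0 \<Longrightarrow> \<phi> x = 1 \<Longrightarrow> norm x \<le> R" using level_set_bounded by blast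
  have "norm s \<le> R * norm (mat_powr (\<phi> s) E)" if s: "s \<noteq> 0" for s
  proof -
    define t where "t = ln (\<phi> s)"
    have t: "exp t = \<phi> s" using pos[OF s] by (simp add: t_def)
    define y where "y = mat_exp (- t *\<^sub>R transpose E) *v s"
    have sy: "s = mat_exp (t *\<^sub>R transpose E) *v y" unfolding y_def by (rule mat_exp_cancel[symmetric])
    then have "y \<noteq> 0" using s by auto
    moreover have "\<phi> y = 1"
      unfolding y_def using phi_mat_exp[OF s, of "- t"] pos[OF s] by (simp add: exp_minus t)
    ultimately have "norm y \<le> R" by (rule R)
    have "norm s \<le> norm (mat_exp (t *\<^sub>R transpose E)) * norm y"
      using norm_matrix_vector_mult_le[of "mat_exp (t *\<^sub>R transpose E)" y] sy by simp
    also have "\<dots> \<le> norm (mat_powr (\<phi> s) E) * R"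
      using \<open>norm y \<le> R\<close> by (intro mult_mono) (auto simp: mat_exp_transpose norm_transpose mat_powr_def t_def)
    finally show ?thesis by (simp add: mult.commute)
  qed
  with R show thesis using that by blast
qed

definition shell :: "int \<Rightarrow> (real^'n) set" where
  "shell k = {s. s \<noteq> 0 \<and> 2 powr real_of_int k \<le> \<phi> s \<and> \<phi> s < 2 powr (real_of_int k + 1)}"

lemma shell_measurable [measurable]: "shell k \<in> sets borel"
  unfolding shell_def by measurable

text \<open>By homogeneity \<open>shell k\<close> is the image of \<open>shell 0\<close> under the
  flow at time \<open>k * ln 2\<close>, whose determinant is \<open>2 powr (k * trace E)\<close>.
  Boundedness of \<open>shell 0\<close> makes its volume \<open>V\<close> finite.\<close>

lemma emeasure_shell:
  obtains V where "V \<ge> 0" "\<And>k. emeasure lborel (shell k) = ennreal (2 powr (real_of_int k * trace E) * V)"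
proof -
  obtain R where R: "R > 0" "\<And>s. s \<noteq> 0 \<Longrightarrow> norm s \<le> R * norm (mat_powr (\<phi> s) E)"
    using norm_le_mat_powr by blast
  have "compact ((\<lambda>t. mat_exp (t *\<^sub>R E)) ` {0..ln 2})"
    by (intro compact_continuous_image continuous_on_subset[OF continuous_mat_exp]) auto
  then have "bounded ((\<lambda>t. mat_exp (t *\<^sub>R E)) ` {0..ln 2})" by (rule compact_imp_bounded)
  then obtain R0 where R0: "\<And>t. t \<in> {0..ln 2} \<Longrightarrow> norm (mat_exp (t *\<^sub>R E)) \<le> R0"
    unfolding bounded_iff by blast
  have "bounded (shell 0)"
    unfolding bounded_iff
  proof (intro exI[of _ "R * R0"] ballI)
    fix s assume "s \<in> shell 0"
    then have s: "s \<noteq> 0" "1 \<le> \<phi> s" "\<phi> s < 2" by (auto simp: shell_def)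
    then have "ln (\<phi> s) \<in> {0..ln 2}" by simp
    from R0[OF this] have "norm (mat_powr (\<phi> s) E) \<le> R0" by (simp add: mat_powr_def)
    then show "norm s \<le> R * R0" using R(2)[OF s(1)] R(1) by (meson mult_left_mono order_trans less_imp_le)
  qed
  then have lm: "shell 0 \<in> lmeasurable"
    by (intro bounded_set_imp_lmeasurable) auto
  define V where "V = measure lebesgue (shell 0)"
  have "emeasure lborel (shell k) = ennreal (2 powr (real_of_int k * trace E) * V)" for k
  proof -
    define t where "t = real_of_int k * ln 2"
    let ?A = "mat_exp (t *\<^sub>R transpose E)"
    have et: "exp t = 2 powr real_of_int k" by (simp add: t_def powr_def)
    have im: "shell k = ((*v) ?A) ` shell 0"
    proof (intro set_eqI iffI)
      fix s assume s: "s \<in> shell k"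
      define y where "y = mat_exp (- t *\<^sub>R transpose E) *v s"
      have sy: "s = ?A *v y" unfolding y_def by (rule mat_exp_cancel[symmetric])
      moreover have "s \<noteq> 0" using s by (simp add: shell_def)
      ultimately have "y \<noteq> 0" by auto
      moreover have "\<phi> y = \<phi> s / 2 powr real_of_int k"
        unfolding y_def using phi_mat_exp[OF \<open>s \<noteq> 0\<close>, of "- t"] by (simp add: exp_minus et divide_inverse mult.commute)
      then have "\<phi> s = 2 powr real_of_int k * \<phi> y" by simp
      ultimately have "y \<in> shell 0" using s by (simp add: shell_def powr_add)
      then show "s \<in> ((*v) ?A) ` shell 0" using sy by blast
    next
      fix s assume "s \<in> ((*v) ?A) ` shell 0"
      then obtain y where y: "y \<in> shell 0" "s = ?A *v y" by blast
      have "y = mat_exp (- t *\<^sub>R transpose E) *v s"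
        using mat_exp_cancel[of "- t" "transpose E" y] y(2) by simp
      then have "s \<noteq> 0" using y(1) by (auto simp: shell_def)
      moreover have "\<phi> s = 2 powr real_of_int k * \<phi> y"
        using y by (auto simp: shell_def phi_mat_exp et)
      ultimately show "s \<in> shell k" using y(1) by (auto simp: shell_def powr_add)
    qed
    have d: "det (matrix ((*v) ?A)) = 2 powr (real_of_int k * trace E)"
      by (simp add: mat_exp_transpose det_transpose det_mat_exp t_def powr_def mult_ac)
    have meas: "((*v) ?A) ` shell 0 \<in> lmeasurable \<and>
        measure lebesgue (((*v) ?A) ` shell 0) = \<bar>det (matrix ((*v) ?A))\<bar> * V"
      unfolding V_def by (rule measure_linear_image_cart[OF matrix_vector_mul_linear _ lm])
        (simp only: d, simp)
    have "emeasure lborel (shell k) = emeasure lebesgue (shell k)" by simp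
    also have "\<dots> = ennreal (measure lebesgue (shell k))"
      unfolding im using meas by (intro emeasure_eq_measure2) blast
    also have "measure lebesgue (shell k) = 2 powr (real_of_int k * trace E) * V"
      unfolding im using meas by (simp only: d abs_of_nonneg powr_ge_zero)
    finally show ?thesis .
  qed
  then show thesis using that[of V] by (simp add: V_def)
qed

lemma shell_cover: "s \<noteq> 0 \<Longrightarrow> \<exists>k. s \<in> shell k"
proof -
  assume s: "s \<noteq> 0"
  let ?k = "\<lfloor>log 2 (\<phi> s)\<rfloor>"
  have "2 powr real_of_int ?k \<le> 2 powr log 2 (\<phi> s)" by (intro powr_mono) auto
  moreover have "2 powr log 2 (\<phi> s) < 2 powr (real_of_int ?k + 1)" by (intro powr_less_mono) linarith+
  moreover have "2 powr log 2 (\<phi> s) = \<phi> s" using pos[OF s] by simp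
  ultimately have "s \<in> shell ?k" using s by (simp add: shell_def)
  then show ?thesis by blast
qed

lemma powr_le_on_shell:
  assumes "s \<in> shell k"
  shows "\<phi> s powr e \<le> 2 powr \<bar>e\<bar> * 2 powr (real_of_int k * e)"
proof (cases "e \<ge> 0")
  case True
  have "\<phi> s powr e \<le> (2 powr (real_of_int k + 1)) powr e"
    using assms True pos by (intro powr_mono2) (auto simp: shell_def intro: less_imp_le)
  also have "\<dots> = 2 powr \<bar>e\<bar> * 2 powr (real_of_int k * e)"
    using True by (simp add: powr_powr powr_add[symmetric] algebra_simps)
  finally show ?thesis .
next
  case False
  have "\<phi> s powr e \<le> (2 powr real_of_int k) powr e"
    using assms False by (intro powr_mono2') (auto simp: shell_def)
  also have "\<dots> \<le> 2 powr \<bar>e\<bar> * 2 powr (real_of_int k * e)"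
    using ge_one_powr_ge_zero[of 2 "\<bar>e\<bar>"] by (simp add: powr_powr mult_le_cancel_right1)
  finally show ?thesis .
qed

lemma nn_integral_shell_le:
  assumes "\<And>s. s \<in> shell k \<Longrightarrow> G s \<le> K * \<phi> s powr e" "K \<ge> 0" "G \<in> borel_measurable borel"
    and V: "emeasure lborel (shell k) = ennreal (2 powr (real_of_int k * q) * V)" "V \<ge> 0"
  shows "(\<integral>\<^sup>+s. ennreal (G s) * indicator (shell k) s \<partial>lborel) \<le>
    ennreal (K * 2 powr \<bar>e\<bar> * V * 2 powr (real_of_int k * (e + q)))"
proof -
  have "(\<integral>\<^sup>+s. ennreal (G s) * indicator (shell k) s \<partial>lborel) \<le>
      (\<integral>\<^sup>+s. ennreal (K * (2 powr \<bar>e\<bar> * 2 powr (real_of_int k * e))) * indicator (shell k) s \<partial>lborel)"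
  proof (rule nn_integral_mono)
    fix s
    show "ennreal (G s) * indicator (shell k) s \<le> ennreal (K * (2 powr \<bar>e\<bar> * 2 powr (real_of_int k * e))) * indicator (shell k) s"
      using assms(1)[of s] mult_left_mono[OF powr_le_on_shell[of s k e] assms(2)]
      by (auto simp: indicator_def intro!: ennreal_leI)
  qed
  also have "\<dots> = ennreal (K * (2 powr \<bar>e\<bar> * 2 powr (real_of_int k * e))) * ennreal (2 powr (real_of_int k * q) * V)"
    by (subst nn_integral_cmult) (auto simp: V)
  also have "\<dots> = ennreal (K * (2 powr \<bar>e\<bar> * 2 powr (real_of_int k * e)) * (2 powr (real_of_int k * q) * V))"
    using assms(2) V(2) by (intro ennreal_mult[symmetric]) auto
  also have "K * (2 powr \<bar>e\<bar> * 2 powr (real_of_int k * e)) * (2 powr (real_of_int k * q) * V) =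
      K * 2 powr \<bar>e\<bar> * V * 2 powr (real_of_int k * (e + q))"
    by (simp add: powr_add distrib_left mult_ac)
  finally show ?thesis .
qed

text \<open>The shells are summed in two directions. The ratios of the geometric series are
  \<open>2 powr (- (e1 + trace E))\<close> towards the origin and
  \<open>2 powr (e2 + trace E)\<close> towards infinity.\<close>

lemma integrable_power_weight:
  assumes G [measurable]: "G \<in> borel_measurable borel" and G0: "\<And>s. 0 \<le> G s"
    and K: "K \<ge> 0"
    and small: "\<And>s. s \<noteq> 0 \<Longrightarrow> \<phi> s \<le> 1 \<Longrightarrow> G s \<le> K * \<phi> s powr e1" and e1: "0 < e1 + trace E"
    and large: "\<And>s. s \<noteq> 0 \<Longrightarrow> 1 \<le> \<phi> s \<Longrightarrow> G s \<le> K * \<phi> s powr e2" and e2: "e2 + trace E < 0"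
  shows "integrable lborel G"
proof (rule integrableI_nonneg)
  obtain V where V: "V \<ge> 0" "\<And>k. emeasure lborel (shell k) = ennreal (2 powr (real_of_int k * trace E) * V)"
    using emeasure_shell by blast
  \<comment> \<open>The shift by one gives the first sequence exactly the shells of negative index,
    on which \<open>\<phi> s \<le> 1\<close>.\<close>
  let ?s1 = "\<lambda>j. shell (- int (Suc j))" and ?s2 = "\<lambda>j. shell (int j)"
  have b1: "(\<integral>\<^sup>+s. ennreal (G s) * indicator (?s1 j) s \<partial>lborel) \<le> ennreal (K * 2 powr \<bar>e1\<bar> * V * 2 powr (real j * - (e1 + trace E)))" for j
  proof -
    have "G s \<le> K * \<phi> s powr e1" if "s \<in> ?s1 j" for s
    proof (rule small)
      have "2 powr (real_of_int (- int (Suc j)) + 1) \<le> 2 powr (0::real)" by (intro powr_mono) auto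
      then show "\<phi> s \<le> 1" using that by (simp add: shell_def)
    qed (use that in \<open>simp add: shell_def\<close>)
    from nn_integral_shell_le[of "- int (Suc j)" G K e1 "trace E" V, OF this K G V(2) V(1)]
    have "(\<integral>\<^sup>+s. ennreal (G s) * indicator (?s1 j) s \<partial>lborel) \<le>
        ennreal (K * 2 powr \<bar>e1\<bar> * V * 2 powr (real_of_int (- int (Suc j)) * (e1 + trace E)))" .
    also have "\<dots> \<le> ennreal (K * 2 powr \<bar>e1\<bar> * V * 2 powr (real j * - (e1 + trace E)))"
      using K V e1 by (intro ennreal_leI mult_left_mono powr_mono) (auto simp: algebra_simps)
    finally show ?thesis .
  qed
  have b2: "(\<integral>\<^sup>+s. ennreal (G s) * indicator (?s2 j) s \<partial>lborel) \<le> ennreal (K * 2 powr \<bar>e2\<bar> * V * 2 powr (real j * (e2 + trace E)))" for j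
  proof -
    have "G s \<le> K * \<phi> s powr e2" if "s \<in> ?s2 j" for s
    proof (rule large)
      have "2 powr (0::real) \<le> 2 powr real_of_int (int j)" by (intro powr_mono) auto
      then show "1 \<le> \<phi> s" using that by (simp add: shell_def)
    qed (use that in \<open>simp add: shell_def\<close>)
    from nn_integral_shell_le[of "int j" G K e2 "trace E" V, OF this K G V(2) V(1)] show ?thesis by simp
  qed
  have "(\<integral>\<^sup>+s. ennreal (G s) \<partial>lborel) \<le>
      (\<integral>\<^sup>+s. (\<Sum>j. ennreal (G s) * indicator (?s1 j) s) + (\<Sum>j. ennreal (G s) * indicator (?s2 j) s) \<partial>lborel)"
  proof (rule nn_integral_mono_AE)
    have "AE s in lborel. s \<noteq> (0 :: real^'n)" by (rule AE_lborel_singleton)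
    then show "AE s in lborel. ennreal (G s) \<le> (\<Sum>j. ennreal (G s) * indicator (?s1 j) s) + (\<Sum>j. ennreal (G s) * indicator (?s2 j) s)"
    proof eventually_elim
      case (elim s)
      then obtain k where k: "s \<in> shell k" using shell_cover by blast
      have single: "f j \<le> (\<Sum>j. f j)" for f :: "nat \<Rightarrow> ennreal" and j
        using sum_le_suminf[of f "{j}"] by (simp add: summableI)
      show ?case
      proof (cases "k \<ge> 0")
        case True
        then have "s \<in> ?s2 (nat k)" using k by simp
        then have "ennreal (G s) \<le> (\<Sum>j. ennreal (G s) * indicator (?s2 j) s)"
          using single[of "\<lambda>j. ennreal (G s) * indicator (?s2 j) s" "nat k"] by simp
        then show ?thesis by (simp add: add_increasing)
      next
        case False
        then have "- int (Suc (nat (- k - 1))) = k" by simp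
        then have "s \<in> ?s1 (nat (- k - 1))" using k by simp
        then have "ennreal (G s) \<le> (\<Sum>j. ennreal (G s) * indicator (?s1 j) s)"
          using single[of "\<lambda>j. ennreal (G s) * indicator (?s1 j) s" "nat (- k - 1)"] by simp
        then show ?thesis by (simp add: add_increasing2)
      qed
    qed
  qed
  also have "\<dots> = (\<Sum>j. \<integral>\<^sup>+s. ennreal (G s) * indicator (?s1 j) s \<partial>lborel) + (\<Sum>j. \<integral>\<^sup>+s. ennreal (G s) * indicator (?s2 j) s \<partial>lborel)"
  proof -
    have m: "(\<lambda>s. ennreal (G s) * indicator (shell k) s) \<in> borel_measurable lborel" for k by measurable
    show ?thesis
      by (subst nn_integral_add, (intro borel_measurable_suminf_order m)+) (simp only: nn_integral_suminf[OF m])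
  qed
  also have "\<dots> \<le> (\<Sum>j. ennreal (K * 2 powr \<bar>e1\<bar> * V * 2 powr (real j * - (e1 + trace E)))) +
      (\<Sum>j. ennreal (K * 2 powr \<bar>e2\<bar> * V * 2 powr (real j * (e2 + trace E))))"
    by (intro add_mono suminf_le b1 b2 summableI)
  also have "\<dots> < \<infinity>"
    using K V(1) e1 e2 unfolding infinity_ennreal_def ennreal_add_less_top
    by (intro conjI suminf_geometric_finite[unfolded infinity_ennreal_def]) auto
  finally show "(\<integral>\<^sup>+s. ennreal (G s) \<partial>lborel) < \<infinity>" .
qed (use G0 in auto)

end

section \<open>The kernel and its integrability\<close>

definition tilde_scaled :: "complex \<Rightarrow> real^'d^'d \<Rightarrow> real^('d + 'd)^('d + 'd)" where
  "tilde_scaled z B = tilde_matrix (\<chi> i j. z * complex_of_real (B $ i $ j))"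

lemma tilde_kernel: "tilde_matrix (harmonizable_kernel \<phi> B t s) = tilde_scaled (iexp (t \<bullet> s) - 1) (mat_powr (\<phi> s) B)"
  by (simp add: harmonizable_kernel_def tilde_scaled_def)

lemma tilde_scaled_nth:
  "tilde_scaled z B $ Inl i $ Inl j = Re z * B $ i $ j"
  "tilde_scaled z B $ Inl i $ Inr j = - (Im z * B $ i $ j)"
  "tilde_scaled z B $ Inr i = 0"
  by (simp_all add: tilde_scaled_def tilde_matrix_def vec_eq_iff)

lemma tilde_scaled_diff: "tilde_scaled z B - tilde_scaled z' B = tilde_scaled (z - z') B"
proof -
  have "(tilde_scaled z B - tilde_scaled z' B) $ k $ m = tilde_scaled (z - z') B $ k $ m" for k m
    by (cases k; cases m) (simp_all add: tilde_scaled_nth left_diff_distrib)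
  then show ?thesis by (simp add: vec_eq_iff)
qed

text \<open>The norm of matrices is Euclidean in the entries, so the factorisation is exact: the
  kernel has the size of its scalar factor times that of the matrix power.\<close>

lemma norm_tilde_scaled: "norm (tilde_scaled z B) = cmod z * norm B"
proof -
  have "(norm (tilde_scaled z B))\<^sup>2 = (\<Sum>k\<in>UNIV. \<Sum>m\<in>UNIV. (tilde_scaled z B $ k $ m)\<^sup>2)"
    by (simp add: norm_vec_def L2_set_def sum_nonneg)
  also have "\<dots> = (\<Sum>i\<in>UNIV. (\<Sum>j\<in>UNIV. (Re z * B $ i $ j)\<^sup>2) + (\<Sum>j\<in>UNIV. (Im z * B $ i $ j)\<^sup>2))"
    by (simp add: sum_UNIV_Plus tilde_scaled_nth)
  also have "\<dots> = (cmod z)\<^sup>2 * (\<Sum>i\<in>UNIV. \<Sum>j\<in>UNIV. (B $ i $ j)\<^sup>2)"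
    by (simp add: cmod_power2 power_mult_distrib sum_distrib_left sum.distrib[symmetric] distrib_right)
  also have "(\<Sum>i\<in>UNIV. \<Sum>j\<in>UNIV. (B $ i $ j)\<^sup>2) = (norm B)\<^sup>2"
    by (simp add: norm_vec_def L2_set_def sum_nonneg)
  finally have "(norm (tilde_scaled z B))\<^sup>2 = (cmod z * norm B)\<^sup>2" by (simp add: power_mult_distrib)
  then show ?thesis by (rule power2_eq_imp_eq) auto
qed

lemma tilde_scaled_measurable:
  assumes [measurable]: "z \<in> borel_measurable borel" "B \<in> borel_measurable borel"
  shows "(\<lambda>s. tilde_scaled (z s) (B s)) \<in> borel_measurable borel"
proof -
  have "continuous_on UNIV (\<lambda>p :: complex \<times> (real^'d^'d). tilde_scaled (fst p) (snd p) $ k $ m)" for k m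
    by (cases k; cases m) (auto simp: tilde_scaled_nth intro!: continuous_intros)
  then have "continuous_on UNIV (\<lambda>p :: complex \<times> (real^'d^'d). \<chi> k m. tilde_scaled (fst p) (snd p) $ k $ m)"
    by (intro continuous_on_vec_lambda)
  then have m: "(\<lambda>p :: complex \<times> (real^'d^'d). tilde_scaled (fst p) (snd p)) \<in> borel_measurable borel"
    by (intro borel_measurable_continuous_onI) simp
  have "(\<lambda>s. (z s, B s)) \<in> borel_measurable borel" by measurable
  from measurable_compose[OF this m] show ?thesis by simp
qed

text \<open>The two halves of the result are, up to sign, the real and the imaginary part of
  \<open>z\<close> times one and the same vector.\<close>

lemma transpose_tilde_scaled_eq_0:
  assumes "transpose (tilde_scaled z B) *v embed_first v = 0"
  shows "z = 0 \<or> transpose B *v v = 0"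
proof -
  have "(transpose (tilde_scaled z B) *v embed_first v) $ Inl j = Re z * (transpose B *v v) $ j" for j
    by (simp add: matrix_vector_mult_def transpose_def sum_UNIV_Plus tilde_scaled_nth embed_first_def sum_distrib_left mult.assoc)
  moreover have "(transpose (tilde_scaled z B) *v embed_first v) $ Inr j = - Im z * (transpose B *v v) $ j" for j
    by (simp add: matrix_vector_mult_def transpose_def sum_UNIV_Plus tilde_scaled_nth embed_first_def sum_distrib_left mult.assoc sum_negf)
  ultimately have "Re z * (transpose B *v v) $ j = 0" "Im z * (transpose B *v v) $ j = 0" for j
    using assms by (simp_all add: vec_eq_iff)
  then show ?thesis by (auto simp: complex_eq_iff vec_eq_iff)
qed

lemma norm_iexp_minus_one_le: "cmod (iexp x - 1) \<le> min 2 \<bar>x\<bar>"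
  using dist_exp_i_1[of x] abs_sin_x_le_abs_x[of "x / 2"] by auto

locale harmonizable_weight = homogeneous_weight E \<phi>
  for E :: "real^'n^'n" and \<phi> :: "real^'n \<Rightarrow> real" +
  fixes D :: "real^'d^'d" and \<alpha> q a h H :: real
  assumes alpha: "0 < \<alpha>" "\<alpha> < 2" and q: "q = trace E"
    and a: "a = Min (Re ` eigenvalues E)" and h: "h = Min (Re ` eigenvalues D)"
    and H: "H = Max (Re ` eigenvalues D)"
    and lower: "q * (1/2 - 1/\<alpha>) < h" and upper: "H < a"
begin

abbreviation B :: "real^'d^'d" where "B \<equiv> - D - (q / \<alpha>) *\<^sub>R mat 1"

lemma mat_powr_phi_measurable [measurable]: "(\<lambda>s. mat_powr (\<phi> s) B) \<in> borel_measurable borel"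
proof -
  have "(\<lambda>u. mat_exp (u *\<^sub>R B)) \<in> borel_measurable borel"
    by (rule borel_measurable_continuous_onI) (rule continuous_mat_exp)
  then show ?thesis unfolding mat_powr_def by measurable
qed

text \<open>It bounds the kernels of all parameters of norm at most \<kappa> at once, and so serves
  both for a single kernel and for all increments near a point.\<close>

definition dominating :: "real \<Rightarrow> real^'n \<Rightarrow> real" where
  "dominating \<kappa> s = truncated_power \<alpha> (min 2 (\<kappa> * norm s) * norm (mat_powr (\<phi> s) B))"

lemma eigenvalue_bounds:
  "z \<in> eigenvalues E \<Longrightarrow> a \<le> Re z"
  "z \<in> eigenvalues B \<Longrightarrow> - H - q / \<alpha> \<le> Re z \<and> Re z \<le> - h - q / \<alpha>"
proof -
  have fin: "finite (Re ` eigenvalues E)" "finite (Re ` eigenvalues D)" using finite_eigenvalues by blast+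
  show "z \<in> eigenvalues E \<Longrightarrow> a \<le> Re z" unfolding a using fin by simp
  assume "z \<in> eigenvalues B"
  then have "- z - of_real (q / \<alpha>) \<in> eigenvalues D" by (rule eigenvalues_affine)
  then have "Re (- z - of_real (q / \<alpha>)) \<in> Re ` eigenvalues D" by (rule imageI)
  then have "h \<le> Re (- z - of_real (q / \<alpha>))" "Re (- z - of_real (q / \<alpha>)) \<le> H"
    unfolding h H by (rule Min_le[OF fin(2)], rule Max_ge[OF fin(2)])
  then show "- H - q / \<alpha> \<le> Re z \<and> Re z \<le> - h - q / \<alpha>" by simp
qed

text \<open>Near the origin the \<alpha>-th power is used, with \<open>norm s\<close> of order
  \<open>\<phi> s powr (a - e)\<close>; at infinity the square, with the bounded factor 2. The
  spectral estimates need a strict margin in the exponents, which the strict hypotheses on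
  \<open>h\<close> and \<open>H\<close> provide.\<close>

lemma integrable_dominating:
  assumes "0 \<le> \<kappa>"
  shows "integrable lborel (dominating \<kappa>)"
proof -
  \<comment> \<open>A quarter of the gap: after two losses of \<open>e\<close> the shell exponent
    near the origin is still \<open>\<alpha> * (2 * e) > 0\<close>.\<close>
  define e where "e = (a - H) / 4"
  \<comment> \<open>Twice the gap in the lower bound on \<open>h\<close>. Giving up
    \<open>\<theta> / 4\<close> in the growth rate leaves the shell exponent
    \<open>- \<theta> / 2 < 0\<close> at infinity.\<close>
  define \<theta> where "\<theta> = 2 * h + 2 * (q / \<alpha>) - q"
  have e: "e > 0" using upper by (simp add: e_def)
  have \<theta>: "\<theta> > 0" using lower by (simp add: \<theta>_def algebra_simps)
  obtain R where R: "R > 0" "\<And>s. s \<noteq> 0 \<Longrightarrow> norm s \<le> R * norm (mat_powr (\<phi> s) E)"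
    using norm_le_mat_powr by blast
  have "a - e < Re z" if "z \<in> eigenvalues E" for z using eigenvalue_bounds(1)[OF that] e by simp
  then obtain C1 where C1: "C1 > 0" "\<And>c. 0 < c \<Longrightarrow> c \<le> 1 \<Longrightarrow> norm (mat_powr c E) \<le> C1 * c powr (a - e)"
    using mat_powr_bound_small[of E "a - e"] by metis
  have "- H - q / \<alpha> - e < Re z" if "z \<in> eigenvalues B" for z using eigenvalue_bounds(2)[OF that] e by simp
  then obtain C2 where C2: "C2 > 0" "\<And>c. 0 < c \<Longrightarrow> c \<le> 1 \<Longrightarrow> norm (mat_powr c B) \<le> C2 * c powr (- H - q / \<alpha> - e)"
    using mat_powr_bound_small[of B "- H - q / \<alpha> - e"] by metis
  have "Re z < - h - q / \<alpha> + \<theta> / 4" if "z \<in> eigenvalues B" for z using eigenvalue_bounds(2)[OF that] \<theta> by simp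
  then obtain C3 where C3: "C3 > 0" "\<And>c. 1 \<le> c \<Longrightarrow> norm (mat_powr c B) \<le> C3 * c powr (- h - q / \<alpha> + \<theta> / 4)"
    using mat_powr_bound_large[of B "- h - q / \<alpha> + \<theta> / 4"] by metis
  define c1 where "c1 = \<kappa> * (R * C1) * C2"
  have c1: "c1 \<ge> 0" using assms R C1 C2 by (simp add: c1_def)
  define K where "K = max (c1 powr \<alpha>) ((2 * C3)\<^sup>2)"
  define u where "u = a - e + (- H - q / \<alpha> - e)"
  define b where "b = - h - q / \<alpha> + \<theta> / 4"
  show ?thesis
  proof (rule integrable_power_weight[where K=K and ?e1.0="u * \<alpha>" and ?e2.0="b * 2"])
    show "dominating \<kappa> \<in> borel_measurable borel" unfolding dominating_def[abs_def] by measurable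
    show "0 \<le> dominating \<kappa> s" for s by (simp add: dominating_def)
    show "0 \<le> K" by (simp add: K_def max.coboundedI1)
    have "u * \<alpha> + q = \<alpha> * (a - H - 2 * e)" using alpha by (simp add: u_def field_simps)
    also have "a - H - 2 * e = 2 * e" by (simp add: e_def field_simps)
    finally have "u * \<alpha> + q = \<alpha> * (2 * e)" .
    then show "0 < u * \<alpha> + trace E" using alpha e unfolding q[symmetric] by simp
    have "b * 2 + q = - \<theta> / 2" by (simp add: b_def \<theta>_def field_simps)
    then show "b * 2 + trace E < 0" using \<theta> unfolding q[symmetric] by simp
    fix s :: "real^'n" assume s: "s \<noteq> 0"
    note p = pos[OF s]
    {
      assume le: "\<phi> s \<le> 1"
      have "norm s \<le> R * (C1 * \<phi> s powr (a - e))"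
        using R(2)[OF s] C1(2)[OF p le] R(1) by (meson mult_left_mono order_trans less_imp_le)
      then have n: "\<kappa> * norm s \<le> \<kappa> * (R * (C1 * \<phi> s powr (a - e)))" using assms by (intro mult_left_mono)
      have "min 2 (\<kappa> * norm s) * norm (mat_powr (\<phi> s) B) \<le>
          (\<kappa> * (R * (C1 * \<phi> s powr (a - e)))) * (C2 * \<phi> s powr (- H - q / \<alpha> - e))"
        using n C2(2)[OF p le] assms R C1 by (intro mult_mono) (auto intro: order_trans[OF min.cobounded2])
      also have "\<dots> = c1 * \<phi> s powr u" by (simp only: c1_def u_def powr_add mult_ac)
      finally have m: "min 2 (\<kappa> * norm s) * norm (mat_powr (\<phi> s) B) \<le> c1 * \<phi> s powr u" .
      have "dominating \<kappa> s \<le> (min 2 (\<kappa> * norm s) * norm (mat_powr (\<phi> s) B)) powr \<alpha>"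
        by (simp add: dominating_def truncated_power_def)
      also have "\<dots> \<le> (c1 * \<phi> s powr u) powr \<alpha>"
        using m assms alpha by (intro powr_mono2) auto
      also have "\<dots> = c1 powr \<alpha> * \<phi> s powr (u * \<alpha>)"
        using c1 by (simp add: powr_mult powr_powr)
      also have "\<dots> \<le> K * \<phi> s powr (u * \<alpha>)" by (intro mult_right_mono) (auto simp: K_def)
      finally show "dominating \<kappa> s \<le> K * \<phi> s powr (u * \<alpha>)" .
    }
    {
      assume ge: "1 \<le> \<phi> s"
      have "min 2 (\<kappa> * norm s) * norm (mat_powr (\<phi> s) B) \<le> 2 * (C3 * \<phi> s powr b)"
        using C3(2)[OF ge] assms by (intro mult_mono) (auto simp: b_def)
      then have "(min 2 (\<kappa> * norm s) * norm (mat_powr (\<phi> s) B))\<^sup>2 \<le> (2 * (C3 * \<phi> s powr b))\<^sup>2"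
        using assms by (intro power_mono) auto
      also have "\<dots> = (2 * C3)\<^sup>2 * \<phi> s powr (b * 2)"
        using p by (simp add: power_mult_distrib powr_powr[symmetric] powr_numeral)
      also have "\<dots> \<le> K * \<phi> s powr (b * 2)" by (intro mult_right_mono) (auto simp: K_def)
      finally show "dominating \<kappa> s \<le> K * \<phi> s powr (b * 2)"
        by (auto simp: dominating_def truncated_power_def)
    }
  qed
qed

lemma increment_le_dominating:
  assumes "norm v \<le> \<kappa>"
  shows "truncated_power \<alpha> (cmod (iexp (v \<bullet> s) - 1) * norm (mat_powr (\<phi> s) B)) \<le> dominating \<kappa> s"
  unfolding dominating_def
proof (intro truncated_power_mono mult_right_mono)
  have "\<bar>v \<bullet> s\<bar> \<le> \<kappa> * norm s"
    using Cauchy_Schwarz_ineq2[of v s] mult_right_mono[OF assms, of "norm s"] by simp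
  then show "cmod (iexp (v \<bullet> s) - 1) \<le> min 2 (\<kappa> * norm s)"
    using norm_iexp_minus_one_le[of "v \<bullet> s"] by linarith
qed (use alpha in auto)

lemma integrable_increment:
  "integrable lborel (\<lambda>s. truncated_power \<alpha> (cmod (iexp (v \<bullet> s) - 1) * norm (mat_powr (\<phi> s) B)))"
  by (rule Bochner_Integration.integrable_bound[OF integrable_dominating[of "norm v"]])
     (auto intro!: AE_I2 order_trans[OF increment_le_dominating[OF order_refl]])

lemma increment_tendsto_0:
  "((\<lambda>t. LINT s|lborel. truncated_power \<alpha> (cmod (iexp ((t - t0) \<bullet> s) - 1) * norm (mat_powr (\<phi> s) B))) \<longlongrightarrow> 0) (at t0)"
  unfolding tendsto_at_iff_sequentially
proof (intro allI impI)
  fix X :: "nat \<Rightarrow> real^'n" assume "X \<longlonglongrightarrow> t0"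
  then have v: "(\<lambda>n. X n - t0) \<longlonglongrightarrow> 0" by (simp add: LIM_zero)
  then have "eventually (\<lambda>n. norm (X n - t0) < 1) sequentially"
    using tendsto_norm_zero[OF v] by (intro order_tendstoD(2)) auto
  then obtain N where N: "\<And>n. n \<ge> N \<Longrightarrow> norm (X n - t0) < 1" by (auto simp: eventually_sequentially)
  let ?F = "\<lambda>n s. truncated_power \<alpha> (cmod (iexp ((X n - t0) \<bullet> s) - 1) * norm (mat_powr (\<phi> s) B))"
  have "(\<lambda>n. LINT s|lborel. ?F (n + N) s) \<longlonglongrightarrow> (LINT s|(lborel :: (real^'n) measure). 0)"
  proof (rule integral_dominated_convergence[where w="dominating 1"])
    show "integrable lborel (dominating 1)" by (rule integrable_dominating) simp
    show "AE s in lborel. (\<lambda>n. ?F (n + N) s) \<longlonglongrightarrow> 0"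
    proof (rule AE_I2, rule tendsto_sandwich[OF _ _ tendsto_const])
      fix s :: "real^'n"
      show "eventually (\<lambda>n. ?F (n + N) s \<le> (cmod (iexp ((X (n + N) - t0) \<bullet> s) - 1) * norm (mat_powr (\<phi> s) B))\<^sup>2) sequentially"
        by (simp add: truncated_power_def)
      have "(\<lambda>n. (cmod (iexp ((X (n + N) - t0) \<bullet> s) - 1) * norm (mat_powr (\<phi> s) B))\<^sup>2) \<longlonglongrightarrow>
          (cmod (iexp (0 \<bullet> s) - 1) * norm (mat_powr (\<phi> s) B))\<^sup>2"
        by (intro tendsto_intros LIMSEQ_ignore_initial_segment[OF v])
      then show "(\<lambda>n. (cmod (iexp ((X (n + N) - t0) \<bullet> s) - 1) * norm (mat_powr (\<phi> s) B))\<^sup>2) \<longlonglongrightarrow> 0" by simp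
    qed simp
    show "AE s in lborel. norm (?F (n + N) s) \<le> dominating 1 s" for n
    proof (rule AE_I2)
      fix s
      have "norm (X (n + N) - t0) \<le> 1" using N[of "n + N"] by simp
      from increment_le_dominating[OF this] show "norm (?F (n + N) s) \<le> dominating 1 s" by simp
    qed
  qed auto
  then have "(\<lambda>n. LINT s|lborel. ?F n s) \<longlonglongrightarrow> 0"
    by (intro LIMSEQ_offset[of "\<lambda>n. LINT s|lborel. ?F n s" N]) simp
  then show "((\<lambda>t. LINT s|lborel. truncated_power \<alpha> (cmod (iexp ((t - t0) \<bullet> s) - 1) * norm (mat_powr (\<phi> s) B))) \<circ> X) \<longlonglongrightarrow> 0"
    by (simp add: comp_def)
qed

lemma kernel_measurable: "(\<lambda>s. tilde_matrix (harmonizable_kernel \<phi> B t s)) \<in> borel_measurable borel"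
  unfolding tilde_kernel by (intro tilde_scaled_measurable) measurable

lemma integrable_kernel:
  "integrable lborel (\<lambda>s. truncated_power \<alpha> (norm (tilde_matrix (harmonizable_kernel \<phi> B t s))))"
  unfolding tilde_kernel norm_tilde_scaled by (rule integrable_increment)

text \<open>The matrix power is an exponential and hence invertible, so only the scalar factor of
  the kernel can vanish.\<close>

lemma transpose_kernel_eq_0:
  assumes "transpose (tilde_matrix (harmonizable_kernel \<phi> B t s)) *v embed_first v = 0" "v \<noteq> 0"
  shows "iexp (t \<bullet> s) = 1"
proof (rule ccontr)
  assume "iexp (t \<bullet> s) \<noteq> 1"
  with assms(1) have "transpose (mat_powr (\<phi> s) B) *v v = 0"
    unfolding tilde_kernel using transpose_tilde_scaled_eq_0 by fastforce
  then have "mat_exp (ln (\<phi> s) *\<^sub>R transpose B) *v v = 0"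
    by (simp add: mat_powr_def mat_exp_transpose)
  then have "v = 0"
    using mat_exp_cancel[of "- ln (\<phi> s)" "transpose B" v] by simp
  with assms(2) show False by simp
qed

end

section \<open>The harmonizable field\<close>

locale harmonizable_field =
  tempered_scattered \<alpha> l \<sigma> P M + harmonizable_weight E \<phi> D \<alpha> q a h H
  for \<alpha> l :: real and \<sigma> :: "(real^('d::finite + 'd)) measure" and P :: "'w measure"
    and M :: "(real^'n::finite) set \<Rightarrow> 'w \<Rightarrow> real^('d + 'd)"
    and E :: "real^'n^'n" and \<phi> :: "real^'n \<Rightarrow> real" and D :: "real^'d^'d" and q a h H :: real +
  assumes not_in_hyperspace: "not_in_hyperspace \<sigma>"
begin

abbreviation kernel :: "real^'n \<Rightarrow> real^'n \<Rightarrow> real^('d + 'd)^('d + 'd)" where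
  "kernel t \<equiv> \<lambda>s. tilde_matrix (harmonizable_kernel \<phi> B t s)"

lemma kernel_integral_exists: "\<exists>X. has_stoch_integral P M (kernel t) X"
  by (rule sc.has_stoch_integral_exists[OF kernel_measurable integrable_kernel])

context
  fixes X :: "real^'n \<Rightarrow> 'w \<Rightarrow> real^('d + 'd)"
  assumes X: "\<And>t. has_stoch_integral P M (kernel t) (X t)"
begin

lemma field_measurable [measurable]: "X t \<in> borel_measurable P"
  using X[of t] unfolding has_stoch_integral_def by (elim conjE)

text \<open>The tail of an increment is bounded by a gauge integral that depends on
  \<open>t - t0\<close> alone. With one tail constant for all \<open>t\<close>, the claim reduces to
  \<open>increment_tendsto_0\<close>.\<close>

lemma field_stochastically_continuous: "stochastically_continuous P (\<lambda>t \<omega>. first_half (X t \<omega>))"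
  unfolding stochastically_continuous_def tendsto_in_prob_def
proof (intro allI impI)
  fix t0 :: "real^'n" and \<delta> :: real assume "0 < \<delta>"
  show "((\<lambda>t. measure P {\<omega>\<in>space P. norm (first_half (X t \<omega>) - first_half (X t0 \<omega>)) > \<delta>}) \<longlongrightarrow> 0) (at t0)"
  proof -
    obtain K where K: "sc.tail_constant \<delta> K" using sc.tail_bound[OF \<open>0 < \<delta>\<close>] by blast
    let ?J = "\<lambda>t. LINT s|lborel. truncated_power \<alpha> (cmod (iexp ((t - t0) \<bullet> s) - 1) * norm (mat_powr (\<phi> s) B))"
    have le: "measure P {\<omega>\<in>space P. norm (first_half (X t \<omega>) - first_half (X t0 \<omega>)) > \<delta>} \<le> K * ?J t" for t
    proof -
      let ?G = "\<lambda>s. kernel t s - kernel t0 s"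
      have nG: "norm (?G s) = cmod (iexp ((t - t0) \<bullet> s) - 1) * norm (mat_powr (\<phi> s) B)" for s
      proof -
        have "iexp (t \<bullet> s) - 1 - (iexp (t0 \<bullet> s) - 1) = iexp (t0 \<bullet> s) * (iexp ((t - t0) \<bullet> s) - 1)"
          by (simp add: inner_diff_left algebra_simps exp_diff)
        then show ?thesis
          by (simp only: tilde_kernel tilde_scaled_diff norm_tilde_scaled norm_mult norm_exp_i_times mult_1)
      qed
      have char: "(CLINT \<omega>|P. iexp (w \<bullet> (X t \<omega> - X t0 \<omega>))) = exp (of_real (- (LINT s|lborel. exponent (transpose (?G s) *v w))))" for w
      proof -
        \<comment> \<open>The difference of two given versions is read as a pair with the vectors
          \<open>w\<close> and \<open>- w\<close>, so the joint characteristic function replaces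
          linearity of the integral.\<close>
        let ?f = "\<lambda>b. kernel (if b then t else t0)" and ?w = "\<lambda>b. if b then w else - w"
        have u: "(\<Sum>b\<in>UNIV. transpose (?f b s) *v ?w b) = transpose (?G s) *v w" for s
          by (simp add: UNIV_bool transpose_def matrix_vector_mult_def vec_eq_iff sum_negf sum_subtractf left_diff_distrib)
        have Z: "(\<Sum>b\<in>UNIV. ?w b \<bullet> X (if b then t else t0) \<omega>) = w \<bullet> (X t \<omega> - X t0 \<omega>)" for \<omega>
          by (simp add: UNIV_bool inner_diff_right)
        show ?thesis
          using sc.char_stoch_integral(2)[of ?f "\<lambda>b. X (if b then t else t0)" ?w, OF X] by (simp only: u Z)
      qed
      have "measure P {\<omega>\<in>space P. norm (first_half (X t \<omega>) - first_half (X t0 \<omega>)) > \<delta>} \<le>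
          measure P {\<omega>\<in>space P. norm (X t \<omega> - X t0 \<omega>) > \<delta>}"
      proof (rule sc.finite_measure_mono)
        show "{\<omega>\<in>space P. norm (first_half (X t \<omega>) - first_half (X t0 \<omega>)) > \<delta>} \<subseteq> {\<omega>\<in>space P. norm (X t \<omega> - X t0 \<omega>) > \<delta>}"
          by (auto simp: first_half_linear(2)[symmetric] intro: less_le_trans norm_first_half_le)
        show "{\<omega>\<in>space P. norm (X t \<omega> - X t0 \<omega>) > \<delta>} \<in> sets P" by measurable
      qed
      also have "\<dots> \<le> K * (LINT s|lborel. truncated_power \<alpha> (norm (?G s)))"
      proof (rule sc.tail_constantD[OF K _ _ _ char])
        show "?G \<in> borel_measurable borel" by (intro borel_measurable_diff kernel_measurable)
        show "integrable lborel (\<lambda>s. truncated_power \<alpha> (norm (?G s)))" unfolding nG by (rule integrable_increment)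
      qed measurable
      finally show ?thesis unfolding nG .
    qed
    have lim: "((\<lambda>t. K * ?J t) \<longlongrightarrow> 0) (at t0)"
      by (rule tendsto_mult_right_zero[OF increment_tendsto_0])
    show "((\<lambda>t. measure P {\<omega>\<in>space P. norm (first_half (X t \<omega>) - first_half (X t0 \<omega>)) > \<delta>}) \<longlongrightarrow> 0) (at t0)"
      by (rule tendsto_sandwich[OF _ _ tendsto_const lim]) (intro always_eventually allI measure_nonneg le)+
  qed
qed

text \<open>If \<open>v \<bullet> Y t\<close> were a.s. constant, its characteristic function would have modulus one, so that
  the exponent would vanish along the kernel; but \<open>iexp (t \<bullet> s) \<noteq> 1\<close> on an open set of \<open>s\<close>.\<close>

lemma field_full:
  assumes "t \<noteq> 0"
  shows "full (distr P borel (\<lambda>\<omega>. first_half (X t \<omega>)))"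
  unfolding full_def
proof (intro allI impI notI)
  fix v :: "real^'d" and c :: real
  assume v: "v \<noteq> 0" and "AE x in distr P borel (\<lambda>\<omega>. first_half (X t \<omega>)). v \<bullet> x = c"
  then have ae: "AE \<omega> in P. embed_first v \<bullet> X t \<omega> = c"
    by (simp add: AE_distr_iff inner_first_half)
  let ?u = "\<lambda>s. transpose (kernel t s) *v embed_first v"
  have iu: "integrable lborel (\<lambda>s. exponent (?u s))"
    and cu: "(CLINT \<omega>|P. iexp (embed_first v \<bullet> X t \<omega>)) = exp (of_real (- (LINT s|lborel. exponent (?u s))))"
    using sc.char_stoch_integral[of "\<lambda>_ :: unit. kernel t" "\<lambda>_. X t" "\<lambda>_. embed_first v", OF X]
    by (simp_all add: UNIV_unit del: of_real_minus)
  have "(\<lambda>\<omega>. embed_first v \<bullet> X t \<omega>) \<in> borel_measurable P"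
    by (intro borel_measurable_inner borel_measurable_const field_measurable)
  then have "(\<lambda>\<omega>. iexp (embed_first v \<bullet> X t \<omega>)) \<in> borel_measurable P" by measurable
  moreover have "AE \<omega> in P. iexp (embed_first v \<bullet> X t \<omega>) = iexp c"
    using ae by eventually_elim simp
  ultimately have "(CLINT \<omega>|P. iexp (embed_first v \<bullet> X t \<omega>)) = (CLINT \<omega>|P. iexp c)"
    by (intro integral_cong_AE) auto
  also have "\<dots> = iexp c" by (simp add: sc.prob_space)
  finally have "cmod (exp (of_real (- (LINT s|lborel. exponent (?u s))))) = 1"
    unfolding cu by (simp only: norm_exp_i_times)
  then have "(LINT s|lborel. exponent (?u s)) = 0"
    by (simp only: norm_exp_eq_Re Re_complex_of_real exp_eq_one_iff neg_equal_0_iff_equal)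
  then have "AE s in lborel. exponent (?u s) = 0"
    using integral_nonneg_eq_0_iff_AE[OF iu] exponent_nonneg by auto
  then have ae1: "AE s in lborel. iexp (t \<bullet> s) = 1"
  proof eventually_elim
    case (elim s)
    have "?u s = 0"
      by (rule exponent_eq_0_imp[OF exponential_tempering_axioms not_in_hyperspace elim])
    then show ?case by (rule transpose_kernel_eq_0[OF _ v])
  qed
  \<comment> \<open>An open slab on which the cosine stays below 1. It contains the multiple of
    \<open>t\<close> whose inner product with \<open>t\<close> is \<open>1 < pi\<close>.\<close>
  let ?U = "{s. 0 < t \<bullet> s} \<inter> {s. t \<bullet> s < pi}"
  have "open ?U" by (intro open_Int open_halfspace_gt open_halfspace_lt)
  have "AE s in lborel. s \<notin> ?U"
    using ae1
  proof eventually_elim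
    case (elim s)
    then have "cos (t \<bullet> s) = 1" by (metis Re_exp cis.sel(1) cis_conv_exp one_complex.sel(1))
    then show ?case using cos_monotone_0_pi[of 0 "t \<bullet> s"] by auto
  qed
  then have "?U \<in> null_sets lborel"
    using AE_iff_null_sets[of ?U lborel] \<open>open ?U\<close> by (auto simp: borel_open)
  then have "?U \<in> null_sets lebesgue" by (rule null_sets_completionI)
  then have "negligible ?U" by (simp add: negligible_iff_null_sets)
  then have "?U = {}" using open_not_negligible[OF \<open>open ?U\<close>] by blast
  moreover have "(1 / (t \<bullet> t)) *\<^sub>R t \<in> ?U" using assms pi_gt3 by simp
  ultimately show False by blast
qed

end

end

theorem theorem3p5:
  fixes P :: "'w measure"
    and \<sigma> :: "(real^('d::finite + 'd)) measure"
    and M :: "(real^'n::finite) set \<Rightarrow> 'w \<Rightarrow> complex^'d"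
    and E :: "real^'n^'n" and D :: "real^'d^'d"
    and \<phi> :: "real^'n \<Rightarrow> real"
    and g :: "real^'n \<Rightarrow> real^'n \<Rightarrow> complex^'d^'d"
    and \<alpha> l q a h H :: real
  assumes "0 < \<alpha>" and "\<alpha> < 2" and "0 < l"
    and "sphere_measure \<sigma>" and "symmetric_measure \<sigma>" and "not_in_hyperspace \<sigma>"
    and "complex_exp_tempered_stable_measure P \<alpha> l \<sigma> M"
    and "Q_matrix E" and "q = trace E" and "a = Min (Re ` eigenvalues E)"
    and "continuous_on UNIV \<phi>" and "\<forall>x. 0 \<le> \<phi> x"
    and "adjoint_homogeneous E \<phi>" and "\<forall>x. x \<noteq> 0 \<longrightarrow> 0 < \<phi> x"
    and "h = Min (Re ` eigenvalues D)" and "H = Max (Re ` eigenvalues D)"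
    and "q * (1/2 - 1/\<alpha>) < h" and "h \<le> H" and "H < a"
    and "g = harmonizable_kernel \<phi> (- D - (q/\<alpha>) *\<^sub>R mat 1)"
  shows "(\<forall>t. \<exists>Z. has_Re_integral P M (g t) Z) \<and>
    (\<forall>Y. (\<forall>t. has_Re_integral P M (g t) (Y t)) \<longrightarrow>
       (\<forall>t :: 'k::finite \<Rightarrow> real^'n.
          tempered_stable \<alpha> (distr P borel (\<lambda>\<omega>. (\<chi> j. Y (t j) \<omega>) :: real^'d^'k))) \<and>
       stochastically_continuous P Y \<and>
       (\<forall>t. t \<noteq> 0 \<longrightarrow> full (distr P borel (Y t))))"
proof -
  \<comment> \<open>The identification of complex values with real vectors of twice the dimension is
    made once; taking real parts then becomes \<open>first_half\<close>.\<close>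
  define M' where "M' = (\<lambda>A \<omega>. realify (M A \<omega>))"
  interpret harmonizable_field \<alpha> l \<sigma> P M' E \<phi> D q a h H
    by unfold_locales
       (use assms in \<open>auto simp: M'_def complex_exp_tempered_stable_measure_def\<close>)
  have g: "(\<lambda>s. tilde_matrix (g t s)) = kernel t" for t
    by (simp add: assms(20))
  have Re_integral: "has_Re_integral P M (g t) Y \<longleftrightarrow>
      (\<exists>X. has_stoch_integral P M' (kernel t) X \<and> Y = (\<lambda>\<omega>. first_half (X \<omega>)))" for t Y
    by (simp add: has_Re_integral_def g M'_def first_half_def)
  show ?thesis
  proof (intro conjI allI impI)
    show "\<exists>Z. has_Re_integral P M (g t) Z" for t
      unfolding Re_integral using kernel_integral_exists by blast
    fix Y assume "\<forall>t. has_Re_integral P M (g t) (Y t)"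
    \<comment> \<open>The versions \<open>Y\<close> are arbitrary, so a full integral is chosen for
      each \<open>t\<close> separately. No compatibility between the choices is required, since
      joint characteristic functions are the same for all versions.\<close>
    then obtain X where X: "\<And>t. has_stoch_integral P M' (kernel t) (X t)"
      and Y: "\<And>t. Y t = (\<lambda>\<omega>. first_half (X t \<omega>))"
      unfolding Re_integral by metis
    show "tempered_stable \<alpha> (distr P borel (\<lambda>\<omega>. (\<chi> j. Y (t j) \<omega>) :: real^'d^'k))" for t :: "'k \<Rightarrow> real^'n"
      unfolding Y by (rule tempered_stable_stacked[OF X integrable_kernel])
    show "stochastically_continuous P Y"
      using field_stochastically_continuous[OF X] by (simp add: Y[abs_def] fun_eq_iff[symmetric])
    show "full (distr P borel (Y t))" if "t \<noteq> 0" for t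
      unfolding Y by (rule field_full[OF X that])
  qed
qed

end
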